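(* Let $0\le \alpha<1$ and put \[ q_\alpha=\frac{2}{1+\alpha},\qquad r_\alpha=\frac{2}{1-\alpha}, \] so that $1<q_\alpha\le 2\le r_\alpha<\infty$. Then: (i) $J_B[\mathcal{T},\boldsymbol{H}_{-\alpha}]=J_B[\mathcal{T}^{\mathbb{R}},\boldsymbol{H}_{-\alpha}]=J_B[\mathcal{T}^{\mathbb{R}},\boldsymbol{H}^{\mathbb{R}}_{-\alpha}]=[2,\infty]$; (ii) $J_H[\mathcal{T},\boldsymbol{H}_{-\alpha}]=J_H[\mathcal{T}^{\mathbb{R}},\boldsymbol{H}_{-\alpha}]=J_H[\mathcal{T}^{\mathbb{R}},\boldsymbol{H}^{\mathbb{R}}_{-\alpha}]=[1,q_\alpha]$; (iii) $J_B[\mathcal{T},\boldsymbol{H}_{\alpha}]=J_B[\mathcal{T}^{\mathbb{R}},\boldsymbol{H}_{\alpha}]=J_B[\mathcal{T}^{\mathbb{R}},\boldsymbol{H}^{\mathbb{R}}_{\alpha}]=[r_\alpha,\infty]$; (iv) $J_H[\mathcal{T},\boldsymbol{H}_{\alpha}]=J_H[\mathcal{T}^{\mathbb{R}},\boldsymbol{H}_{\alpha}]=J_H[\mathcal{T}^{\mathbb{R}},\boldsymbol{H}^{\mathbb{R}}_{\alpha}]=[1,2]$.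
   Context: For $-1<\lambda<1$, let $\boldsymbol{H}_\lambda=L_2([-1/2,1/2],|t|^\lambda\,dt;\mathbb{C})$ (complex Hilbert space) and $\boldsymbol{H}^{\mathbb{R}}_\lambda=L_2([-1/2,1/2],|t|^\lambda\,dt;\mathbb{R})$ (real Hilbert space). For $n\in\mathbb{Z}$ let $\tau_n(t)=e^{2\pi i n t}$, $t\in[-1/2,1/2]$. The complex trigonometric system is $\mathcal{T}=(\phi_n)_{n=0}^\infty$ with $\phi_{2n}=\tau_{-n}$ and $\phi_{2n+1}=\tau_{n+1}$ for $n\ge 0$. The real trigonometric system is $\mathcal{T}^{\mathbb{R}}=(\phi^{\mathbb{R}}_n)_{n=0}^\infty$ with $\phi^{\mathbb{R}}_0=1$, $\phi^{\mathbb{R}}_{2k-1}(t)=\cos(2\pi kt)$, $\phi^{\mathbb{R}}_{2k}(t)=\sin(2\pi k t)$ for $k\ge1$. It is known that, for $-1<\lambda<1$, $\mathcal{T}$ is a semi-normalized Schauder basis of $\boldsymbol{H}_\lambda$ and $\mathcal{T}^{\mathbb{R}}$ is a semi-normalized Schauder basis of both $\boldsymbol{H}_\lambda$ and $\boldsymbol{H}^{\mathbb{R}}_\lambda$. Let $\mathcal{X}=(\boldsymbol{x}_n)$ be a Schauder basis of a Banach space $\mathbb{X}$ with coordinate functionals $(\boldsymbol{x}_n^* )$. For $r\in[1,\infty]$, $\mathcal{X}$ is $r$-Besselian if $f\mapsto(\boldsymbol{x}_n^*(f))_n$ is a bounded operator from $\mathbb{X}$ into $\ell_r$. For $q\in[1,\infty]$,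 $\mathcal{X}$ is $q$-Hilbertian if $(a_n)_n\mapsto\sum_n a_n\boldsymbol{x}_n$ is a bounded operator from $\ell_q$ into $\mathbb{X}$. Define $J_B[\mathcal{X},\mathbb{X}]=\{r\in[1,\infty]:\mathcal{X}\text{ is }r\text{-Besselian}\}$ and $J_H[\mathcal{X},\mathbb{X}]=\{q\in[1,\infty]:\mathcal{X}\text{ is }q\text{-Hilbertian}\}$. *)

theory Defs
  imports "HOL-Analysis.Analysis"
begin

text \<open>
  A normed space of functions over the scalar field \<open>'k\<close> is given by its set of vectors and
  its norm, with pointwise operations. As usual for \<open>L\<^sub>2\<close>, vectors are representatives: two
  functions denote the same element if the norm of their difference vanishes. All notions below
  depend on vectors only up to this identification.
\<close>

record ('s, 'k) fun_space =
  vectors :: "('s \<Rightarrow> 'k) set"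
  vnorm :: "('s \<Rightarrow> 'k) \<Rightarrow> real"

definition expands ::
  "('s, 'k::real_normed_field) fun_space \<Rightarrow> (nat \<Rightarrow> 's \<Rightarrow> 'k) \<Rightarrow> (nat \<Rightarrow> 'k) \<Rightarrow> ('s \<Rightarrow> 'k) \<Rightarrow> bool"
  where "expands X x a f \<longleftrightarrow> (\<lambda>n. vnorm X (\<lambda>t. f t - (\<Sum>k<n. a k * x k t))) \<longlonglongrightarrow> 0"

definition schauder_basis ::
  "('s, 'k::real_normed_field) fun_space \<Rightarrow> (nat \<Rightarrow> 's \<Rightarrow> 'k) \<Rightarrow> bool"
  where "schauder_basis X x \<longleftrightarrow>
    (\<forall>n. x n \<in> vectors X) \<and> (\<forall>f\<in>vectors X. \<exists>!a. expands X x a f)"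

definition coords ::
  "('s, 'k::real_normed_field) fun_space \<Rightarrow> (nat \<Rightarrow> 's \<Rightarrow> 'k) \<Rightarrow> ('s \<Rightarrow> 'k) \<Rightarrow> nat \<Rightarrow> 'k"
  where "coords X x f = (THE a. expands X x a f)"

definition ell :: "ereal \<Rightarrow> (nat \<Rightarrow> 'k::real_normed_field) set"
  where "ell r = {a. if r = \<infinity> then bdd_above (range (\<lambda>n. norm (a n)))
                     else summable (\<lambda>n. norm (a n) powr real_of_ereal r)}"

definition ell_norm :: "ereal \<Rightarrow> (nat \<Rightarrow> 'k::real_normed_field) \<Rightarrow> real"
  where "ell_norm r a = (if r = \<infinity> then (SUP n. norm (a n))
           else (\<Sum>n. norm (a n) powr real_of_ereal r) powr (1 / real_of_ereal r))"

text \<open>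
  Being Besselian or Hilbertian is a property of Schauder bases, so the basis property is part
  of both definitions. Linearity of the two operators is automatic; only well-definedness and
  boundedness are stated.
\<close>

definition besselian ::
  "ereal \<Rightarrow> (nat \<Rightarrow> 's \<Rightarrow> 'k::real_normed_field) \<Rightarrow> ('s, 'k) fun_space \<Rightarrow> bool"
  where "besselian r x X \<longleftrightarrow> schauder_basis X x \<and>
    (\<exists>C. \<forall>f\<in>vectors X. coords X x f \<in> ell r \<and> ell_norm r (coords X x f) \<le> C * vnorm X f)"

definition hilbertian ::
  "ereal \<Rightarrow> (nat \<Rightarrow> 's \<Rightarrow> 'k::real_normed_field) \<Rightarrow> ('s, 'k) fun_space \<Rightarrow> bool"
  where "hilbertian q x X \<longleftrightarrow> schauder_basis X x \<and>
    (\<exists>C. \<forall>a\<in>ell q. \<exists>f\<in>vectors X. expands X x a f \<and> vnorm X f \<le> C * ell_norm q a)"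

definition J_B :: "(nat \<Rightarrow> 's \<Rightarrow> 'k::real_normed_field) \<Rightarrow> ('s, 'k) fun_space \<Rightarrow> ereal set"
  where "J_B x X = {r\<in>{1..\<infinity>}. besselian r x X}"

definition J_H :: "(nat \<Rightarrow> 's \<Rightarrow> 'k::real_normed_field) \<Rightarrow> ('s, 'k) fun_space \<Rightarrow> ereal set"
  where "J_H x X = {q\<in>{1..\<infinity>}. hilbertian q x X}"

text \<open>
  The measure \<open>|t|\<^sup>s dt\<close> on \<open>[-1/2, 1/2]\<close>. In Isabelle \<open>0 powr s = 0\<close>, which only
  affects a null set. Every Lebesgue measurable function agrees almost everywhere with a Borel
  one, so using \<open>lborel\<close> does not change the space \<open>L\<^sub>2\<close>. Values of vectors outside
  \<open>[-1/2, 1/2]\<close> are irrelevant.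
\<close>

definition power_measure :: "real \<Rightarrow> real measure"
  where "power_measure s =
    density (restrict_space lborel {-1/2..1/2}) (\<lambda>t. ennreal (\<bar>t\<bar> powr s))"

definition L2_space :: "'s measure \<Rightarrow> ('s, 'k::real_normed_field) fun_space"
  where "L2_space M =
    \<lparr> vectors = {f \<in> borel_measurable M. integrable M (\<lambda>t. (norm (f t))\<^sup>2)},
      vnorm = (\<lambda>f. sqrt (integral\<^sup>L M (\<lambda>t. (norm (f t))\<^sup>2))) \<rparr>"

definition H_complex :: "real \<Rightarrow> (real, complex) fun_space"
  where "H_complex s = L2_space (power_measure s)"

definition H_real :: "real \<Rightarrow> (real, real) fun_space"
  where "H_real s = L2_space (power_measure s)"

definition tau :: "int \<Rightarrow> real \<Rightarrow> complex"
  where "tau n t = exp (2 * of_real pi * \<i> * of_int n * of_real t)"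

definition trig :: "nat \<Rightarrow> real \<Rightarrow> complex"
  where "trig n = (if even n then tau (- int (n div 2)) else tau (int (n div 2) + 1))"

definition real_trig :: "nat \<Rightarrow> real \<Rightarrow> real"
  where "real_trig n t =
    (if n = 0 then 1
     else if odd n then cos (2 * pi * real ((n + 1) div 2) * t)
     else sin (2 * pi * real (n div 2) * t))"

text \<open>The real system regarded as a system in the complex space.\<close>

definition real_trig_complex :: "nat \<Rightarrow> real \<Rightarrow> complex"
  where "real_trig_complex n t = complex_of_real (real_trig n t)"

end

theory Submission
  imports Defs
begin

text \<open>
  On \<open>H s\<close>, \<open>\<bar>s\<bar> < 1\<close>, the partial sum operators are uniformly bounded: conjugating the Dirichlet
  kernel by the weight \<open>\<bar>t\<bar> powr (s/2)\<close> changes it by at most a kernel of homogeneity \<open>-1\<close> in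
  \<open>(\<bar>s\<bar>, \<bar>t\<bar>)\<close>, which is bounded on the unweighted \<open>L\<^sub>2\<close> by Schur's test with the test
  function \<open>\<bar>t\<bar> powr (-1/2)\<close>. With the density of trigonometric polynomials this gives the basis
  property, and the coordinates are the Fourier coefficients.

  Since \<open>H (-\<alpha>)\<close> is contained in \<open>L\<^sub>2\<close>, Bessel's inequality makes the systems 2-Besselian there;
  dually they are 2-Hilbertian in \<open>H \<alpha>\<close>. Splitting a function at \<open>\<bar>t\<bar> = \<delta>\<close> and integrating over the
  level gives Pitt's inequality, which is the \<open>r\<close>-Besselian property in \<open>H \<alpha>\<close>, and dually the
  \<open>q\<close>-Hilbertian property in \<open>H (-\<alpha>)\<close>.

  The exponents are optimal. In a Hilbert space a suitable choice of signs makes the norm of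
  \<open>\<Sum>k<n. \<plusminus> x k\<close> at most, or at least, of order \<open>sqrt n\<close>, which excludes Besselian exponents below 2
  and Hilbertian exponents above 2. A Dirichlet kernel of order \<open>n\<close> is of size \<open>n\<close> on
  \<open>\<bar>t\<bar> \<le> c/n\<close>, and the indicator of \<open>\<bar>t\<bar> \<le> c/n\<close> has about \<open>n\<close> coefficients of size \<open>1/n\<close>; these
  two give the bounds for \<open>q\<close> and \<open>r\<close>.
\<close>

section \<open>The seminorm of \<open>L\<^sub>2\<close>\<close>

text \<open>The kernel estimate is stated with
  \<open>\<bar>\<bar>s\<bar> - \<bar>t\<bar>\<bar>\<close> in place of |s - t|. On the circle the
  Dirichlet kernel is also large where s - t is near 1 or -1; the quantity ||s| - |t|| is at most |s
  - t| and at most 1 - |s - t|, so it absorbs both singularities. The weight is even, so its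
  increment vanishes where |s| = |t| and cancels this factor. What remains is dominated by a
  positive kernel, and no singular integral has to be treated: the oscillating part is the
  unweighted partial sum, which orthogonality alone controls. The test requires |s/2| < 1/2, which
  is the whole range |s| < 1. Duality refers to the unweighted pairing, under which
  \<open>H (-s)\<close> is the dual of \<open>H s\<close>. The Fourier coefficients are therefore
  given by the same integrals for all s, and each Hilbertian estimate is the adjoint of a Besselian
  one.\<close>

lemma vectors_L2_iff:
  "f \<in> vectors (L2_space M) \<longleftrightarrow> f \<in> borel_measurable M \<and> integrable M (\<lambda>t. (norm (f t))\<^sup>2)"
  by (simp add: L2_space_def)

lemma L2_measurable [measurable_dest]:
  "f \<in> vectors (L2_space M) \<Longrightarrow> f \<in> borel_measurable M"
  by (simp add: vectors_L2_iff)

lemma vnorm_L2: "vnorm (L2_space M) f = sqrt (\<integral>t. (norm (f t))\<^sup>2 \<partial>M)"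
  by (simp add: L2_space_def)

lemma vnorm_L2_nonneg [simp]: "0 \<le> vnorm (L2_space M) f"
  by (simp add: vnorm_L2)

lemma vnorm_L2_sq: "(vnorm (L2_space M) f)\<^sup>2 = (\<integral>t. (norm (f t))\<^sup>2 \<partial>M)"
  by (simp add: vnorm_L2)

lemma nn_integral_L2:
  assumes "f \<in> vectors (L2_space M)"
  shows "(\<integral>\<^sup>+t. ennreal ((norm (f t))\<^sup>2) \<partial>M) = ennreal ((vnorm (L2_space M) f)\<^sup>2)"
  using assms unfolding vnorm_L2_sq vectors_L2_iff by (intro nn_integral_eq_integral) auto

text \<open>Bounds are proved in \<open>ennreal\<close>, where no integrability has to be known
  beforehand; membership and the norm bound then follow together.\<close>

lemma L2_boundI:
  assumes [measurable]: "f \<in> borel_measurable M"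
    and le: "(\<integral>\<^sup>+t. ennreal ((norm (f t))\<^sup>2) \<partial>M) \<le> ennreal (c\<^sup>2)" and "0 \<le> c"
  shows "f \<in> vectors (L2_space M)" "vnorm (L2_space M) f \<le> c"
proof -
  have int: "integrable M (\<lambda>t. (norm (f t))\<^sup>2)"
  proof (rule integrableI_bounded)
    show "(\<integral>\<^sup>+t. ennreal (norm ((norm (f t))\<^sup>2)) \<partial>M) < \<infinity>"
      using le_less_trans[OF le ennreal_less_top] by simp
  qed measurable
  then show v: "f \<in> vectors (L2_space M)"
    by (simp add: vectors_L2_iff)
  have "(vnorm (L2_space M) f)\<^sup>2 \<le> c\<^sup>2"
    using le unfolding nn_integral_L2[OF v] ennreal_le_iff[OF zero_le_power2] .
  then show "vnorm (L2_space M) f \<le> c"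
    using \<open>0 \<le> c\<close> by (rule power2_le_imp_le)
qed

lemma L2_vnorm_mono:
  assumes "g \<in> vectors (L2_space M)" and [measurable]: "f \<in> borel_measurable M"
    and "AE t in M. norm (f t) \<le> norm (g t)"
  shows "f \<in> vectors (L2_space M)" "vnorm (L2_space M) f \<le> vnorm (L2_space M) g"
proof -
  have "(\<integral>\<^sup>+t. ennreal ((norm (f t))\<^sup>2) \<partial>M) \<le> ennreal ((vnorm (L2_space M) g)\<^sup>2)"
    unfolding nn_integral_L2[OF assms(1), symmetric]
    by (rule nn_integral_mono_AE) (use assms(3) in eventually_elim, auto intro: power_mono)
  from L2_boundI[OF assms(2) this]
  show "f \<in> vectors (L2_space M)" "vnorm (L2_space M) f \<le> vnorm (L2_space M) g" by auto
qed

lemma vnorm_L2_cong_AE: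
  assumes "AE t in M. f t = g t" "f \<in> borel_measurable M" "g \<in> borel_measurable M"
  shows "vnorm (L2_space M) f = vnorm (L2_space M) g"
  unfolding vnorm_L2 using assms by (intro arg_cong[where f=sqrt] integral_cong_AE) auto

lemma ennreal_power2_le_imp_le:
  assumes "x\<^sup>2 \<le> (ennreal c)\<^sup>2" "0 \<le> c"
  shows "x \<le> ennreal c"
proof (cases x)
  case (real r)
  then have "r\<^sup>2 \<le> c\<^sup>2" using assms by (simp add: ennreal_power)
  then show ?thesis using real assms(2) by (auto intro: ennreal_leI power2_le_imp_le)
next
  case top
  then show ?thesis using assms by (simp add: ennreal_power top_unique power2_eq_square ennreal_mult_eq_top_iff)
qed

text \<open>Two value types are allowed because the completeness proof pairs a vector-valued
  function with the real constant 1.\<close>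

lemma L2_Cauchy_Schwarz:
  fixes f :: "'s \<Rightarrow> 'a::{real_normed_field,euclidean_space}"
    and g :: "'s \<Rightarrow> 'b::{real_normed_field,euclidean_space}"
  assumes f: "f \<in> vectors (L2_space M)" and g: "g \<in> vectors (L2_space M)"
  shows "integrable M (\<lambda>t. norm (f t) * norm (g t))"
    and "(\<integral>t. norm (f t) * norm (g t) \<partial>M) \<le> vnorm (L2_space M) f * vnorm (L2_space M) g"
proof -
  let ?c = "vnorm (L2_space M) f * vnorm (L2_space M) g"
  note [measurable] = f[THEN L2_measurable] g[THEN L2_measurable]
  have "(\<integral>\<^sup>+t. ennreal (norm (f t)) * ennreal (norm (g t)) \<partial>M)\<^sup>2
      \<le> ennreal ((vnorm (L2_space M) f)\<^sup>2) * ennreal ((vnorm (L2_space M) g)\<^sup>2)"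
    unfolding nn_integral_L2[OF f, symmetric] nn_integral_L2[OF g, symmetric]
    using Cauchy_Schwarz_nn_integral[of "\<lambda>t. ennreal (norm (f t))" M "\<lambda>t. ennreal (norm (g t))"]
    by (simp add: ennreal_power)
  also have "\<dots> = (ennreal ?c)\<^sup>2"
    by (simp add: ennreal_power power_mult_distrib flip: ennreal_mult)
  finally have le: "(\<integral>\<^sup>+t. ennreal (norm (f t) * norm (g t)) \<partial>M) \<le> ennreal ?c"
    by (subst ennreal_mult) (auto intro: ennreal_power2_le_imp_le)
  show "integrable M (\<lambda>t. norm (f t) * norm (g t))"
    by (rule integrableI_bounded) (use le_less_trans[OF le ennreal_less_top] in simp_all)
  then have "ennreal (\<integral>t. norm (f t) * norm (g t) \<partial>M) \<le> ennreal ?c"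
    using le by (subst (asm) nn_integral_eq_integral) auto
  then show "(\<integral>t. norm (f t) * norm (g t) \<partial>M) \<le> ?c"
    by simp
qed

lemma L2_mult_integrable:
  fixes f g :: "'s \<Rightarrow> 'k::{real_normed_field,euclidean_space}"
  assumes f: "f \<in> vectors (L2_space M)" and g: "g \<in> vectors (L2_space M)"
  shows "integrable M (\<lambda>t. f t * g t)"
  by (rule Bochner_Integration.integrable_bound[OF L2_Cauchy_Schwarz(1)[OF f g]])
     (use f g in \<open>auto simp: vectors_L2_iff norm_mult\<close>)

lemma L2_add:
  fixes f g :: "'s \<Rightarrow> 'k::{real_normed_field,euclidean_space}"
  assumes f: "f \<in> vectors (L2_space M)" and g: "g \<in> vectors (L2_space M)"
  shows "(\<lambda>t. f t + g t) \<in> vectors (L2_space M)"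
    and "vnorm (L2_space M) (\<lambda>t. f t + g t) \<le> vnorm (L2_space M) f + vnorm (L2_space M) g"
proof -
  note [measurable] = f[THEN L2_measurable] g[THEN L2_measurable]
  let ?h = "\<lambda>t. (norm (f t))\<^sup>2 + 2 * (norm (f t) * norm (g t)) + (norm (g t))\<^sup>2"
  have h: "integrable M ?h"
    using f g L2_Cauchy_Schwarz(1)[OF f g] by (auto simp: vectors_L2_iff)
  have le: "(norm (f t + g t))\<^sup>2 \<le> ?h t" for t
    using power_mono[OF norm_triangle_ineq[of "f t" "g t"], of 2] by (simp add: power2_sum algebra_simps)
  show v: "(\<lambda>t. f t + g t) \<in> vectors (L2_space M)"
    unfolding vectors_L2_iff
    by (intro conjI Bochner_Integration.integrable_bound[OF h])
       (use le in \<open>auto simp: abs_of_nonneg intro: order_trans[OF le]\<close>)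
  have "(vnorm (L2_space M) (\<lambda>t. f t + g t))\<^sup>2 \<le> integral\<^sup>L M ?h"
    unfolding vnorm_L2_sq using v h le by (intro integral_mono) (auto simp: vectors_L2_iff)
  also have "\<dots> = (vnorm (L2_space M) f)\<^sup>2 + 2 * (\<integral>t. norm (f t) * norm (g t) \<partial>M)
        + (vnorm (L2_space M) g)\<^sup>2"
    using f g L2_Cauchy_Schwarz(1)[OF f g] by (simp add: vectors_L2_iff vnorm_L2_sq)
  also have "\<dots> \<le> (vnorm (L2_space M) f + vnorm (L2_space M) g)\<^sup>2"
    using L2_Cauchy_Schwarz(2)[OF f g] by (simp add: power2_sum)
  finally show "vnorm (L2_space M) (\<lambda>t. f t + g t) \<le> vnorm (L2_space M) f + vnorm (L2_space M) g"
    by (rule power2_le_imp_le) simp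
qed

lemma L2_cmult:
  fixes f :: "'s \<Rightarrow> 'k::{real_normed_field,euclidean_space}"
  assumes f: "f \<in> vectors (L2_space M)"
  shows "(\<lambda>t. c * f t) \<in> vectors (L2_space M)"
    and "vnorm (L2_space M) (\<lambda>t. c * f t) = norm c * vnorm (L2_space M) f"
  using f by (auto simp: vectors_L2_iff vnorm_L2 norm_mult power_mult_distrib real_sqrt_mult)

lemma L2_diff:
  fixes f g :: "'s \<Rightarrow> 'k::{real_normed_field,euclidean_space}"
  assumes f: "f \<in> vectors (L2_space M)" and g: "g \<in> vectors (L2_space M)"
  shows "(\<lambda>t. f t - g t) \<in> vectors (L2_space M)"
    and "vnorm (L2_space M) (\<lambda>t. f t - g t) \<le> vnorm (L2_space M) f + vnorm (L2_space M) g"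
  using L2_add[OF f L2_cmult(1)[OF g, of "-1"]] L2_cmult(2)[OF g, of "-1"] by auto

lemma vnorm_L2_minus_commute:
  "vnorm (L2_space M) (\<lambda>t. f t - g t) = vnorm (L2_space M) (\<lambda>t. g t - f t)"
  by (simp add: vnorm_L2 norm_minus_commute)

lemma vnorm_L2_triangle_sub:
  fixes f g :: "'s \<Rightarrow> 'k::{real_normed_field,euclidean_space}"
  assumes f: "f \<in> vectors (L2_space M)" and g: "g \<in> vectors (L2_space M)"
  shows "vnorm (L2_space M) f \<le> vnorm (L2_space M) (\<lambda>t. f t - g t) + vnorm (L2_space M) g"
  using L2_add(2)[OF L2_diff(1)[OF f g] g] by simp

lemma L2_zero: "(\<lambda>t. 0) \<in> vectors (L2_space M)"
  by (simp add: vectors_L2_iff)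

lemma L2_sum:
  fixes f :: "'i \<Rightarrow> 's \<Rightarrow> 'k::{real_normed_field,euclidean_space}"
  assumes "\<And>i. i \<in> A \<Longrightarrow> f i \<in> vectors (L2_space M)"
  shows "(\<lambda>t. \<Sum>i\<in>A. f i t) \<in> vectors (L2_space M)"
  using assms by (induction A rule: infinite_finite_induct) (auto intro: L2_zero L2_add(1))

lemma L2_lincomb:
  fixes x :: "nat \<Rightarrow> 's \<Rightarrow> 'k::{real_normed_field,euclidean_space}"
  assumes "\<And>i. x i \<in> vectors (L2_space M)"
  shows "(\<lambda>t. \<Sum>i\<in>A. a i * x i t) \<in> vectors (L2_space M)"
  by (intro L2_sum L2_cmult assms)

lemma (in finite_measure) L2_bounded:
  fixes f :: "'a \<Rightarrow> 'k::{real_normed_field,euclidean_space}"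
  assumes [measurable]: "f \<in> borel_measurable M" and "\<And>t. norm (f t) \<le> B"
  shows "f \<in> vectors (L2_space M)" "vnorm (L2_space M) f \<le> B * sqrt (measure M (space M))"
proof -
  have B: "0 \<le> B" by (rule order_trans[OF norm_ge_zero assms(2)])
  have "(\<integral>\<^sup>+t. ennreal ((norm (f t))\<^sup>2) \<partial>M) \<le> (\<integral>\<^sup>+t. ennreal (B\<^sup>2) \<partial>M)"
    by (intro nn_integral_mono ennreal_leI power_mono assms) auto
  also have "\<dots> = ennreal ((B * sqrt (measure M (space M)))\<^sup>2)"
    using B by (simp add: power_mult_distrib emeasure_eq_measure ennreal_mult)
  finally show "f \<in> vectors (L2_space M)" "vnorm (L2_space M) f \<le> B * sqrt (measure M (space M))"
    using L2_boundI[OF assms(1)] B by simp_all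
qed

lemma L2_parallelogram:
  fixes f g :: "'s \<Rightarrow> 'k::{real_normed_field,euclidean_space}"
  assumes f: "f \<in> vectors (L2_space M)" and g: "g \<in> vectors (L2_space M)"
  shows "(vnorm (L2_space M) (\<lambda>t. f t + g t))\<^sup>2 + (vnorm (L2_space M) (\<lambda>t. f t - g t))\<^sup>2
    = 2 * (vnorm (L2_space M) f)\<^sup>2 + 2 * (vnorm (L2_space M) g)\<^sup>2"
proof -
  have "(norm (f t + g t))\<^sup>2 + (norm (f t - g t))\<^sup>2 = 2 * (norm (f t))\<^sup>2 + 2 * (norm (g t))\<^sup>2" for t
    by (simp add: power2_norm_eq_inner inner_simps inner_commute)
  then have "(\<integral>t. (norm (f t + g t))\<^sup>2 + (norm (f t - g t))\<^sup>2 \<partial>M)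
      = (\<integral>t. 2 * (norm (f t))\<^sup>2 + 2 * (norm (g t))\<^sup>2 \<partial>M)" by simp
  then show ?thesis
    unfolding vnorm_L2_sq using f g L2_add(1)[OF f g] L2_diff(1)[OF f g]
    by (simp add: vectors_L2_iff)
qed

text \<open>The Riesz-Fischer argument: a rapidly Cauchy subsequence converges almost everywhere,
  and Fatou's lemma turns this into norm convergence of the full sequence. The Hilbertian property
  needs it to produce the sum of a series.\<close>

lemma (in finite_measure) L2_complete:
  fixes F :: "nat \<Rightarrow> 'a \<Rightarrow> 'k::{real_normed_field,euclidean_space}"
  assumes F: "\<And>n. F n \<in> vectors (L2_space M)"
    and Cauchy: "\<And>e. 0 < e \<Longrightarrow> \<exists>N. \<forall>m\<ge>N. \<forall>n\<ge>N. vnorm (L2_space M) (\<lambda>t. F m t - F n t) < e"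
  obtains f where "f \<in> vectors (L2_space M)" "(\<lambda>n. vnorm (L2_space M) (\<lambda>t. f t - F n t)) \<longlonglongrightarrow> 0"
proof -
  note [measurable] = F[THEN L2_measurable]
  have "\<forall>k. \<exists>N. \<forall>m\<ge>N. \<forall>n\<ge>N. vnorm (L2_space M) (\<lambda>t. F m t - F n t) < (1/2)^k"
    using Cauchy by simp
  then obtain \<phi>0 where \<phi>0: "\<And>k m n. m \<ge> \<phi>0 k \<Longrightarrow> n \<ge> \<phi>0 k \<Longrightarrow>
      vnorm (L2_space M) (\<lambda>t. F m t - F n t) < (1/2)^k" by metis
  \<comment> \<open>Adding k and summing the thresholds makes the indices nondecreasing, unbounded
    and at least \<open>\<phi>0 k\<close>.\<close>
  define \<phi> where "\<phi> k = k + (\<Sum>i\<le>k. \<phi>0 i)" for k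
  have \<phi>_mono: "\<phi> k \<le> \<phi> (Suc k)" and \<phi>_ge: "\<phi>0 k \<le> \<phi> k" "k \<le> \<phi> k" for k
    by (auto simp: \<phi>_def intro: trans_le_add2 member_le_sum)
  define G where "G k = F (\<phi> k)" for k
  have G [measurable]: "G k \<in> borel_measurable M" for k by (simp add: G_def)
  define \<mu> where "\<mu> = sqrt (measure M (space M))"
  have one: "(\<lambda>t. 1::real) \<in> vectors (L2_space M)" "vnorm (L2_space M) (\<lambda>t. 1::real) \<le> \<mu>"
    by (rule L2_bounded(1)[of _ 1], simp, simp) (use L2_bounded(2)[of "\<lambda>t. 1::real" 1] in \<open>simp add: \<mu>_def\<close>)
  \<comment> \<open>Since the measure is finite, Cauchy-Schwarz against 1 controls the increments in
    the norm of L_1, where they can be summed under the integral.\<close>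
  have step: "(\<integral>\<^sup>+t. ennreal (norm (G (Suc k) t - G k t)) \<partial>M) \<le> ennreal (\<mu> * (1/2)^k)" for k
  proof -
    have v: "(\<lambda>t. G (Suc k) t - G k t) \<in> vectors (L2_space M)"
      unfolding G_def by (rule L2_diff(1)[OF F F])
    note CS = L2_Cauchy_Schwarz[OF v one(1)]
    have "(\<integral>\<^sup>+t. ennreal (norm (G (Suc k) t - G k t)) \<partial>M) = ennreal (\<integral>t. norm (G (Suc k) t - G k t) \<partial>M)"
      by (rule nn_integral_eq_integral) (use CS(1) in simp_all)
    also have "\<dots> \<le> ennreal (vnorm (L2_space M) (\<lambda>t. G (Suc k) t - G k t) * vnorm (L2_space M) (\<lambda>t. 1::real))"
      by (rule ennreal_leI) (use CS(2) in simp)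
    also have "\<dots> \<le> ennreal ((1/2)^k * \<mu>)"
    proof (intro ennreal_leI mult_mono one(2))
      have "\<phi>0 k \<le> \<phi> (Suc k)" using \<phi>_ge(1)[of k] \<phi>_mono[of k] by (rule order_trans)
      then show "vnorm (L2_space M) (\<lambda>t. G (Suc k) t - G k t) \<le> (1/2)^k"
        unfolding G_def using \<phi>0[OF _ \<phi>_ge(1)[of k]] by (simp add: less_imp_le)
    qed simp_all
    finally show ?thesis by (simp add: mult.commute)
  qed
  have "(\<integral>\<^sup>+t. (\<Sum>k. ennreal (norm (G (Suc k) t - G k t))) \<partial>M)
      = (\<Sum>k. \<integral>\<^sup>+t. ennreal (norm (G (Suc k) t - G k t)) \<partial>M)"
    by (rule nn_integral_suminf) simp
  also have "\<dots> \<le> (\<Sum>k. ennreal (\<mu> * (1/2)^k))"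
    by (intro suminf_le step) auto
  also have "\<dots> = ennreal (\<Sum>k. \<mu> * (1/2)^k)"
    by (intro suminf_ennreal2) (auto simp: \<mu>_def intro!: summable_mult)
  also have "\<dots> < \<infinity>" by simp
  finally have "AE t in M. (\<Sum>k. ennreal (norm (G (Suc k) t - G k t))) \<noteq> \<infinity>"
    by (intro nn_integral_noteq_infinite) auto
  then have conv: "AE t in M. (\<lambda>k. G k t) \<longlonglongrightarrow> lim (\<lambda>k. G k t)"
  proof eventually_elim
    case (elim t)
    then have "summable (\<lambda>k. G (Suc k) t - G k t)"
      by (intro summable_norm_cancel[OF summable_suminf_not_top]) auto
    then have "convergent (\<lambda>k. G k t - G 0 t)"
      unfolding summable_iff_convergent sum_lessThan_telescope[of "\<lambda>k. G k t"] .
    then have "convergent (\<lambda>k. G k t)"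
      using convergent_diff_const_right_iff[of "\<lambda>k. G k t" "G 0 t"] by simp
    then show ?case by (simp add: convergent_LIMSEQ_iff)
  qed
  define f where "f t = lim (\<lambda>k. G k t)" for t
  have f_meas [measurable]: "f \<in> borel_measurable M" unfolding f_def by (intro borel_measurable_lim_metric G)
  \<comment> \<open>Fatou's lemma along the subsequence: a bound on the distance from
    \<open>F n\<close> to all late \<open>F m\<close> survives in the limit.\<close>
  have tail: "(\<integral>\<^sup>+t. ennreal ((norm (f t - F n t))\<^sup>2) \<partial>M) \<le> ennreal (e\<^sup>2)"
    if e: "0 \<le> e" and N: "\<And>m. m \<ge> N \<Longrightarrow> vnorm (L2_space M) (\<lambda>t. F m t - F n t) \<le> e" for n N e
  proof -
    have "(\<integral>\<^sup>+t. ennreal ((norm (f t - F n t))\<^sup>2) \<partial>M)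
        = (\<integral>\<^sup>+t. liminf (\<lambda>k. ennreal ((norm (G k t - F n t))\<^sup>2)) \<partial>M)"
    proof (rule nn_integral_cong_AE, use conv in eventually_elim)
      case (elim t)
      then have "(\<lambda>k. ennreal ((norm (G k t - F n t))\<^sup>2)) \<longlonglongrightarrow> ennreal ((norm (f t - F n t))\<^sup>2)"
        unfolding f_def by (intro tendsto_intros)
      then show ?case by (intro lim_imp_Liminf[symmetric]) simp_all
    qed
    also have "\<dots> \<le> liminf (\<lambda>k. \<integral>\<^sup>+t. ennreal ((norm (G k t - F n t))\<^sup>2) \<partial>M)"
      by (rule nn_integral_liminf) simp
    also have "\<dots> \<le> liminf (\<lambda>k. ennreal (e\<^sup>2))"
    proof (rule Liminf_mono, rule eventually_mono[OF eventually_ge_at_top[of N]])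
      fix k assume "N \<le> k"
      then have "N \<le> \<phi> k" using \<phi>_ge(2)[of k] by (rule order_trans)
      then have "(vnorm (L2_space M) (\<lambda>t. F (\<phi> k) t - F n t))\<^sup>2 \<le> e\<^sup>2"
        by (intro power_mono N) simp_all
      then show "(\<integral>\<^sup>+t. ennreal ((norm (G k t - F n t))\<^sup>2) \<partial>M) \<le> ennreal (e\<^sup>2)"
        unfolding G_def nn_integral_L2[OF L2_diff(1)[OF F F]] by (rule ennreal_leI)
    qed
    also have "\<dots> = ennreal (e\<^sup>2)" by (simp add: Liminf_const)
    finally show ?thesis .
  qed
  obtain N1 where N1: "\<And>m n. m \<ge> N1 \<Longrightarrow> n \<ge> N1 \<Longrightarrow> vnorm (L2_space M) (\<lambda>t. F m t - F n t) < 1"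
    using Cauchy[OF zero_less_one] by metis
  have "(\<integral>\<^sup>+t. ennreal ((norm (f t - F N1 t))\<^sup>2) \<partial>M) \<le> ennreal (1\<^sup>2)"
    by (rule tail[of 1 N1]) (simp_all add: N1 less_imp_le)
  then have "(\<lambda>t. f t - F N1 t) \<in> vectors (L2_space M)"
    by (rule L2_boundI(1)[rotated]) auto
  from L2_add(1)[OF this F[of N1]] have "f \<in> vectors (L2_space M)"
    by (simp only: diff_add_cancel)
  moreover have "(\<lambda>n. vnorm (L2_space M) (\<lambda>t. f t - F n t)) \<longlonglongrightarrow> 0"
  proof (rule LIMSEQ_I)
    fix e :: real assume "0 < e"
    then obtain N where N: "\<And>m n. m \<ge> N \<Longrightarrow> n \<ge> N \<Longrightarrow> vnorm (L2_space M) (\<lambda>t. F m t - F n t) < e/2"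
      using Cauchy[OF half_gt_zero[OF \<open>0 < e\<close>]] by metis
    show "\<exists>N. \<forall>n\<ge>N. norm (vnorm (L2_space M) (\<lambda>t. f t - F n t) - 0) < e"
    proof (intro exI[of _ N] allI impI)
      fix n assume "N \<le> n"
      have "(\<integral>\<^sup>+t. ennreal ((norm (f t - F n t))\<^sup>2) \<partial>M) \<le> ennreal ((e/2)\<^sup>2)"
        by (rule tail[of "e/2" N]) (use \<open>0 < e\<close> N \<open>N \<le> n\<close> in \<open>simp_all add: less_imp_le\<close>)
      then have "vnorm (L2_space M) (\<lambda>t. f t - F n t) \<le> e/2"
        by (rule L2_boundI(2)[rotated]) (use \<open>0 < e\<close> in auto)
      then show "norm (vnorm (L2_space M) (\<lambda>t. f t - F n t) - 0) < e"
        using \<open>0 < e\<close> by simp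
    qed
  qed
  ultimately show ?thesis by (rule that)
qed

section \<open>Power weights\<close>

definition leb :: "real measure"
  where "leb = restrict_space lborel {-1/2..1/2}"

abbreviation H :: "real \<Rightarrow> (real, 'k::real_normed_field) fun_space"
  where "H s \<equiv> L2_space (power_measure s)"

text \<open>Since 0 powr c = 0 for every c, the composition law \<open>wt_wt\<close> holds at 0 as
  well, whereas \<open>wt 0\<close> is the identity only almost everywhere.\<close>

definition wt :: "real \<Rightarrow> (real \<Rightarrow> 'k::real_normed_field) \<Rightarrow> real \<Rightarrow> 'k"
  where "wt c f t = of_real (\<bar>t\<bar> powr c) * f t"

lemma space_leb [simp]: "space leb = {-1/2..1/2}"
  by (simp add: leb_def space_restrict_space)

lemma finite_measure_leb: "finite_measure leb"
  by (intro finite_measureI) (simp add: leb_def emeasure_restrict_space space_restrict_space)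

lemma measure_leb_space: "measure leb (space leb) = 1"
  by (simp add: leb_def measure_restrict_space space_restrict_space)

lemma sets_power_measure [measurable_cong]: "sets (power_measure s) = sets leb"
  by (simp add: power_measure_def leb_def)

lemma space_power_measure: "space (power_measure s) = {-1/2..1/2}"
  by (simp add: power_measure_def space_restrict_space)

lemma measurable_power_measure: "f \<in> borel_measurable (power_measure s) \<longleftrightarrow> f \<in> borel_measurable leb"
  using measurable_cong_sets[OF sets_power_measure refl] by blast

lemma borel_measurable_leb: "f \<in> borel_measurable borel \<Longrightarrow> f \<in> borel_measurable leb"
  unfolding leb_def by (intro measurable_restrict_space1) simp

lemma nn_integral_power_measure:
  assumes "f \<in> borel_measurable leb"
  shows "(\<integral>\<^sup>+t. f t \<partial>power_measure s) = (\<integral>\<^sup>+t. ennreal (\<bar>t\<bar> powr s) * f t \<partial>leb)"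
  unfolding power_measure_def leb_def[symmetric]
  by (rule nn_integral_density[OF borel_measurable_leb assms]) measurable

lemma AE_leb_nonzero: "AE t in leb. t \<noteq> c"
proof -
  have "AE t in lborel. t \<noteq> c" using AE_lborel_singleton[of c] by eventually_elim auto
  then show ?thesis unfolding leb_def by (subst AE_restrict_space_iff) (auto elim: eventually_mono)
qed

lemma AE_power_measureI:
  assumes "AE t in leb. P t"
  shows "AE t in power_measure s. P t"
  unfolding power_measure_def leb_def[symmetric]
  by (subst AE_density[OF borel_measurable_leb]) (measurable, rule AE_mp[OF assms], simp)

text \<open>The two half-intervals share the point 0, which does no harm in an upper bound.\<close>

lemma nn_integral_even_le:
  assumes [measurable]: "h \<in> borel_measurable borel"
  shows "(\<integral>\<^sup>+t. h \<bar>t\<bar> \<partial>leb) \<le> 2 * (\<integral>\<^sup>+t\<in>{0..1/2}. h t \<partial>lborel)"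
proof -
  have "(\<integral>\<^sup>+t. h \<bar>t\<bar> \<partial>leb) = (\<integral>\<^sup>+t\<in>{-1/2..1/2}. h \<bar>t\<bar> \<partial>lborel)"
    unfolding leb_def by (subst nn_integral_restrict_space) auto
  also have "\<dots> \<le> (\<integral>\<^sup>+t. h \<bar>t\<bar> * indicator {-1/2..0} t + h \<bar>t\<bar> * indicator {0..1/2} t \<partial>lborel)"
    by (intro nn_integral_mono) (auto split: split_indicator)
  also have "\<dots> = (\<integral>\<^sup>+t\<in>{-1/2..0}. h \<bar>t\<bar> \<partial>lborel) + (\<integral>\<^sup>+t\<in>{0..1/2}. h \<bar>t\<bar> \<partial>lborel)"
    by (intro nn_integral_add) auto
  also have "(\<integral>\<^sup>+t\<in>{-1/2..0}. h \<bar>t\<bar> \<partial>lborel) = (\<integral>\<^sup>+t\<in>{0..1/2}. h \<bar>t\<bar> \<partial>lborel)"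
    by (subst nn_integral_real_affine[where c = "-1" and t = 0]) 
       (auto intro!: nn_integral_cong split: split_indicator)
  also have "(\<integral>\<^sup>+t\<in>{0..1/2}. h \<bar>t\<bar> \<partial>lborel) = (\<integral>\<^sup>+t\<in>{0..1/2}. h t \<partial>lborel)"
    by (intro nn_integral_cong) (auto split: split_indicator)
  finally show ?thesis by (simp add: mult_2)
qed

lemma nn_integral_powr_0:
  assumes "-1 < a" "0 \<le> c"
  shows "(\<integral>\<^sup>+t\<in>{0..c}. ennreal (t powr a) \<partial>lborel) = ennreal (c powr (a + 1) / (a + 1))"
proof -
  have "(\<integral>\<^sup>+t. ennreal (indicator {0..c} t * t powr a) \<partial>lborel) = ennreal (c powr (a + 1) / (a + 1))"
    by (rule nn_integral_has_integral_lebesgue[OF _ has_integral_powr_from_0[OF assms]]) simp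
  then show ?thesis
    by (simp add: ennreal_mult ennreal_indicator mult.commute)
qed

lemma nn_integral_powr_inf:
  assumes "a < -1" "0 < c"
  shows "(\<integral>\<^sup>+t\<in>{c..}. ennreal (t powr a) \<partial>lborel) = ennreal (c powr (a + 1) / - (a + 1))"
proof -
  have "(\<integral>\<^sup>+t. ennreal (indicator {c..} t * t powr a) \<partial>lborel) = ennreal (- (c powr (a + 1)) / (a + 1))"
    by (rule nn_integral_has_integral_lebesgue[OF _ has_integral_powr_to_inf[OF assms]]) simp
  also have "- (c powr (a + 1)) / (a + 1) = c powr (a + 1) / - (a + 1)"
    using assms by (simp add: field_simps)
  finally show ?thesis
    by (simp add: ennreal_mult ennreal_indicator mult.commute)
qed

lemma nn_integral_abs_powr_le:
  assumes "-1 < a" "0 \<le> c"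
  shows "(\<integral>\<^sup>+t. ennreal (\<bar>t\<bar> powr a) * indicator {..c} \<bar>t\<bar> \<partial>leb) \<le> ennreal (2 * c powr (a + 1) / (a + 1))"
proof -
  have "(\<integral>\<^sup>+t. ennreal (\<bar>t\<bar> powr a) * indicator {..c} \<bar>t\<bar> \<partial>leb)
      \<le> 2 * (\<integral>\<^sup>+t\<in>{0..1/2}. ennreal (t powr a) * indicator {..c} t \<partial>lborel)"
    by (rule nn_integral_even_le[of "\<lambda>t. ennreal (t powr a) * indicator {..c} t"]) measurable
  also have "(\<integral>\<^sup>+t\<in>{0..1/2}. ennreal (t powr a) * indicator {..c} t \<partial>lborel)
      \<le> (\<integral>\<^sup>+t\<in>{0..c}. ennreal (t powr a) \<partial>lborel)"
    by (intro nn_integral_mono) (auto split: split_indicator)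
  also have "\<dots> = ennreal (c powr (a + 1) / (a + 1))"
    by (rule nn_integral_powr_0[OF assms])
  also have "2 * \<dots> = ennreal (2 * c powr (a + 1) / (a + 1))"
    using assms by (subst times_divide_eq_right[symmetric], subst ennreal_mult) auto
  finally show ?thesis by (simp add: mult_left_mono)
qed

lemma finite_power_measure:
  assumes "-1 < s"
  shows "finite_measure (power_measure s)"
proof (rule finite_measureI)
  have "emeasure (power_measure s) (space (power_measure s)) = (\<integral>\<^sup>+t. 1 \<partial>power_measure s)"
    by simp
  also have "\<dots> = (\<integral>\<^sup>+t. ennreal (\<bar>t\<bar> powr s) * indicator {..1/2} \<bar>t\<bar> \<partial>leb)"
    by (subst nn_integral_power_measure)
       (auto intro!: nn_integral_cong split: split_indicator)
  also have "\<dots> < \<infinity>"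
    using nn_integral_abs_powr_le[OF assms, of "1/2"] by (auto intro: le_less_trans)
  finally show "emeasure (power_measure s) (space (power_measure s)) \<noteq> \<infinity>" by simp
qed

lemma wt_measurable [measurable]:
  fixes f :: "real \<Rightarrow> 'k::{real_normed_field,euclidean_space}"
  assumes [measurable]: "f \<in> borel_measurable leb"
  shows "wt c f \<in> borel_measurable leb"
proof -
  have [measurable]: "(\<lambda>t. of_real (\<bar>t\<bar> powr c) :: 'k) \<in> borel_measurable leb"
    by (rule borel_measurable_leb) measurable
  show ?thesis unfolding wt_def[abs_def] by measurable
qed

lemma norm_wt: "norm (wt c f t) = \<bar>t\<bar> powr c * norm (f t)"
  by (simp add: wt_def norm_mult)

lemma wt_wt: "wt b (wt c f) = wt (b + c) f"
  by (simp add: wt_def fun_eq_iff powr_add)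

lemma norm_wt_sq: "(norm (wt (s/2) f t))\<^sup>2 = \<bar>t\<bar> powr s * (norm (f t))\<^sup>2"
proof -
  have "(\<bar>t\<bar> powr (s/2))\<^sup>2 = \<bar>t\<bar> powr s"
    by (simp add: power2_eq_square flip: powr_add)
  then show ?thesis by (simp add: norm_wt power_mult_distrib)
qed

lemma nn_integral_H:
  fixes f :: "real \<Rightarrow> 'k::{real_normed_field,euclidean_space}"
  assumes "f \<in> borel_measurable leb"
  shows "(\<integral>\<^sup>+t. ennreal ((norm (f t))\<^sup>2) \<partial>power_measure s) = (\<integral>\<^sup>+t. ennreal ((norm (wt (s/2) f t))\<^sup>2) \<partial>leb)"
  using assms by (subst nn_integral_power_measure) (auto simp: norm_wt_sq ennreal_mult)

text \<open>Moving half of the weight into the function makes \<open>H s\<close> an isometric copy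
  of the unweighted space, so that unweighted estimates become applicable.\<close>

lemma wt_mem_iff:
  fixes f :: "real \<Rightarrow> 'k::{real_normed_field,euclidean_space}"
  assumes [measurable]: "f \<in> borel_measurable leb"
  shows "wt (s/2) f \<in> vectors (L2_space leb) \<longleftrightarrow> f \<in> vectors (H s)"
    and "vnorm (L2_space leb) (wt (s/2) f) = vnorm (H s) f"
proof -
  have 1: "(\<integral>\<^sup>+t. ennreal (norm ((norm (f t))\<^sup>2)) \<partial>power_measure s)
      = (\<integral>\<^sup>+t. ennreal (norm ((norm (wt (s/2) f t))\<^sup>2)) \<partial>leb)"
    using nn_integral_H[OF assms, of s] by simp
  show "wt (s/2) f \<in> vectors (L2_space leb) \<longleftrightarrow> f \<in> vectors (H s)"
    unfolding vectors_L2_iff integrable_iff_bounded 1 measurable_power_measure by simp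
  show "vnorm (L2_space leb) (wt (s/2) f) = vnorm (H s) f"
    unfolding vnorm_L2
    by (subst (1 2) integral_eq_nn_integral) (use 1 in \<open>simp_all add: measurable_power_measure\<close>)
qed

lemma H_measurable: "f \<in> vectors (H s) \<Longrightarrow> f \<in> borel_measurable leb"
  by (simp add: vectors_L2_iff measurable_power_measure)

lemma nn_integral_H_eq:
  fixes f :: "real \<Rightarrow> 'k::{real_normed_field,euclidean_space}"
  assumes "f \<in> vectors (H s)"
  shows "(\<integral>\<^sup>+t. ennreal (\<bar>t\<bar> powr s * (norm (f t))\<^sup>2) \<partial>leb) = ennreal ((vnorm (H s) f)\<^sup>2)"
  using nn_integral_L2[OF assms] nn_integral_H[OF H_measurable[OF assms], of s]
  by (simp add: norm_wt_sq)

lemma H_boundI: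
  fixes f :: "real \<Rightarrow> 'k::{real_normed_field,euclidean_space}"
  assumes f: "f \<in> borel_measurable leb"
    and le: "(\<integral>\<^sup>+t. ennreal (\<bar>t\<bar> powr s * (norm (f t))\<^sup>2) \<partial>leb) \<le> ennreal (c\<^sup>2)" and c: "0 \<le> c"
  shows "f \<in> vectors (H s)" "vnorm (H s) f \<le> c"
proof -
  have "(\<integral>\<^sup>+t. ennreal ((norm (f t))\<^sup>2) \<partial>power_measure s) \<le> ennreal (c\<^sup>2)"
    using le unfolding nn_integral_H[OF f] norm_wt_sq .
  from L2_boundI[OF _ this c] show "f \<in> vectors (H s)" "vnorm (H s) f \<le> c"
    using f by (simp_all add: measurable_power_measure)
qed

text \<open>With c = -s this carries \<open>H (-s)\<close> isometrically into \<open>H s\<close>; it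
  supplies the dual element in \<open>dual_bound\<close>.\<close>

lemma wt_H:
  fixes f :: "real \<Rightarrow> 'k::{real_normed_field,euclidean_space}"
  assumes f: "f \<in> vectors (H (s + 2 * c))"
  shows "wt c f \<in> vectors (H s)" "vnorm (H s) (wt c f) = vnorm (H (s + 2 * c)) f"
proof -
  note [measurable] = H_measurable[OF f]
  have eq: "s/2 + c = (s + 2 * c)/2" by simp
  show "wt c f \<in> vectors (H s)"
    using wt_mem_iff(1)[of "wt c f" s] wt_mem_iff(1)[of f "s + 2 * c"] f unfolding wt_wt eq by simp
  show "vnorm (H s) (wt c f) = vnorm (H (s + 2 * c)) f"
    using wt_mem_iff(2)[of "wt c f" s] wt_mem_iff(2)[of f "s + 2 * c"] unfolding wt_wt eq by simp
qed

text \<open>On the interval |t| <= 1, so a larger exponent gives a smaller weight. In this way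
  Bessel's inequality reaches the spaces with negative exponent.\<close>

lemma H_antimono:
  fixes f :: "real \<Rightarrow> 'k::{real_normed_field,euclidean_space}"
  assumes f: "f \<in> vectors (H s)" and "s \<le> u"
  shows "f \<in> vectors (H u)" "vnorm (H u) f \<le> vnorm (H s) f"
proof -
  have "(\<integral>\<^sup>+t. ennreal (\<bar>t\<bar> powr u * (norm (f t))\<^sup>2) \<partial>leb) \<le> ennreal ((vnorm (H s) f)\<^sup>2)"
    unfolding nn_integral_H_eq[OF f, symmetric]
  proof (intro nn_integral_mono ennreal_leI mult_right_mono)
    fix t assume "t \<in> space leb"
    then have "\<bar>t\<bar> \<le> 1" by (auto)
    then show "\<bar>t\<bar> powr u \<le> \<bar>t\<bar> powr s"
      using \<open>s \<le> u\<close> by (cases "t = 0") (auto intro: powr_mono')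
  qed auto
  from H_boundI[OF H_measurable[OF f] this]
  show "f \<in> vectors (H u)" "vnorm (H u) f \<le> vnorm (H s) f" by simp_all
qed

text \<open>The factors \<open>\<bar>t\<bar> powr (s/2)\<close> and
  \<open>\<bar>t\<bar> powr (-s/2)\<close> cancel off 0, so Cauchy-Schwarz applies to the weighted
  functions. This is what gives the unweighted Fourier integrals a meaning on
  \<open>H s\<close>.\<close>

lemma H_pairing:
  fixes f :: "real \<Rightarrow> 'a::{real_normed_field,euclidean_space}"
    and g :: "real \<Rightarrow> 'b::{real_normed_field,euclidean_space}"
  assumes f: "f \<in> vectors (H s)" and g: "g \<in> vectors (H (-s))"
  shows "integrable leb (\<lambda>t. norm (f t) * norm (g t))"
    and "(\<integral>t. norm (f t) * norm (g t) \<partial>leb) \<le> vnorm (H s) f * vnorm (H (-s)) g"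
proof -
  note [measurable] = H_measurable[OF f] H_measurable[OF g]
  have f': "wt (s/2) f \<in> vectors (L2_space leb)" and g': "wt (-s/2) g \<in> vectors (L2_space leb)"
    using wt_mem_iff(1)[of f s] wt_mem_iff(1)[of g "-s"] f g by auto
  note CS = L2_Cauchy_Schwarz[OF f' g']
  have "AE t in leb. norm (wt (s/2) f t) * norm (wt (-s/2) g t) = norm (f t) * norm (g t)"
    using AE_leb_nonzero[of 0]
  proof eventually_elim
    case (elim t)
    then have "\<bar>t\<bar> powr (s/2) * \<bar>t\<bar> powr (-s/2) = 1" by (simp flip: powr_add)
    moreover have "norm (wt (s/2) f t) * norm (wt (-s/2) g t)
        = (\<bar>t\<bar> powr (s/2) * \<bar>t\<bar> powr (-s/2)) * (norm (f t) * norm (g t))"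
      by (simp only: norm_wt mult_ac)
    ultimately show ?case by simp
  qed
  note AE = this
  show "integrable leb (\<lambda>t. norm (f t) * norm (g t))"
    by (rule integrable_cong_AE_imp[OF CS(1) _ AE]) measurable
  have "(\<integral>t. norm (f t) * norm (g t) \<partial>leb) = (\<integral>t. norm (wt (s/2) f t) * norm (wt (-s/2) g t) \<partial>leb)"
    by (rule integral_cong_AE) (use AE in \<open>auto elim: AE_mp\<close>)
  with CS(2) show "(\<integral>t. norm (f t) * norm (g t) \<partial>leb) \<le> vnorm (H s) f * vnorm (H (-s)) g"
    using wt_mem_iff(2)[of f s] wt_mem_iff(2)[of g "-s"] by simp
qed

lemma H_mult:
  fixes f g :: "real \<Rightarrow> 'k::{real_normed_field,euclidean_space}"
  assumes f: "f \<in> vectors (H s)" and g: "g \<in> vectors (H (-s))"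
  shows "integrable leb (\<lambda>t. f t * g t)"
    and "norm (\<integral>t. f t * g t \<partial>leb) \<le> vnorm (H s) f * vnorm (H (-s)) g"
proof -
  note [measurable] = H_measurable[OF f] H_measurable[OF g]
  show int: "integrable leb (\<lambda>t. f t * g t)"
    by (rule Bochner_Integration.integrable_bound[OF H_pairing(1)[OF f g]]) (auto simp: norm_mult)
  have "norm (\<integral>t. f t * g t \<partial>leb) \<le> (\<integral>t. norm (f t * g t) \<partial>leb)"
    by (rule integral_norm_bound)
  also have "\<dots> \<le> vnorm (H s) f * vnorm (H (-s)) g"
    using H_pairing(2)[OF f g] by (simp add: norm_mult)
  finally show "norm (\<integral>t. f t * g t \<partial>leb) \<le> vnorm (H s) f * vnorm (H (-s)) g" .
qed

lemma H_bounded: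
  fixes f :: "real \<Rightarrow> 'k::{real_normed_field,euclidean_space}"
  assumes "-1 < s" "f \<in> borel_measurable borel" "\<And>t. norm (f t) \<le> B"
  shows "f \<in> vectors (H s)"
    "vnorm (H s) f \<le> B * sqrt (measure (power_measure s) (space (power_measure s)))"
proof -
  interpret finite_measure "power_measure s" by (rule finite_power_measure[OF assms(1)])
  show "f \<in> vectors (H s)"
    "vnorm (H s) f \<le> B * sqrt (measure (power_measure s) (space (power_measure s)))"
    using L2_bounded[of f B] assms by (simp_all add: measurable_power_measure borel_measurable_leb)
qed

lemma H_one: "-1 < s \<Longrightarrow> (\<lambda>t. 1 :: 'k::{real_normed_field,euclidean_space}) \<in> vectors (H s)"
  by (rule H_bounded[where B = 1]) auto

lemma H_integrable:
  fixes f :: "real \<Rightarrow> 'k::{real_normed_field,euclidean_space}"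
  assumes "f \<in> vectors (H s)" "s < 1"
  shows "integrable leb f"
  using H_mult(1)[OF assms(1) H_one] assms(2) by simp

section \<open>Schur's test\<close>

text \<open>A majorant, homogeneous of degree \<open>-1\<close>, of the difference between the Dirichlet kernel
  conjugated by the weight \<open>\<bar>t\<bar> powr c\<close>, \<open>\<bar>c\<bar> = g\<close>, and the Dirichlet kernel itself.\<close>

definition schur_kernel :: "real \<Rightarrow> real \<Rightarrow> real \<Rightarrow> real"
  where "schur_kernel g a b =
    (if b \<le> a then a powr (g - 1) * b powr (- g) else a powr (- g) * b powr (g - 1))"

lemma schur_kernel_commute: "schur_kernel g a b = schur_kernel g b a"
  by (auto simp: schur_kernel_def)

lemma schur_kernel_nonneg [simp]: "0 \<le> schur_kernel g a b"
  by (simp add: schur_kernel_def)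

lemma schur_kernel_measurable [measurable (raw)]:
  assumes [measurable]: "f \<in> borel_measurable M" "h \<in> borel_measurable M"
  shows "(\<lambda>x. schur_kernel g (f x) (h x)) \<in> borel_measurable M"
  unfolding schur_kernel_def by measurable

lemma divide_powr:
  fixes a b c :: real
  assumes "0 < a" "0 < b"
  shows "(a / b) powr c = a powr c * b powr - c"
  using assms by (simp add: powr_divide powr_minus field_simps)

text \<open>With u = a/b, the exponent c may be replaced by g if u >= 1 and by -g if u <= 1, since
  this only increases the deviation from 1. Then one power is weakened, using g <= 1, so that u - 1
  becomes a factor.\<close>

lemma powr_diff_le_schur_kernel:
  assumes "0 < a" "0 < b" "\<bar>c\<bar> \<le> 1"
  shows "\<bar>(a / b) powr c - 1\<bar> \<le> \<bar>a - b\<bar> * schur_kernel \<bar>c\<bar> a b"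
proof -
  define u g where "u = a / b" and "g = \<bar>c\<bar>"
  have u: "0 < u" and g: "0 \<le> g" "g \<le> 1" using assms by (auto simp: u_def g_def)
  have pos: "0 < u powr g" "0 < u powr - g" and inv: "u powr - g * u powr g = 1"
    using u by (auto simp flip: powr_add)
  show ?thesis
  proof (cases "b \<le> a")
    case True
    then have u1: "1 \<le> u" using assms by (simp add: u_def)
    have "\<bar>u powr c - 1\<bar> \<le> u powr g - 1"
    proof (cases "0 \<le> c")
      case True
      then show ?thesis using u1 by (simp add: g_def ge_one_powr_ge_zero)
    next
      case False
      then have c: "c = - g" by (simp add: g_def)
      have ge: "1 \<le> u powr g" using u1 g by (simp add: ge_one_powr_ge_zero)
      then have le: "u powr - g \<le> 1" using mult_left_mono[OF ge, of "u powr - g"] inv pos by simp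
      have "1 - u powr - g = u powr - g * (u powr g - 1)" using inv by (simp add: algebra_simps)
      also have "\<dots> \<le> 1 * (u powr g - 1)" using le ge by (intro mult_right_mono) auto
      finally show ?thesis using le by (simp add: c)
    qed
    also have "\<dots> \<le> u powr g - u powr (g - 1)"
      using u1 g powr_mono[of "g - 1" 0 u] by simp
    also have "\<dots> = (u - 1) * u powr (g - 1)"
      using u powr_add[of u 1 "g - 1"] by (simp add: left_diff_distrib)
    also have "\<dots> = ((u - 1) * b) * (a powr (g - 1) * b powr (- g))"
      using assms powr_add[of b 1 "- g"] by (simp add: u_def divide_powr mult_ac)
    also have "(u - 1) * b = a - b"
      using assms by (simp add: u_def left_diff_distrib)
    finally show ?thesis using True by (simp add: schur_kernel_def u_def g_def)
  next
    case False
    then have u1: "u \<le> 1" using assms by (simp add: u_def)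
    have ge: "u \<le> u powr g" using powr_mono'[of g 1 u] u u1 g by simp
    have le: "u powr g \<le> 1" using u u1 g powr_mono'[of 0 g u] by simp
    then have ge1: "1 \<le> u powr - g" using mult_left_mono[OF le, of "u powr - g"] inv pos by simp
    have "\<bar>u powr c - 1\<bar> \<le> u powr - g * (1 - u powr g)"
    proof (cases "0 \<le> c")
      case True
      then have "\<bar>u powr c - 1\<bar> = 1 * (1 - u powr g)" using le by (simp add: g_def)
      also have "\<dots> \<le> u powr - g * (1 - u powr g)" using le ge1 by (intro mult_right_mono) auto
      finally show ?thesis .
    next
      case False
      then have c: "c = - g" by (simp add: g_def)
      have "u powr - g * (1 - u powr g) = u powr - g - 1" using inv by (simp add: algebra_simps)
      then show ?thesis using ge1 by (simp add: c)
    qed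
    also have "\<dots> \<le> u powr - g * (1 - u)" using ge by (intro mult_left_mono) auto
    also have "\<dots> = ((1 - u) * b) * (a powr (- g) * b powr (g - 1))"
      using assms powr_add[of b 1 "g - 1"] by (simp add: u_def divide_powr mult_ac)
    also have "(1 - u) * b = b - a"
      using assms by (simp add: u_def left_diff_distrib)
    finally show ?thesis using False by (simp add: schur_kernel_def u_def g_def)
  qed
qed

text \<open>By homogeneity the bound does not depend on a. Up to a the exponent is -g - 1/2 > -1,
  beyond a it is g - 3/2 < -1, both because g < 1/2; each part contributes 1/(1/2 - g), and evenness
  doubles the sum.\<close>

lemma nn_integral_schur_kernel_le:
  assumes a: "0 < a" and g: "0 \<le> g" "g < 1/2"
  shows "(\<integral>\<^sup>+t. ennreal (schur_kernel g a \<bar>t\<bar> * (a / \<bar>t\<bar>) powr (1/2)) \<partial>leb) \<le> ennreal (4 / (1/2 - g))"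
proof -
  let ?d = "1/2 - g"
  have "(\<integral>\<^sup>+t. ennreal (schur_kernel g a \<bar>t\<bar> * (a / \<bar>t\<bar>) powr (1/2)) \<partial>leb)
      \<le> 2 * (\<integral>\<^sup>+t\<in>{0..1/2}. ennreal (schur_kernel g a t * (a / t) powr (1/2)) \<partial>lborel)"
    by (rule nn_integral_even_le[of "\<lambda>t. ennreal (schur_kernel g a t * (a / t) powr (1/2))"]) measurable
  also have "(\<integral>\<^sup>+t\<in>{0..1/2}. ennreal (schur_kernel g a t * (a / t) powr (1/2)) \<partial>lborel)
      \<le> (\<integral>\<^sup>+t. ennreal (a powr - ?d) * (ennreal (t powr (- g - 1/2)) * indicator {0..a} t)
           + ennreal (a powr ?d) * (ennreal (t powr (g - 3/2)) * indicator {a..} t) \<partial>lborel)"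
  proof (rule nn_integral_mono)
    fix t :: real
    consider "t = 0" | "t < 0" | "0 < t" "t \<le> a" | "a < t" by linarith
    then show "ennreal (schur_kernel g a t * (a / t) powr (1/2)) * indicator {0..1/2} t
      \<le> ennreal (a powr - ?d) * (ennreal (t powr (- g - 1/2)) * indicator {0..a} t)
           + ennreal (a powr ?d) * (ennreal (t powr (g - 3/2)) * indicator {a..} t)"
    proof cases
      case 3
      have "a powr (g - 1) * a powr (1/2) = a powr - ?d" "t powr - g * t powr - (1/2) = t powr (- g - 1/2)"
        by (simp_all flip: powr_add)
      moreover have "schur_kernel g a t * (a / t) powr (1/2)
          = (a powr (g - 1) * a powr (1/2)) * (t powr - g * t powr - (1/2))"
        using 3 a by (simp add: schur_kernel_def divide_powr mult_ac)
      ultimately have "schur_kernel g a t * (a / t) powr (1/2) = a powr - ?d * t powr (- g - 1/2)"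
        by (simp only:)
      then show ?thesis using 3 by (auto simp: ennreal_mult split: split_indicator)
    next
      case 4
      have "a powr - g * a powr (1/2) = a powr ?d" "t powr (g - 1) * t powr - (1/2) = t powr (g - 3/2)"
        by (simp_all flip: powr_add)
      moreover have "schur_kernel g a t * (a / t) powr (1/2)
          = (a powr - g * a powr (1/2)) * (t powr (g - 1) * t powr - (1/2))"
        using 4 a by (simp add: schur_kernel_def divide_powr mult_ac)
      ultimately have "schur_kernel g a t * (a / t) powr (1/2) = a powr ?d * t powr (g - 3/2)"
        by (simp only:)
      then show ?thesis using 4 a by (auto simp: ennreal_mult split: split_indicator)
    qed auto
  qed
  also have "\<dots> = ennreal (a powr - ?d) * (\<integral>\<^sup>+t\<in>{0..a}. ennreal (t powr (- g - 1/2)) \<partial>lborel)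
      + ennreal (a powr ?d) * (\<integral>\<^sup>+t\<in>{a..}. ennreal (t powr (g - 3/2)) \<partial>lborel)"
    by (subst nn_integral_add) (auto simp: nn_integral_cmult)
  also have "\<dots> = ennreal (a powr - ?d) * ennreal (a powr ?d / ?d)
      + ennreal (a powr ?d) * ennreal (a powr - ?d / ?d)"
    using a g by (subst nn_integral_powr_0, simp, simp, subst nn_integral_powr_inf) (auto simp: algebra_simps)
  also have "\<dots> = ennreal (2 / ?d)"
  proof -
    have "a powr - ?d * a powr ?d = 1" using a by (simp flip: powr_add)
    then have "a powr - ?d * (a powr ?d / ?d) = 1 / ?d" "a powr ?d * (a powr - ?d / ?d) = 1 / ?d"
      by (simp_all add: mult.commute)
    then have "ennreal (a powr - ?d) * ennreal (a powr ?d / ?d) = ennreal (1 / ?d)"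
        "ennreal (a powr ?d) * ennreal (a powr - ?d / ?d) = ennreal (1 / ?d)"
      using g by (subst ennreal_mult[symmetric]; simp)+
    then show ?thesis using g by (simp add: ennreal_plus[symmetric] del: ennreal_plus)
  qed
  also have "2 * ennreal (2 / ?d) = ennreal (4 / ?d)"
    using g by (subst ennreal_numeral[symmetric], subst ennreal_mult[symmetric]) auto
  finally show ?thesis by (simp add: mult_left_mono)
qed

lemma measurable_leb_fst [measurable]: "(\<lambda>x. fst x) \<in> borel_measurable (leb \<Otimes>\<^sub>M M)"
  and measurable_leb_snd [measurable]: "(\<lambda>x. snd x) \<in> borel_measurable (M \<Otimes>\<^sub>M leb)"
  using measurable_compose[OF measurable_fst borel_measurable_leb[OF measurable_ident]]
    measurable_compose[OF measurable_snd borel_measurable_leb[OF measurable_ident]]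
  by (auto simp: id_def)

lemma measurable_leb_ident [measurable]: "(\<lambda>x. x) \<in> borel_measurable leb"
  using borel_measurable_leb[OF measurable_ident] by (simp add: id_def)

text \<open>Cauchy-Schwarz splits the kernel into a row integral and, after Fubini, a column
  integral. The kernel is symmetric, so the same bound holds for both, and the constant appears
  squared.\<close>

lemma schur_test:
  fixes G :: "real \<Rightarrow> ennreal"
  assumes [measurable]: "G \<in> borel_measurable leb" and g: "0 \<le> g" "g < 1/2"
  shows "(\<integral>\<^sup>+s. (\<integral>\<^sup>+t. ennreal (schur_kernel g \<bar>s\<bar> \<bar>t\<bar>) * G t \<partial>leb)\<^sup>2 \<partial>leb)
    \<le> ennreal ((4 / (1/2 - g))\<^sup>2) * (\<integral>\<^sup>+t. (G t)\<^sup>2 \<partial>leb)"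
proof -
  interpret leb: finite_measure leb by (rule finite_measure_leb)
  interpret pair_sigma_finite leb leb ..
  let ?C = "4 / (1/2 - g)"
  let ?q = "\<lambda>s t. schur_kernel g \<bar>s\<bar> \<bar>t\<bar>"
  have row: "(\<integral>\<^sup>+t. ennreal (?q s t * (\<bar>s\<bar> / \<bar>t\<bar>) powr (1/2)) \<partial>leb) \<le> ennreal ?C" if "s \<noteq> 0" for s
    using nn_integral_schur_kernel_le[of "\<bar>s\<bar>" g] that g by simp
  have "(\<integral>\<^sup>+s. (\<integral>\<^sup>+t. ennreal (?q s t) * G t \<partial>leb)\<^sup>2 \<partial>leb)
      \<le> (\<integral>\<^sup>+s. ennreal ?C * (\<integral>\<^sup>+t. ennreal (?q s t * (\<bar>t\<bar> / \<bar>s\<bar>) powr (1/2)) * (G t)\<^sup>2 \<partial>leb) \<partial>leb)"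
  proof (rule nn_integral_mono_AE, use AE_leb_nonzero[of 0] in eventually_elim)
    fix s :: real assume s: "s \<noteq> 0"
    \<comment> \<open>The two factors of exponent 1/2 are reciprocal ratios of the test function at
      s and t, so the product of \<open>?F1\<close> and \<open>?F2\<close> restores the
      integrand.\<close>
    let ?F1 = "\<lambda>t. ennreal (sqrt (?q s t * (\<bar>s\<bar> / \<bar>t\<bar>) powr (1/2)))"
    let ?F2 = "\<lambda>t. ennreal (sqrt (?q s t * (\<bar>t\<bar> / \<bar>s\<bar>) powr (1/2))) * G t"
    have [measurable]: "(\<lambda>t. sqrt (?q s t * (\<bar>s\<bar> / \<bar>t\<bar>) powr (1/2))) \<in> borel_measurable leb"
      "(\<lambda>t. sqrt (?q s t * (\<bar>t\<bar> / \<bar>s\<bar>) powr (1/2))) \<in> borel_measurable leb" by measurable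
    have "(\<integral>\<^sup>+t. ennreal (?q s t) * G t \<partial>leb) = (\<integral>\<^sup>+t. ?F1 t * ?F2 t \<partial>leb)"
    proof (rule nn_integral_cong_AE, use AE_leb_nonzero[of 0] in eventually_elim)
      fix t :: real assume t: "t \<noteq> 0"
      have "(\<bar>s\<bar> / \<bar>t\<bar>) powr (1/2) * (\<bar>t\<bar> / \<bar>s\<bar>) powr (1/2) = 1"
        using s t by (simp flip: powr_mult)
      then have "(?q s t * (\<bar>s\<bar> / \<bar>t\<bar>) powr (1/2)) * (?q s t * (\<bar>t\<bar> / \<bar>s\<bar>) powr (1/2)) = (?q s t)\<^sup>2"
        by (simp add: power2_eq_square mult_ac)
      then have "sqrt (?q s t * (\<bar>s\<bar> / \<bar>t\<bar>) powr (1/2)) * sqrt (?q s t * (\<bar>t\<bar> / \<bar>s\<bar>) powr (1/2)) = ?q s t"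
        by (simp only: real_sqrt_mult[symmetric]) simp
      then show "ennreal (?q s t) * G t = ?F1 t * ?F2 t"
        by (simp only: mult.assoc[symmetric] ennreal_mult[symmetric] real_sqrt_ge_zero
            mult_nonneg_nonneg schur_kernel_nonneg powr_ge_zero)
    qed
    then have "(\<integral>\<^sup>+t. ennreal (?q s t) * G t \<partial>leb)\<^sup>2 \<le> (\<integral>\<^sup>+t. (?F1 t)\<^sup>2 \<partial>leb) * (\<integral>\<^sup>+t. (?F2 t)\<^sup>2 \<partial>leb)"
      using Cauchy_Schwarz_nn_integral[of ?F1 leb ?F2] by simp
    also have "(\<integral>\<^sup>+t. (?F1 t)\<^sup>2 \<partial>leb) = (\<integral>\<^sup>+t. ennreal (?q s t * (\<bar>s\<bar> / \<bar>t\<bar>) powr (1/2)) \<partial>leb)"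
      by (intro nn_integral_cong) (simp add: ennreal_power)
    also have "(\<integral>\<^sup>+t. (?F2 t)\<^sup>2 \<partial>leb) = (\<integral>\<^sup>+t. ennreal (?q s t * (\<bar>t\<bar> / \<bar>s\<bar>) powr (1/2)) * (G t)\<^sup>2 \<partial>leb)"
      by (intro nn_integral_cong) (simp add: ennreal_power power_mult_distrib)
    finally show "(\<integral>\<^sup>+t. ennreal (?q s t) * G t \<partial>leb)\<^sup>2
        \<le> ennreal ?C * (\<integral>\<^sup>+t. ennreal (?q s t * (\<bar>t\<bar> / \<bar>s\<bar>) powr (1/2)) * (G t)\<^sup>2 \<partial>leb)"
      by (rule order_trans) (intro mult_right_mono row s, simp)
  qed
  also have "\<dots> = ennreal ?C * (\<integral>\<^sup>+s. (\<integral>\<^sup>+t. ennreal (?q s t * (\<bar>t\<bar> / \<bar>s\<bar>) powr (1/2)) * (G t)\<^sup>2 \<partial>leb) \<partial>leb)"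
    by (rule nn_integral_cmult) measurable
  also have "(\<integral>\<^sup>+s. (\<integral>\<^sup>+t. ennreal (?q s t * (\<bar>t\<bar> / \<bar>s\<bar>) powr (1/2)) * (G t)\<^sup>2 \<partial>leb) \<partial>leb)
      = (\<integral>\<^sup>+t. (\<integral>\<^sup>+s. ennreal (?q s t * (\<bar>t\<bar> / \<bar>s\<bar>) powr (1/2)) * (G t)\<^sup>2 \<partial>leb) \<partial>leb)"
    by (rule Fubini') measurable
  also have "\<dots> \<le> (\<integral>\<^sup>+t. ennreal ?C * (G t)\<^sup>2 \<partial>leb)"
  proof (rule nn_integral_mono_AE, use AE_leb_nonzero[of 0] in eventually_elim)
    fix t :: real assume t: "t \<noteq> 0"
    have "(\<integral>\<^sup>+s. ennreal (?q s t * (\<bar>t\<bar> / \<bar>s\<bar>) powr (1/2)) * (G t)\<^sup>2 \<partial>leb)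
        = (\<integral>\<^sup>+s. ennreal (?q t s * (\<bar>t\<bar> / \<bar>s\<bar>) powr (1/2)) \<partial>leb) * (G t)\<^sup>2"
      by (subst nn_integral_multc) (auto simp: schur_kernel_commute[of g "\<bar>t\<bar>"])
    also have "\<dots> \<le> ennreal ?C * (G t)\<^sup>2"
      by (intro mult_right_mono row t) simp
    finally show "(\<integral>\<^sup>+s. ennreal (?q s t * (\<bar>t\<bar> / \<bar>s\<bar>) powr (1/2)) * (G t)\<^sup>2 \<partial>leb) \<le> ennreal ?C * (G t)\<^sup>2" .
  qed
  also have "\<dots> = ennreal ?C * (\<integral>\<^sup>+t. (G t)\<^sup>2 \<partial>leb)"
    by (rule nn_integral_cmult) measurable
  also have "ennreal ?C * (ennreal ?C * (\<integral>\<^sup>+t. (G t)\<^sup>2 \<partial>leb)) = ennreal (?C\<^sup>2) * (\<integral>\<^sup>+t. (G t)\<^sup>2 \<partial>leb)"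
  proof -
    have "ennreal (?C\<^sup>2) = ennreal ?C * ennreal ?C"
      unfolding power2_eq_square using g by (intro ennreal_mult) auto
    then show ?thesis by (simp only: mult.assoc)
  qed
  finally show ?thesis by (simp add: mult_left_mono)
qed

section \<open>Density of trigonometric polynomials\<close>

text \<open>Real cosines and sines with a free coefficient give one notion for real and complex
  scalars. Integer frequencies of either sign keep the product formulas free of case
  distinctions.\<close>

inductive trig_poly :: "(real \<Rightarrow> 'k::real_normed_field) \<Rightarrow> bool" where
  trig_poly_cos: "trig_poly (\<lambda>t. of_real (cos (2 * pi * of_int j * t)) * c)"
| trig_poly_sin: "trig_poly (\<lambda>t. of_real (sin (2 * pi * of_int j * t)) * c)"
| trig_poly_add: "trig_poly p \<Longrightarrow> trig_poly q \<Longrightarrow> trig_poly (\<lambda>t. p t + q t)"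

lemma trig_poly_of_real:
  assumes "trig_poly (p :: real \<Rightarrow> real)"
  shows "trig_poly (\<lambda>t. of_real (p t) * c)"
  using assms
proof induction
  case (trig_poly_cos j d)
  then show ?case using trig_poly.trig_poly_cos[of j "of_real d * c"] by (simp add: mult.assoc)
next
  case (trig_poly_sin j d)
  then show ?case using trig_poly.trig_poly_sin[of j "of_real d * c"] by (simp add: mult.assoc)
next
  case (trig_poly_add p q)
  then show ?case using trig_poly.trig_poly_add[OF trig_poly_add.IH] by (simp add: distrib_right)
qed

lemma trig_poly_const: "trig_poly (\<lambda>t. c)"
  using trig_poly_cos[of 0 c] by simp

lemma freq_add: "2 * pi * of_int (k + j) * t = 2 * pi * of_int k * t + 2 * pi * of_int j * t"
  and freq_diff: "2 * pi * of_int (k - j) * t = 2 * pi * of_int k * t - 2 * pi * of_int j * t"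
  by (simp_all add: algebra_simps)

lemma trig_poly_mult_cos:
  assumes "trig_poly (p :: real \<Rightarrow> real)"
  shows "trig_poly (\<lambda>t. p t * (cos (2 * pi * of_int j * t) * c))"
  using assms
proof induction
  case (trig_poly_cos k d)
  have "trig_poly (\<lambda>t. cos (2 * pi * of_int (k - j) * t) * (c * d / 2) + cos (2 * pi * of_int (k + j) * t) * (c * d / 2))"
    using trig_poly_add[OF trig_poly.trig_poly_cos trig_poly.trig_poly_cos, of "k - j" "c*d/2" "k + j" "c*d/2"] by simp
  then show ?case by (rule back_subst[of trig_poly]) (simp only: freq_add freq_diff cos_add cos_diff sin_add sin_diff, simp add: algebra_simps)
next
  case (trig_poly_sin k d)
  have "trig_poly (\<lambda>t. sin (2 * pi * of_int (k + j) * t) * (c * d / 2) + sin (2 * pi * of_int (k - j) * t) * (c * d / 2))"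
    using trig_poly_add[OF trig_poly.trig_poly_sin trig_poly.trig_poly_sin, of "k + j" "c*d/2" "k - j" "c*d/2"] by simp
  then show ?case by (rule back_subst[of trig_poly]) (simp only: freq_add freq_diff cos_add cos_diff sin_add sin_diff, simp add: algebra_simps)
next
  case (trig_poly_add p q)
  then show ?case using trig_poly.trig_poly_add[OF trig_poly_add.IH] by (simp add: distrib_right)
qed

lemma trig_poly_mult_sin:
  assumes "trig_poly (p :: real \<Rightarrow> real)"
  shows "trig_poly (\<lambda>t. p t * (sin (2 * pi * of_int j * t) * c))"
  using assms
proof induction
  case (trig_poly_cos k d)
  have "trig_poly (\<lambda>t. sin (2 * pi * of_int (k + j) * t) * (c * d / 2) + sin (2 * pi * of_int (k - j) * t) * (- c * d / 2))"
    using trig_poly_add[OF trig_poly.trig_poly_sin trig_poly.trig_poly_sin, of "k + j" "c*d/2" "k - j" "- c*d/2"] by simp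
  then show ?case by (rule back_subst[of trig_poly]) (simp only: freq_add freq_diff cos_add cos_diff sin_add sin_diff, simp add: algebra_simps)
next
  case (trig_poly_sin k d)
  have "trig_poly (\<lambda>t. cos (2 * pi * of_int (k - j) * t) * (c * d / 2) + cos (2 * pi * of_int (k + j) * t) * (- c * d / 2))"
    using trig_poly_add[OF trig_poly.trig_poly_cos trig_poly.trig_poly_cos, of "k - j" "c*d/2" "k + j" "- c*d/2"] by simp
  then show ?case by (rule back_subst[of trig_poly]) (simp only: freq_add freq_diff cos_add cos_diff sin_add sin_diff, simp add: algebra_simps)
next
  case (trig_poly_add p q)
  then show ?case using trig_poly.trig_poly_add[OF trig_poly_add.IH] by (simp add: distrib_right)
qed

lemma trig_poly_mult:
  assumes p: "trig_poly (p :: real \<Rightarrow> real)" and "trig_poly q"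
  shows "trig_poly (\<lambda>t. p t * q t)"
  using assms(2)
proof induction
  case (trig_poly_cos j c)
  then show ?case using trig_poly_mult_cos[OF p, of j c] by simp
next
  case (trig_poly_sin j c)
  then show ?case using trig_poly_mult_sin[OF p, of j c] by simp
next
  case (trig_poly_add q r)
  then show ?case using trig_poly.trig_poly_add[OF trig_poly_add.IH] by (simp add: distrib_left)
qed

text \<open>A real-linear functional of \<open>cis\<close> is a combination of a cosine and a sine,
  and products stay trigonometric. Hence Stone-Weierstrass on the circle delivers trigonometric
  polynomials.\<close>

lemma trig_poly_real_polynomial_function:
  fixes P :: "complex \<Rightarrow> real"
  assumes "real_polynomial_function P"
  shows "trig_poly (\<lambda>t. P (cis (2 * pi * t)))"
  using assms
proof induction
  case (linear f)
  then interpret f: bounded_linear f .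
  have "cis x = cos x *\<^sub>R 1 + sin x *\<^sub>R \<i>" for x
    by (simp add: complex_eq_iff)
  then have "f (cis x) = cos x * f 1 + sin x * f \<i>" for x
    by (simp add: f.add f.scaleR)
  then show ?case
    using trig_poly_add[OF trig_poly_cos trig_poly_sin, of 1 "f 1" 1 "f \<i>"] by simp
next
  case (const c)
  then show ?case by (rule trig_poly_const)
next
  case (add f g)
  then show ?case by (simp add: trig_poly_add)
next
  case (mult f g)
  then show ?case by (simp add: trig_poly_mult)
qed

lemma trig_poly_bounded:
  fixes p :: "real \<Rightarrow> 'k::{real_normed_field,euclidean_space}"
  assumes "trig_poly p"
  shows "p \<in> borel_measurable borel \<and> (\<exists>B. \<forall>t. norm (p t) \<le> B)"
  using assms
proof induction
  case (trig_poly_cos j c)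
  have "norm (of_real (cos (2 * pi * of_int j * t)) * c) \<le> norm c" for t
    by (simp add: norm_mult mult_left_le_one_le)
  moreover have "(\<lambda>t. of_real (cos (2 * pi * of_int j * t)) * c) \<in> borel_measurable borel"
    by (intro borel_measurable_continuous_onI continuous_intros)
  ultimately show ?case by blast
next
  case (trig_poly_sin j c)
  have "norm (of_real (sin (2 * pi * of_int j * t)) * c) \<le> norm c" for t
    by (simp add: norm_mult mult_left_le_one_le)
  moreover have "(\<lambda>t. of_real (sin (2 * pi * of_int j * t)) * c) \<in> borel_measurable borel"
    by (intro borel_measurable_continuous_onI continuous_intros)
  ultimately show ?case by blast
next
  case (trig_poly_add p q)
  then obtain B C where "\<And>t. norm (p t) \<le> B" "\<And>t. norm (q t) \<le> C" by blast
  then have "norm (p t + q t) \<le> B + C" for t by (rule norm_triangle_mono)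
  then show ?case using trig_poly_add.IH by auto
qed

lemma trig_poly_H:
  fixes p :: "real \<Rightarrow> 'k::{real_normed_field,euclidean_space}"
  assumes "trig_poly p" "-1 < s"
  shows "p \<in> vectors (H s)"
  using trig_poly_bounded[OF assms(1)] H_bounded(1)[OF assms(2)] by blast

section \<open>Functions approximable by trigonometric polynomials\<close>

definition trig_approx :: "real \<Rightarrow> (real \<Rightarrow> 'k::{real_normed_field,euclidean_space}) \<Rightarrow> bool"
  where "trig_approx s u \<longleftrightarrow> u \<in> vectors (H s) \<and>
    (\<forall>e>0. \<exists>p. trig_poly p \<and> vnorm (H s) (\<lambda>t. u t - p t) < e)"

lemma trig_approx_add:
  assumes s: "-1 < s" and u: "trig_approx s u" and v: "trig_approx s v"
  shows "trig_approx s (\<lambda>t. u t + v t)"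
  unfolding trig_approx_def
proof (intro conjI allI impI)
  show "(\<lambda>t. u t + v t) \<in> vectors (H s)"
    using u v by (auto simp: trig_approx_def intro: L2_add(1))
next
  fix e :: real assume "0 < e"
  then have "0 < e/2" by simp
  then obtain p q where p: "trig_poly p" "vnorm (H s) (\<lambda>t. u t - p t) < e/2"
    and q: "trig_poly q" "vnorm (H s) (\<lambda>t. v t - q t) < e/2"
    using u v unfolding trig_approx_def by meson
  have "vnorm (H s) (\<lambda>t. (u t - p t) + (v t - q t))
      \<le> vnorm (H s) (\<lambda>t. u t - p t) + vnorm (H s) (\<lambda>t. v t - q t)"
    using u v unfolding trig_approx_def
    by (intro L2_add(2) L2_diff(1) trig_poly_H[OF p(1) s] trig_poly_H[OF q(1) s]) simp_all
  then have "vnorm (H s) (\<lambda>t. u t + v t - (p t + q t)) < e"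
    using p q by (simp add: algebra_simps)
  then show "\<exists>p. trig_poly p \<and> vnorm (H s) (\<lambda>t. u t + v t - p t) < e"
    using trig_poly_add[OF p(1) q(1)] by blast
qed

lemma trig_approx_sum:
  assumes "-1 < s" "\<And>i. i \<in> A \<Longrightarrow> trig_approx s (u i)"
  shows "trig_approx s (\<lambda>t. \<Sum>i\<in>A. u i t)"
proof -
  have 0: "trig_approx s (\<lambda>t. 0)"
    unfolding trig_approx_def
    by (auto simp: L2_zero vnorm_L2 intro!: exI[of _ "\<lambda>t. 0"] trig_poly_const)
  show ?thesis using assms(2)
    by (induction A rule: infinite_finite_induct) (auto intro: 0 trig_approx_add[OF assms(1)])
qed

lemma vnorm_of_real_mult:
  fixes c :: "'k::{real_normed_field,euclidean_space}"
  assumes "u \<in> vectors (L2_space M)"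
  shows "(\<lambda>t. of_real (u t) * c) \<in> vectors (L2_space M)"
    "vnorm (L2_space M) (\<lambda>t. of_real (u t) * c) = norm c * vnorm (L2_space M) u"
proof -
  have "(\<lambda>t. of_real (u t) :: 'k) \<in> borel_measurable M"
    using L2_measurable[OF assms] by measurable
  then show "(\<lambda>t. of_real (u t) * c) \<in> vectors (L2_space M)"
    "vnorm (L2_space M) (\<lambda>t. of_real (u t) * c) = norm c * vnorm (L2_space M) u"
    using assms by (auto simp: vectors_L2_iff vnorm_L2 norm_mult power_mult_distrib real_sqrt_mult)
qed

lemma trig_approx_of_real:
  fixes c :: "'k::{real_normed_field,euclidean_space}"
  assumes s: "-1 < s" and u: "trig_approx s (u :: real \<Rightarrow> real)"
  shows "trig_approx s (\<lambda>t. of_real (u t) * c)"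
  unfolding trig_approx_def
proof (intro conjI allI impI)
  have uH: "u \<in> vectors (H s)" using u by (simp add: trig_approx_def)
  then show "(\<lambda>t. of_real (u t) * c) \<in> vectors (H s)" by (rule vnorm_of_real_mult)
  fix e :: real assume "0 < e"
  have c: "0 < norm c + 1" using norm_ge_zero[of c] by linarith
  then have "0 < e / (norm c + 1)" using \<open>0 < e\<close> by simp
  then obtain p where p: "trig_poly p" "vnorm (H s) (\<lambda>t. u t - p t) < e / (norm c + 1)"
    using u by (auto simp: trig_approx_def)
  have "vnorm (H s) (\<lambda>t. of_real (u t) * c - of_real (p t) * c) = vnorm (H s) (\<lambda>t. of_real (u t - p t) * c)"
    by (simp add: left_diff_distrib)
  also have "\<dots> = norm c * vnorm (H s) (\<lambda>t. u t - p t)"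
    by (rule vnorm_of_real_mult(2)) (intro L2_diff(1) uH trig_poly_H p s)
  also have "\<dots> \<le> (norm c + 1) * vnorm (H s) (\<lambda>t. u t - p t)"
    by (intro mult_right_mono) auto
  also have "\<dots> < e"
    using p(2) c by (simp add: pos_less_divide_eq mult.commute)
  finally show "\<exists>q. trig_poly q \<and> vnorm (H s) (\<lambda>t. of_real (u t) * c - q t) < e"
    using trig_poly_of_real[OF p(1)] by blast
qed

lemma trig_approx_limit:
  assumes s: "-1 < s" and u: "u \<in> vectors (H s)"
    and v: "\<And>e. 0 < e \<Longrightarrow> \<exists>v. trig_approx s v \<and> vnorm (H s) (\<lambda>t. u t - v t) < e"
  shows "trig_approx s u"
  unfolding trig_approx_def
proof (intro conjI allI impI u)
  fix e :: real assume "0 < e"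
  then have e: "0 < e/2" by simp
  obtain v where v: "trig_approx s v" "vnorm (H s) (\<lambda>t. u t - v t) < e/2"
    using v[OF e] by blast
  obtain p where p: "trig_poly p" "vnorm (H s) (\<lambda>t. v t - p t) < e/2"
    using v(1) e unfolding trig_approx_def by meson
  have "vnorm (H s) (\<lambda>t. (u t - v t) + (v t - p t))
      \<le> vnorm (H s) (\<lambda>t. u t - v t) + vnorm (H s) (\<lambda>t. v t - p t)"
    using u v(1) unfolding trig_approx_def
    by (intro L2_add(2) L2_diff(1) trig_poly_H[OF p(1) s]) simp_all
  then have "vnorm (H s) (\<lambda>t. u t - p t) < e" using v(2) p(2) by simp
  then show "\<exists>p. trig_poly p \<and> vnorm (H s) (\<lambda>t. u t - p t) < e" using p(1) by blast
qed

text \<open>Finite Borel measures on Polish spaces are outer regular; finiteness also permits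
  subtracting the measure of B.\<close>

lemma outer_open:
  fixes \<mu> :: "'a::polish_space measure"
  assumes "finite_measure \<mu>" "sets \<mu> = sets borel" "B \<in> sets borel" "0 < e"
  obtains U where "open U" "B \<subseteq> U" "emeasure \<mu> (U - B) \<le> ennreal e"
proof -
  interpret finite_measure \<mu> by fact
  have eq: "emeasure \<mu> B = (INF U\<in>{U. B \<subseteq> U \<and> open U}. emeasure \<mu> U)"
    using outer_regular[of \<mu> B] assms by simp
  have "emeasure \<mu> B < emeasure \<mu> B + ennreal e"
    using \<open>0 < e\<close> by (simp add: emeasure_eq_measure ennreal_less_iff flip: ennreal_plus)
  then have "(INF U\<in>{U. B \<subseteq> U \<and> open U}. emeasure \<mu> U) < emeasure \<mu> B + ennreal e"
    by (simp only: eq[symmetric])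
  then obtain U where U: "B \<subseteq> U" "open U" "emeasure \<mu> U < emeasure \<mu> B + ennreal e"
    unfolding INF_less_iff by blast
  have "emeasure \<mu> (U - B) = emeasure \<mu> U - emeasure \<mu> B"
    using U assms by (intro emeasure_Diff) auto
  also have "\<dots> \<le> ennreal e"
    using U(3) by (simp add: ennreal_minus_le_iff less_imp_le)
  finally show ?thesis using U that by blast
qed

text \<open>\<open>z \<mapsto> arctan (Im z / (1 + Re z)) / pi\<close> is a Borel inverse of \<open>t \<mapsto> cis (2 * pi * t)\<close> on
  \<open>(-1/2, 1/2)\<close>, so that \<open>A\<close> can be approximated on the circle, where no periodicity has to be
  enforced.\<close>

lemma trig_approx_indicator:
  assumes s: "-1 < s" and A: "A \<in> sets borel"
  shows "trig_approx s (indicator A :: real \<Rightarrow> real)"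
  unfolding trig_approx_def
proof (intro conjI allI impI)
  let ?M = "power_measure s"
  note [measurable] = A
  show ind: "(indicator A :: real \<Rightarrow> real) \<in> vectors (H s)"
    by (rule H_bounded[where B = 1, OF s]) (use A in \<open>auto split: split_indicator\<close>)
  fix e :: real assume "0 < e"
  interpret M: finite_measure ?M by (rule finite_power_measure[OF s])
  define E where "E t = cis (2 * pi * t)" for t
  have E_borel [measurable]: "E \<in> borel_measurable borel"
    unfolding E_def by (intro borel_measurable_continuous_onI continuous_intros)
  then have EM [measurable]: "E \<in> measurable ?M borel"
    by (simp add: measurable_power_measure borel_measurable_leb)
  \<comment> \<open>Regularity and Urysohn's lemma are used for the image measure, where the
    endpoints -1/2 and 1/2 are already identified.\<close>
  define \<mu> where "\<mu> = distr ?M borel E"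
  have \<mu>: "finite_measure \<mu>" "sets \<mu> = sets borel"
    unfolding \<mu>_def by (auto intro: M.finite_measure_distr)
  define B where "B = {z. arctan (Im z / (1 + Re z)) / pi \<in> A}"
  have B: "B \<in> sets borel"
  proof -
    have "(\<lambda>z. arctan (Im z / (1 + Re z)) / pi) \<in> borel_measurable borel" by measurable
    from measurable_sets[OF this A] show ?thesis by (simp add: B_def vimage_def)
  qed
  \<comment> \<open>The half-angle formula recovers t from the point on the circle. At the endpoints
    its denominator 1 + cos vanishes, but they form a null set.\<close>
  have EB: "E t \<in> B \<longleftrightarrow> t \<in> A" if "-1/2 < t" "t < 1/2" for t
  proof -
    have "- (pi/2) < pi * t" "pi * t < pi/2"
      using mult_strict_left_mono[OF that(1) pi_gt_zero] mult_strict_left_mono[OF that(2) pi_gt_zero] by simp_all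
    then have "arctan (tan (pi * t)) = pi * t" by (intro arctan_tan)
    moreover have "tan (pi * t) = sin (2 * pi * t) / (1 + cos (2 * pi * t))"
      using tan_half[of "pi * t"] by (simp only: mult.assoc add.commute)
    ultimately show ?thesis by (simp add: B_def E_def)
  qed
  define \<mu>0 where "\<mu>0 = sqrt (measure ?M (space ?M)) + 1"
  have \<mu>0: "0 < \<mu>0" unfolding \<mu>0_def by (intro add_nonneg_pos) auto
  \<comment> \<open>Error budget: two exceptional sets of measure at most d give d + d = (e/3)^2,
    hence e/3 in norm; the uniform error \<eta> costs at most another e/3, and the last third leaves
    room for strict inequality.\<close>
  define \<eta> where "\<eta> = e / (3 * \<mu>0)"
  have \<eta>: "0 < \<eta>" using \<open>0 < e\<close> \<mu>0 by (simp add: \<eta>_def)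
  define d where "d = (e/3)\<^sup>2 / 2"
  have d: "0 < d" using \<open>0 < e\<close> by (simp add: d_def)
  obtain U where U: "open U" "B \<subseteq> U" "emeasure \<mu> (U - B) \<le> ennreal d"
    by (rule outer_open[OF \<mu> B d])
  obtain V where V: "open V" "- B \<subseteq> V" "emeasure \<mu> (V - - B) \<le> ennreal d"
    by (rule outer_open[OF \<mu> _ d, of "- B"]) (use B in auto)
  \<comment> \<open>U and V together cover the plane, so their complements are disjoint closed sets,
    and h coincides with the indicator of B outside U - B and V - (-B).\<close>
  obtain h :: "complex \<Rightarrow> real" where h: "continuous_on UNIV h" "\<And>x. h x \<in> closed_segment 0 1"
      "\<And>x. x \<in> - U \<Longrightarrow> h x = 0" "\<And>x. x \<in> - V \<Longrightarrow> h x = 1"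
  proof (rule Urysohn[of "- U" "- V" "0::real" 1])
    show "closed (- U)" "closed (- V)" "- U \<inter> - V = {}" using U V by auto
  qed blast
  have h01: "0 \<le> h z" "h z \<le> 1" for z
    using h(2)[of z] by (simp_all add: closed_segment_eq_real_ivl)
  have [measurable]: "h \<in> borel_measurable borel"
    by (rule borel_measurable_continuous_onI[OF h(1)])
  obtain P where P: "real_polynomial_function P" "\<And>z. z \<in> sphere 0 1 \<Longrightarrow> \<bar>h z - P z\<bar> < \<eta>"
    using Stone_Weierstrass_real_polynomial_function[OF compact_sphere continuous_on_subset[OF h(1) subset_UNIV] \<eta>]
    by metis
  have P_tp: "trig_poly (\<lambda>t. P (E t))"
    unfolding E_def by (rule trig_poly_real_polynomial_function[OF P(1)])
  have hE: "(\<lambda>t. h (E t)) \<in> vectors (H s)"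
  proof (rule H_bounded[where B = 1, OF s])
    show "norm (h (E t)) \<le> 1" for t using h01[of "E t"] by (simp add: abs_of_nonneg)
  qed measurable
  have 1: "vnorm (H s) (\<lambda>t. indicator A t - h (E t)) \<le> e/3"
  proof (rule L2_boundI(2))
    show "(\<lambda>t. indicat_real A t - h (E t)) \<in> borel_measurable ?M"
      unfolding measurable_power_measure by (intro borel_measurable_leb) measurable
    have W: "(U - B) \<union> (V - - B) \<in> sets borel" using U V B by auto
    have "AE t in leb. t \<noteq> -1/2 \<and> t \<noteq> 1/2"
      using AE_leb_nonzero[of "-1/2"] AE_leb_nonzero[of "1/2"] by eventually_elim auto
    then have AE: "AE t in ?M. t \<noteq> -1/2 \<and> t \<noteq> 1/2" by (rule AE_power_measureI)
    have "(\<integral>\<^sup>+t. ennreal ((norm (indicator A t - h (E t)))\<^sup>2) \<partial>?M)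
        \<le> (\<integral>\<^sup>+t. indicator ((U - B) \<union> (V - - B)) (E t) \<partial>?M)"
    proof (rule nn_integral_mono_AE, use AE AE_space in eventually_elim)
      fix t assume "t \<noteq> -1/2 \<and> t \<noteq> 1/2" "t \<in> space ?M"
      then have t: "-1/2 < t" "t < 1/2" by (auto simp: space_power_measure)
      have "\<bar>indicator A t - h (E t)\<bar> \<le> 1"
        using h01[of "E t"] by (auto split: split_indicator)
      then have "(norm (indicator A t - h (E t)))\<^sup>2 \<le> 1" by (simp add: abs_square_le_1)
      moreover have "indicator A t - h (E t) = 0" if "E t \<notin> (U - B) \<union> (V - - B)"
        using that EB[OF t] h(3,4)[of "E t"] U(2) V(2) by (cases "E t \<in> B") auto
      ultimately show "ennreal ((norm (indicator A t - h (E t)))\<^sup>2) \<le> indicator ((U - B) \<union> (V - - B)) (E t)"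
        by (cases "E t \<in> (U - B) \<union> (V - - B)") (auto simp: ennreal_le_1)
    qed
    also have "\<dots> = (\<integral>\<^sup>+z. indicator ((U - B) \<union> (V - - B)) z \<partial>\<mu>)"
      unfolding \<mu>_def by (rule nn_integral_distr[symmetric]) (rule EM, use W in simp)
    also have "\<dots> = emeasure \<mu> ((U - B) \<union> (V - - B))"
      using U V B \<mu>(2) by (intro nn_integral_indicator) auto
    also have "\<dots> \<le> emeasure \<mu> (U - B) + emeasure \<mu> (V - - B)"
      using U V B \<mu>(2) by (intro emeasure_subadditive) auto
    also have "\<dots> \<le> ennreal d + ennreal d" by (intro add_mono U V)
    also have "\<dots> = ennreal ((e/3)\<^sup>2)" using d by (simp flip: ennreal_plus) (simp add: d_def)
    finally show "(\<integral>\<^sup>+t. ennreal ((norm (indicator A t - h (E t)))\<^sup>2) \<partial>?M) \<le> ennreal ((e/3)\<^sup>2)" .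
  qed (use \<open>0 < e\<close> in simp)
  have 2: "vnorm (H s) (\<lambda>t. h (E t) - P (E t)) \<le> \<eta> * sqrt (measure ?M (space ?M))"
  proof (rule H_bounded(2)[OF s])
    have [measurable]: "(\<lambda>t. P (E t)) \<in> borel_measurable borel"
      using trig_poly_bounded[OF P_tp] by blast
    show "(\<lambda>t. h (E t) - P (E t)) \<in> borel_measurable borel" by measurable
    show "norm (h (E t) - P (E t)) \<le> \<eta>" for t
      using P(2)[of "E t"] by (simp add: E_def less_imp_le)
  qed
  also have "\<dots> \<le> \<eta> * \<mu>0" using \<eta> by (intro mult_left_mono) (auto simp: \<mu>0_def)
  also have "\<dots> = e/3" using \<mu>0 by (simp add: \<eta>_def)
  finally have 2: "vnorm (H s) (\<lambda>t. h (E t) - P (E t)) \<le> e/3" .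
  have "vnorm (H s) (\<lambda>t. (indicator A t - h (E t)) + (h (E t) - P (E t)))
      \<le> vnorm (H s) (\<lambda>t. indicat_real A t - h (E t)) + vnorm (H s) (\<lambda>t. h (E t) - P (E t))"
    by (intro L2_add(2) L2_diff(1) ind hE trig_poly_H[OF P_tp s])
  with 1 2 \<open>0 < e\<close> have "vnorm (H s) (\<lambda>t. indicator A t - P (E t)) < e" by simp
  then show "\<exists>p. trig_poly p \<and> vnorm (H s) (\<lambda>t. indicat_real A t - p t) < e"
    using P_tp by blast
qed

text \<open>Simple functions approximate f in norm, and each of them is a finite sum of values times
  indicators of Borel sets, to which the preceding lemma applies.\<close>

lemma trig_poly_dense:
  fixes f :: "real \<Rightarrow> 'k::{real_normed_field,euclidean_space}"
  assumes s: "-1 < s" and f: "f \<in> vectors (H s)"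
  shows "trig_approx s f"
proof (rule trig_approx_limit[OF s f])
  let ?M = "power_measure s"
  fix e :: real assume "0 < e"
  have fm [measurable]: "f \<in> borel_measurable ?M" using f by (simp add: vectors_L2_iff)
  obtain F where F: "\<And>i. simple_function ?M (F i)" "\<And>x. x \<in> space ?M \<Longrightarrow> (\<lambda>i. F i x) \<longlonglongrightarrow> f x"
      "\<And>i x. x \<in> space ?M \<Longrightarrow> dist (F i x) 0 \<le> 2 * dist (f x) 0"
    using borel_measurable_implies_sequence_metric[OF fm, of 0] by blast
  have [measurable]: "F i \<in> borel_measurable ?M" for i
    by (rule borel_measurable_simple_function[OF F(1)])
  \<comment> \<open>From |F i| <= 2 |f| follows |f - F i| <= 3 |f|, so 9 |f|^2 is a dominating
    function.\<close>
  have bound: "(norm (f x - F i x))\<^sup>2 \<le> 9 * (norm (f x))\<^sup>2" if "x \<in> space ?M" for i x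
  proof -
    have "norm (f x - F i x) \<le> 3 * norm (f x)"
      using norm_triangle_ineq4[of "f x" "F i x"] F(3)[OF that, of i] unfolding dist_0_norm dist_norm diff_zero
      by linarith
    then have "(norm (f x - F i x))\<^sup>2 \<le> (3 * norm (f x))\<^sup>2" by (rule power_mono) simp
    then show ?thesis by (simp add: power_mult_distrib)
  qed
  have "(\<lambda>i. \<integral>x. (norm (f x - F i x))\<^sup>2 \<partial>?M) \<longlonglongrightarrow> (\<integral>x. 0 \<partial>?M)"
  proof (rule integral_dominated_convergence[where w = "\<lambda>x. 9 * (norm (f x))\<^sup>2"])
    show "AE x in ?M. (\<lambda>i. (norm (f x - F i x))\<^sup>2) \<longlonglongrightarrow> 0"
    proof (rule AE_I2)
      fix x assume "x \<in> space ?M"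
      from F(2)[OF this] have "(\<lambda>i. (norm (f x - F i x))\<^sup>2) \<longlonglongrightarrow> (norm (f x - f x))\<^sup>2"
        by (intro tendsto_intros)
      then show "(\<lambda>i. (norm (f x - F i x))\<^sup>2) \<longlonglongrightarrow> 0" by simp
    qed
    show "AE x in ?M. norm ((norm (f x - F i x))\<^sup>2) \<le> 9 * (norm (f x))\<^sup>2" for i
      using bound by (intro AE_I2) simp
    show "integrable ?M (\<lambda>x. 9 * (norm (f x))\<^sup>2)"
      using f by (simp add: vectors_L2_iff)
  qed measurable
  then have "(\<lambda>i. sqrt (\<integral>x. (norm (f x - F i x))\<^sup>2 \<partial>?M)) \<longlonglongrightarrow> sqrt 0"
    by (intro tendsto_real_sqrt) simp
  then have "(\<lambda>i. vnorm (H s) (\<lambda>x. f x - F i x)) \<longlonglongrightarrow> 0"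
    by (simp add: vnorm_L2)
  from order_tendstoD(2)[OF this \<open>0 < e\<close>]
  obtain i where i: "vnorm (H s) (\<lambda>x. f x - F i x) < e"
    unfolding eventually_sequentially by blast
  let ?G = "\<lambda>t. \<Sum>y\<in>F i ` space ?M. of_real (indicator (F i -` {y} \<inter> space ?M) t) * y"
  have "trig_approx s ?G"
  proof (intro trig_approx_sum trig_approx_of_real trig_approx_indicator s)
    fix y
    have "F i -` {y} \<inter> space ?M \<in> sets leb"
      using simple_functionD(2)[OF F(1), of i "{y}"] unfolding sets_power_measure .
    then show "F i -` {y} \<inter> space ?M \<in> sets borel"
      by (auto simp: leb_def sets_restrict_space)
  qed
  moreover have "vnorm (H s) (\<lambda>t. f t - ?G t) = vnorm (H s) (\<lambda>t. f t - F i t)"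
  proof -
    have "(\<integral>t. (norm (f t - ?G t))\<^sup>2 \<partial>?M) = (\<integral>t. (norm (f t - F i t))\<^sup>2 \<partial>?M)"
    proof (rule Bochner_Integration.integral_cong[OF refl])
      fix t assume "t \<in> space ?M"
      have "?G t = F i t"
        using simple_function_indicator_representation_banach[OF F(1) \<open>t \<in> space ?M\<close>, of i]
        unfolding scaleR_conv_of_real by (rule sym)
      then show "(norm (f t - ?G t))\<^sup>2 = (norm (f t - F i t))\<^sup>2"
        by (simp only:)
    qed
    then show ?thesis by (simp only: vnorm_L2)
  qed
  ultimately show "\<exists>v. trig_approx s v \<and> vnorm (H s) (\<lambda>t. f t - v t) < e"
    using i by (intro exI[of _ ?G]) (simp only: simp_thms)
qed

section \<open>The basis property\<close>

text \<open>Both systems are biorthogonal to a system \<open>y\<close> that is, up to the factors \<open>d\<close>, the conjugate of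
  \<open>x\<close>; the axiom \<open>adjoint\<close> expresses this through the real inner product, uniformly in real and
  complex scalars.\<close>

locale trig_system =
  fixes x y :: "nat \<Rightarrow> real \<Rightarrow> 'k::{real_normed_field,euclidean_space}"
    and d :: "nat \<Rightarrow> real" and K :: real
  assumes x_borel [measurable]: "\<And>k. x k \<in> borel_measurable borel"
    and y_borel [measurable]: "\<And>k. y k \<in> borel_measurable borel"
    and norm_x: "\<And>k t. norm (x k t) \<le> 1"
    and norm_y: "\<And>k t. norm (y k t) \<le> 2"
    and d_ge: "\<And>k. 1 \<le> d k" and d_le: "\<And>k. d k \<le> 2"
    and adjoint: "\<And>c u k t. c \<bullet> (u * y k t) = d k * (u \<bullet> (c * x k t))"
    and biorthogonal: "\<And>j k. (\<integral>t. x j t * y k t \<partial>leb) = (if j = k then 1 else 0)"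
    \<comment> \<open>The product form stays meaningful where |s| = |t|, although the Dirichlet
      kernel is not bounded uniformly in n there. The value of K is 1/2 for the complex system and 2
      for the real one.\<close>
    and kernel_bound: "\<And>s t n. \<bar>s\<bar> \<le> 1/2 \<Longrightarrow> \<bar>t\<bar> \<le> 1/2 \<Longrightarrow>
          norm (\<Sum>k<n. x k s * y k t) * \<bar>\<bar>s\<bar> - \<bar>t\<bar>\<bar> \<le> K"
    and trig_poly_span: "\<And>p. trig_poly p \<Longrightarrow> \<exists>N a. \<forall>t. p t = (\<Sum>k<N. a k * x k t)"
    \<comment> \<open>In the real system the odd indices carry the cosines, while the sines vanish
      at 0; odd indices are therefore suitable for test functions concentrated at 0 in both
      systems.\<close>
    and x_near_0: "\<And>k t. odd k \<Longrightarrow> norm (x k t - 1) \<le> 2 * pi * real k * \<bar>t\<bar>"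
    and y_near_0: "\<And>k t. odd k \<Longrightarrow> norm (y k t - y k 0) \<le> 4 * pi * real k * \<bar>t\<bar>"
    and y_at_0: "\<And>k. odd k \<Longrightarrow> 1 \<le> norm (y k 0)"
begin

lemma K_nonneg: "0 \<le> K"
  using kernel_bound[of 0 0 0] by simp

section \<open>Fourier coefficients, Parseval and Bessel\<close>

definition fourier_coeff :: "(real \<Rightarrow> 'k) \<Rightarrow> nat \<Rightarrow> 'k"
  where "fourier_coeff f k = (\<integral>t. f t * y k t \<partial>leb)"

definition partial_sum :: "(real \<Rightarrow> 'k) \<Rightarrow> nat \<Rightarrow> real \<Rightarrow> 'k"
  where "partial_sum f n t = (\<Sum>k<n. fourier_coeff f k * x k t)"

lemma x_H: "-1 < s \<Longrightarrow> x k \<in> vectors (H s)"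
  by (rule H_bounded(1)[OF _ x_borel norm_x])

lemma y_H: "-1 < s \<Longrightarrow> y k \<in> vectors (H s)"
  by (rule H_bounded(1)[OF _ y_borel norm_y])

lemma comb_H: "-1 < s \<Longrightarrow> (\<lambda>t. \<Sum>k\<in>A. a k * x k t) \<in> vectors (H s)"
  by (rule L2_lincomb) (rule x_H)

lemma x_L2: "x k \<in> vectors (L2_space leb)" and y_L2: "y k \<in> vectors (L2_space leb)"
  using finite_measure.L2_bounded(1)[OF finite_measure_leb borel_measurable_leb[OF x_borel] norm_x]
    finite_measure.L2_bounded(1)[OF finite_measure_leb borel_measurable_leb[OF y_borel] norm_y] by blast+

lemma comb_L2: "(\<lambda>t. \<Sum>k\<in>A. a k * x k t) \<in> vectors (L2_space leb)"
  by (rule L2_lincomb) (rule x_L2)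

text \<open>The factor 2 is the uniform bound of \<open>y\<close>; it covers \<open>x\<close> as
  well.\<close>

definition weight_norm :: "real \<Rightarrow> real"
  where "weight_norm s = 2 * sqrt (measure (power_measure s) (space (power_measure s)))"

lemma weight_norm_nonneg: "0 \<le> weight_norm s"
  by (simp add: weight_norm_def)

lemma vnorm_y_le: "-1 < s \<Longrightarrow> vnorm (H s) (y k) \<le> weight_norm s"
  unfolding weight_norm_def by (rule H_bounded(2)[OF _ y_borel norm_y])

lemma vnorm_x_le: "-1 < s \<Longrightarrow> vnorm (H s) (x k) \<le> weight_norm s"
  unfolding weight_norm_def
  by (rule H_bounded(2)[OF _ x_borel order_trans[OF norm_x one_le_numeral]])

lemma norm_fourier_coeff_le:
  assumes f: "f \<in> vectors (H s)" and s: "-1 < s" "s < 1"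
  shows "norm (fourier_coeff f k) \<le> weight_norm (-s) * vnorm (H s) f"
proof -
  have "norm (fourier_coeff f k) \<le> vnorm (H s) f * vnorm (H (-s)) (y k)"
    unfolding fourier_coeff_def by (rule H_mult(2)[OF f y_H]) (use s in simp)
  also have "\<dots> \<le> vnorm (H s) f * weight_norm (-s)"
    by (rule mult_left_mono[OF vnorm_y_le]) (use s in simp_all)
  finally show ?thesis by (simp only: mult.commute)
qed

lemma integrable_mult_y:
  "f \<in> vectors (H s) \<Longrightarrow> s < 1 \<Longrightarrow> integrable leb (\<lambda>t. f t * y k t)"
  by (rule H_mult(1)[OF _ y_H]) simp_all

lemma fourier_coeff_diff:
  assumes "f \<in> vectors (H s)" "g \<in> vectors (H s)" "s < 1"
  shows "fourier_coeff (\<lambda>t. f t - g t) k = fourier_coeff f k - fourier_coeff g k"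
  unfolding fourier_coeff_def left_diff_distrib
  by (rule Bochner_Integration.integral_diff) (rule integrable_mult_y, fact+)+

lemma integrable_xy: "integrable leb (\<lambda>t. x j t * y k t)"
  by (rule L2_mult_integrable[OF x_L2 y_L2])

lemma fourier_coeff_comb:
  assumes "finite A"
  shows "fourier_coeff (\<lambda>t. \<Sum>j\<in>A. a j * x j t) k = (if k \<in> A then a k else 0)"
proof -
  have "fourier_coeff (\<lambda>t. \<Sum>j\<in>A. a j * x j t) k = (\<integral>t. (\<Sum>j\<in>A. a j * (x j t * y k t)) \<partial>leb)"
    unfolding fourier_coeff_def by (simp add: sum_distrib_right mult.assoc)
  also have "\<dots> = (\<Sum>j\<in>A. a j * (\<integral>t. x j t * y k t \<partial>leb))"
    by (subst Bochner_Integration.integral_sum) (simp_all add: integrable_xy)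
  also have "\<dots> = (\<Sum>j\<in>A. if k = j then a k else 0)"
    unfolding biorthogonal by (rule sum.cong) auto
  also have "\<dots> = (if k \<in> A then a k else 0)"
    using assms by simp
  finally show ?thesis .
qed

text \<open>By \<open>adjoint\<close>, pairing the sum with its k-th term amounts to pairing
  \<open>a k\<close> with the product of the sum and \<open>y k\<close>, up to the factor 1/d k; the
  integral of that product is the k-th coefficient, \<open>a k\<close> again.\<close>

lemma vnorm_comb_sq:
  "(vnorm (L2_space leb) (\<lambda>t. \<Sum>k<n. a k * x k t))\<^sup>2 = (\<Sum>k<n. (norm (a k))\<^sup>2 / d k)"
proof -
  let ?S = "\<lambda>t. \<Sum>k<n. a k * x k t"
  have int: "integrable leb (\<lambda>t. ?S t * y k t)" for k
    by (rule L2_mult_integrable[OF comb_L2 y_L2])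
  have "(norm (?S t))\<^sup>2 = (\<Sum>k<n. (a k \<bullet> (?S t * y k t)) / d k)" for t
  proof -
    have "(a k \<bullet> (?S t * y k t)) / d k = ?S t \<bullet> (a k * x k t)" for k
      unfolding adjoint using d_ge[of k] by simp
    then show ?thesis by (simp add: power2_norm_eq_inner inner_sum_right)
  qed
  then have "(vnorm (L2_space leb) ?S)\<^sup>2 = (\<integral>t. (\<Sum>k<n. (a k \<bullet> (?S t * y k t)) / d k) \<partial>leb)"
    by (simp only: vnorm_L2_sq)
  also have "\<dots> = (\<Sum>k<n. \<integral>t. (a k \<bullet> (?S t * y k t)) / d k \<partial>leb)"
    by (rule Bochner_Integration.integral_sum) (simp add: int integrable_inner_right)
  also have "\<dots> = (\<Sum>k<n. (a k \<bullet> fourier_coeff ?S k) / d k)"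
    unfolding fourier_coeff_def by (rule sum.cong) (simp_all add: int integral_inner_right)
  also have "\<dots> = (\<Sum>k<n. (norm (a k))\<^sup>2 / d k)"
    by (rule sum.cong) (simp_all add: fourier_coeff_comb power2_norm_eq_inner)
  finally show ?thesis .
qed

text \<open>The sum X is the pairing of f with T, so X^2 is at most the product of the squared norms
  of f and T. By Parseval the squared norm of T is at most 2 X, and one factor X cancels. The
  constant 2 is the bound for \<open>d\<close>.\<close>

lemma bessel:
  assumes f: "f \<in> vectors (L2_space leb)"
  shows "(\<Sum>k<n. (norm (fourier_coeff f k))\<^sup>2) \<le> 2 * (vnorm (L2_space leb) f)\<^sup>2"
proof -
  let ?c = "fourier_coeff f"
  let ?T = "\<lambda>t. \<Sum>k<n. (of_real (d k) * ?c k) * x k t"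
  define X where "X = (\<Sum>k<n. (norm (?c k))\<^sup>2)"
  have X0: "0 \<le> X" by (simp add: X_def sum_nonneg)
  have int: "integrable leb (\<lambda>t. f t * y k t)" for k
    by (rule L2_mult_integrable[OF f y_L2])
  have T: "?T \<in> vectors (L2_space leb)" by (rule comb_L2)
  note [measurable] = L2_measurable[OF f] L2_measurable[OF T]
  have "X = (\<Sum>k<n. \<integral>t. ?c k \<bullet> (f t * y k t) \<partial>leb)"
    unfolding X_def
    by (rule sum.cong) (simp_all add: int integral_inner_right power2_norm_eq_inner flip: fourier_coeff_def)
  also have "\<dots> = (\<integral>t. (\<Sum>k<n. ?c k \<bullet> (f t * y k t)) \<partial>leb)"
    by (rule Bochner_Integration.integral_sum[symmetric]) (simp add: int integrable_inner_right)
  also have "\<dots> = (\<integral>t. f t \<bullet> ?T t \<partial>leb)"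
  proof -
    have "?c k \<bullet> (f t * y k t) = f t \<bullet> ((of_real (d k) * ?c k) * x k t)" for k t
      unfolding adjoint mult.assoc inner_mult_right ..
    then show ?thesis by (simp only: inner_sum_right)
  qed
  also have "\<dots> \<le> (\<integral>t. norm (f t) * norm (?T t) \<partial>leb)"
  proof (rule integral_mono)
    show "integrable leb (\<lambda>t. f t \<bullet> ?T t)"
      by (rule Bochner_Integration.integrable_bound[OF L2_Cauchy_Schwarz(1)[OF f T]])
         (measurable, simp add: Cauchy_Schwarz_ineq2)
  qed (rule L2_Cauchy_Schwarz(1)[OF f T], rule norm_cauchy_schwarz)
  also have "\<dots> \<le> vnorm (L2_space leb) f * vnorm (L2_space leb) ?T"
    by (rule L2_Cauchy_Schwarz(2)[OF f T])
  finally have "X\<^sup>2 \<le> (vnorm (L2_space leb) f * vnorm (L2_space leb) ?T)\<^sup>2"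
    using X0 by (rule power_mono)
  also have "\<dots> = (vnorm (L2_space leb) f)\<^sup>2 * (\<Sum>k<n. (norm (of_real (d k) * ?c k))\<^sup>2 / d k)"
    by (simp only: power_mult_distrib vnorm_comb_sq)
  also have "\<dots> \<le> (vnorm (L2_space leb) f)\<^sup>2 * (2 * X)"
  proof (rule mult_left_mono)
    have "(norm (of_real (d k) * ?c k))\<^sup>2 / d k \<le> 2 * (norm (?c k))\<^sup>2" for k
    proof -
      have "(norm (of_real (d k) * ?c k))\<^sup>2 / d k = d k * (norm (?c k))\<^sup>2"
        using d_ge[of k] by (simp add: norm_mult power_mult_distrib power2_eq_square)
      also have "\<dots> \<le> 2 * (norm (?c k))\<^sup>2" by (rule mult_right_mono[OF d_le]) simp
      finally show ?thesis .
    qed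
    then show "(\<Sum>k<n. (norm (of_real (d k) * ?c k))\<^sup>2 / d k) \<le> 2 * X"
      unfolding X_def sum_distrib_left by (rule sum_mono)
  qed simp
  finally have "X * X \<le> X * (2 * (vnorm (L2_space leb) f)\<^sup>2)"
    by (simp only: power2_eq_square mult_ac)
  then have "X \<le> 2 * (vnorm (L2_space leb) f)\<^sup>2"
    using X0 by (cases "X = 0") (simp_all add: mult_le_cancel_left)
  then show ?thesis by (simp only: X_def)
qed

lemma vnorm_partial_sum_leb:
  assumes f: "f \<in> vectors (L2_space leb)"
  shows "vnorm (L2_space leb) (partial_sum f n) \<le> 2 * vnorm (L2_space leb) f"
proof (rule power2_le_imp_le)
  have "(vnorm (L2_space leb) (partial_sum f n))\<^sup>2 = (\<Sum>k<n. (norm (fourier_coeff f k))\<^sup>2 / d k)"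
    unfolding partial_sum_def by (rule vnorm_comb_sq)
  also have "\<dots> \<le> (\<Sum>k<n. (norm (fourier_coeff f k))\<^sup>2)"
  proof (rule sum_mono)
    fix k show "(norm (fourier_coeff f k))\<^sup>2 / d k \<le> (norm (fourier_coeff f k))\<^sup>2"
      using mult_left_mono[OF d_ge[of k] zero_le_power2[of "norm (fourier_coeff f k)"]] d_ge[of k]
      by (subst pos_divide_le_eq) simp_all
  qed
  also have "\<dots> \<le> 2 * (vnorm (L2_space leb) f)\<^sup>2" by (rule bessel[OF f])
  also have "\<dots> \<le> (2 * vnorm (L2_space leb) f)\<^sup>2" by (simp add: power_mult_distrib)
  finally show "(vnorm (L2_space leb) (partial_sum f n))\<^sup>2 \<le> (2 * vnorm (L2_space leb) f)\<^sup>2" .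
qed simp

section \<open>Partial sums in the weighted norms\<close>

definition proj_bound :: "real \<Rightarrow> real"
  where "proj_bound s = K * (4 / (1/2 - \<bar>s/2\<bar>)) + 2"

text \<open>The increment of the weight is at most ||\<sigma>| - |t|| times the Schur majorant, and
  \<open>kernel_bound\<close> uses up the first factor against the Dirichlet kernel. The result is
  uniform in n.\<close>

lemma norm_weighted_kernel_le:
  fixes f :: "real \<Rightarrow> 'k"
  assumes s: "\<bar>s\<bar> < 1" and \<sigma>: "\<sigma> \<noteq> 0" "\<bar>\<sigma>\<bar> \<le> 1/2" and t: "t \<noteq> 0" "\<bar>t\<bar> \<le> 1/2"
  shows "norm (\<Sum>k<n. ((of_real (\<bar>\<sigma>\<bar> powr (s/2)) * f t - wt (s/2) f t) * y k t) * x k \<sigma>)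
    \<le> K * (schur_kernel \<bar>s/2\<bar> \<bar>\<sigma>\<bar> \<bar>t\<bar> * norm (wt (s/2) f t))"
proof -
  let ?c = "s/2" and ?D = "\<Sum>k<n. x k \<sigma> * y k t"
  have diff: "of_real (\<bar>\<sigma>\<bar> powr ?c) * f t - wt ?c f t = of_real (\<bar>\<sigma>\<bar> powr ?c - \<bar>t\<bar> powr ?c) * f t"
    by (simp add: wt_def left_diff_distrib)
  have "(\<Sum>k<n. ((of_real (\<bar>\<sigma>\<bar> powr ?c) * f t - wt ?c f t) * y k t) * x k \<sigma>)
      = (of_real (\<bar>\<sigma>\<bar> powr ?c) * f t - wt ?c f t) * ?D"
    unfolding sum_distrib_left by (rule sum.cong) (simp_all only: mult_ac)
  also have "norm \<dots> = norm (of_real (\<bar>\<sigma>\<bar> powr ?c - \<bar>t\<bar> powr ?c) * f t) * norm ?D"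
    unfolding diff by (rule norm_mult)
  also have "norm (of_real (\<bar>\<sigma>\<bar> powr ?c - \<bar>t\<bar> powr ?c) * f t)
      = \<bar>(\<bar>\<sigma>\<bar> / \<bar>t\<bar>) powr ?c - 1\<bar> * norm (wt ?c f t)"
  proof -
    have "\<bar>\<sigma>\<bar> powr ?c - \<bar>t\<bar> powr ?c = ((\<bar>\<sigma>\<bar> / \<bar>t\<bar>) powr ?c - 1) * \<bar>t\<bar> powr ?c"
      using t by (simp add: left_diff_distrib powr_divide)
    then show ?thesis by (simp add: norm_mult norm_wt abs_mult del: of_real_diff of_real_mult)
  qed
  also have "\<bar>(\<bar>\<sigma>\<bar> / \<bar>t\<bar>) powr ?c - 1\<bar> * norm (wt ?c f t) * norm ?D
      \<le> (\<bar>\<bar>\<sigma>\<bar> - \<bar>t\<bar>\<bar> * schur_kernel \<bar>?c\<bar> \<bar>\<sigma>\<bar> \<bar>t\<bar>) * norm (wt ?c f t) * norm ?D"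
    by (intro mult_right_mono powr_diff_le_schur_kernel) (use s \<sigma> t in auto)
  also have "\<dots> = (norm ?D * \<bar>\<bar>\<sigma>\<bar> - \<bar>t\<bar>\<bar>) * (schur_kernel \<bar>?c\<bar> \<bar>\<sigma>\<bar> \<bar>t\<bar> * norm (wt ?c f t))"
    by (simp only: mult_ac)
  also have "\<dots> \<le> K * (schur_kernel \<bar>?c\<bar> \<bar>\<sigma>\<bar> \<bar>t\<bar> * norm (wt ?c f t))"
    by (intro mult_right_mono kernel_bound \<sigma> t mult_nonneg_nonneg schur_kernel_nonneg norm_ge_zero)
  finally show ?thesis .
qed

lemma vnorm_partial_sum_le:
  assumes f: "f \<in> vectors (H s)" and s: "-1 < s" "s < 1"
  shows "vnorm (H s) (partial_sum f n) \<le> proj_bound s * vnorm (H s) f"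
proof -
  let ?c = "s/2"
  let ?C = "4 / (1/2 - \<bar>?c\<bar>)"
  define g where "g = wt ?c f"
  note fm [measurable] = H_measurable[OF f]
  have g: "g \<in> vectors (L2_space leb)" "vnorm (L2_space leb) g = vnorm (H s) f"
    using wt_mem_iff[OF fm, of s] f by (simp_all add: g_def)
  note [measurable] = L2_measurable[OF g(1)]
  have inty: "integrable leb (\<lambda>t. g t * y k t)" "integrable leb (\<lambda>t. f t * y k t)" for k
    by (rule L2_mult_integrable[OF g(1) y_L2], rule integrable_mult_y[OF f s(2)])
  \<comment> \<open>E is the commutator of the partial sum operator with multiplication by the
    weight. It is an integral operator to which the Schur majorant applies; the other term,
    \<open>partial_sum g n\<close>, is bounded by the unweighted theory.\<close>
  define E where "E \<sigma> = wt ?c (partial_sum f n) \<sigma> - partial_sum g n \<sigma>" for \<sigma>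
  have psH: "partial_sum f n \<in> vectors (H s)"
    unfolding partial_sum_def[abs_def] by (rule comb_H) (rule s)
  have psm [measurable]: "partial_sum h n \<in> borel_measurable leb" for h
    unfolding partial_sum_def[abs_def] by (rule L2_measurable[OF comb_L2])
  have Em [measurable]: "E \<in> borel_measurable leb"
    unfolding E_def[abs_def] by measurable
  have E_eq: "E \<sigma> = (\<integral>t. (\<Sum>k<n. ((of_real (\<bar>\<sigma>\<bar> powr ?c) * f t - g t) * y k t) * x k \<sigma>) \<partial>leb)" for \<sigma>
  proof -
    have "E \<sigma> = (\<Sum>k<n. (of_real (\<bar>\<sigma>\<bar> powr ?c) * fourier_coeff f k - fourier_coeff g k) * x k \<sigma>)"
      by (simp add: E_def wt_def partial_sum_def sum_distrib_left sum_subtractf left_diff_distrib mult.assoc)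
    also have "\<dots> = (\<Sum>k<n. (\<integral>t. (of_real (\<bar>\<sigma>\<bar> powr ?c) * f t - g t) * y k t \<partial>leb) * x k \<sigma>)"
    proof -
      have "(\<integral>t. (of_real (\<bar>\<sigma>\<bar> powr ?c) * f t - g t) * y k t \<partial>leb)
          = of_real (\<bar>\<sigma>\<bar> powr ?c) * fourier_coeff f k - fourier_coeff g k" for k
        by (simp add: fourier_coeff_def left_diff_distrib mult.assoc inty)
      then show ?thesis by (simp only:)
    qed
    also have "\<dots> = (\<integral>t. (\<Sum>k<n. ((of_real (\<bar>\<sigma>\<bar> powr ?c) * f t - g t) * y k t) * x k \<sigma>) \<partial>leb)"
    proof (subst Bochner_Integration.integral_sum)
      show "integrable leb (\<lambda>t. ((of_real (\<bar>\<sigma>\<bar> powr ?c) * f t - g t) * y k t) * x k \<sigma>)" for k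
        unfolding left_diff_distrib mult.assoc[of "of_real _"] by (simp add: inty)
    qed simp
    finally show ?thesis .
  qed
  have E_le: "ennreal (norm (E \<sigma>)) \<le> (\<integral>\<^sup>+t. ennreal (schur_kernel \<bar>?c\<bar> \<bar>\<sigma>\<bar> \<bar>t\<bar>) * ennreal (K * norm (g t)) \<partial>leb)"
    if "\<sigma> \<noteq> 0" "\<sigma> \<in> space leb" for \<sigma>
  proof -
    let ?I = "\<lambda>t. \<Sum>k<n. ((of_real (\<bar>\<sigma>\<bar> powr ?c) * f t - g t) * y k t) * x k \<sigma>"
    have "integrable leb ?I"
    proof (rule Bochner_Integration.integrable_sum)
      show "integrable leb (\<lambda>t. ((of_real (\<bar>\<sigma>\<bar> powr ?c) * f t - g t) * y k t) * x k \<sigma>)" for k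
        unfolding left_diff_distrib mult.assoc[of "of_real _"] by (simp add: inty)
    qed
    then have "ennreal (norm (E \<sigma>)) \<le> (\<integral>\<^sup>+t. ennreal (norm (?I t)) \<partial>leb)"
      unfolding E_eq by (rule integral_norm_bound_ennreal)
    also have "\<dots> \<le> (\<integral>\<^sup>+t. ennreal (schur_kernel \<bar>?c\<bar> \<bar>\<sigma>\<bar> \<bar>t\<bar>) * ennreal (K * norm (g t)) \<partial>leb)"
    proof (rule nn_integral_mono_AE, use AE_leb_nonzero[of 0] AE_space in eventually_elim)
      fix t assume t: "t \<noteq> 0" "t \<in> space leb"
      have "norm (?I t) \<le> K * (schur_kernel \<bar>?c\<bar> \<bar>\<sigma>\<bar> \<bar>t\<bar> * norm (g t))"
        unfolding g_def by (rule norm_weighted_kernel_le) (use s that t in auto)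
      then show "ennreal (norm (?I t)) \<le> ennreal (schur_kernel \<bar>?c\<bar> \<bar>\<sigma>\<bar> \<bar>t\<bar>) * ennreal (K * norm (g t))"
        by (subst ennreal_mult[symmetric]) (simp_all add: K_nonneg mult_ac ennreal_leI)
    qed
    finally show ?thesis .
  qed
  have "(\<integral>\<^sup>+\<sigma>. ennreal ((norm (E \<sigma>))\<^sup>2) \<partial>leb)
      \<le> (\<integral>\<^sup>+\<sigma>. (\<integral>\<^sup>+t. ennreal (schur_kernel \<bar>?c\<bar> \<bar>\<sigma>\<bar> \<bar>t\<bar>) * ennreal (K * norm (g t)) \<partial>leb)\<^sup>2 \<partial>leb)"
  proof (rule nn_integral_mono_AE, use AE_leb_nonzero[of 0] AE_space in eventually_elim)
    fix \<sigma> assume "\<sigma> \<noteq> 0" "\<sigma> \<in> space leb"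
    from power_mono[OF E_le[OF this], of 2]
    show "ennreal ((norm (E \<sigma>))\<^sup>2)
      \<le> (\<integral>\<^sup>+t. ennreal (schur_kernel \<bar>?c\<bar> \<bar>\<sigma>\<bar> \<bar>t\<bar>) * ennreal (K * norm (g t)) \<partial>leb)\<^sup>2"
      by (simp add: ennreal_power)
  qed
  also have "\<dots> \<le> ennreal (?C\<^sup>2) * (\<integral>\<^sup>+t. (ennreal (K * norm (g t)))\<^sup>2 \<partial>leb)"
    by (rule schur_test) (use s in auto)
  also have "(\<integral>\<^sup>+t. (ennreal (K * norm (g t)))\<^sup>2 \<partial>leb) = (\<integral>\<^sup>+t. ennreal (K\<^sup>2) * ennreal ((norm (g t))\<^sup>2) \<partial>leb)"
    by (rule nn_integral_cong) (simp add: K_nonneg ennreal_power power_mult_distrib flip: ennreal_mult)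
  also have "\<dots> = ennreal (K\<^sup>2) * ennreal ((vnorm (H s) f)\<^sup>2)"
    using g(2) by (subst nn_integral_cmult) (simp_all add: nn_integral_L2[OF g(1)])
  also have "ennreal (?C\<^sup>2) * \<dots> = ennreal ((K * ?C * vnorm (H s) f)\<^sup>2)"
    by (subst ennreal_mult[symmetric], simp, simp, subst ennreal_mult[symmetric], simp, simp)
       (simp only: power_mult_distrib mult_ac)
  finally have le: "(\<integral>\<^sup>+\<sigma>. ennreal ((norm (E \<sigma>))\<^sup>2) \<partial>leb) \<le> ennreal ((K * ?C * vnorm (H s) f)\<^sup>2)" .
  have nn: "0 \<le> K * ?C * vnorm (H s) f"
    by (intro mult_nonneg_nonneg K_nonneg divide_nonneg_nonneg vnorm_L2_nonneg) (use s in simp_all)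
  note E = L2_boundI[OF Em le nn]
  have psg: "partial_sum g n \<in> vectors (L2_space leb)"
    unfolding partial_sum_def[abs_def] by (rule comb_L2)
  have "vnorm (H s) (partial_sum f n) = vnorm (L2_space leb) (wt ?c (partial_sum f n))"
    by (rule wt_mem_iff(2)[symmetric]) measurable
  also have "wt ?c (partial_sum f n) = (\<lambda>\<sigma>. E \<sigma> + partial_sum g n \<sigma>)"
    by (simp add: E_def)
  also have "vnorm (L2_space leb) \<dots> \<le> vnorm (L2_space leb) E + vnorm (L2_space leb) (partial_sum g n)"
    by (rule L2_add(2)[OF E(1) psg])
  also have "\<dots> \<le> K * ?C * vnorm (H s) f + 2 * vnorm (H s) f"
    using E(2) vnorm_partial_sum_leb[OF g(1), of n] g(2) by simp
  finally show ?thesis by (simp only: proj_bound_def distrib_right)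
qed

text \<open>Density and uniform boundedness: from some N on, the partial sums reproduce the
  approximating polynomial p, and f - p is small together with all of its partial sums.\<close>

lemma expands_fourier:
  assumes f: "f \<in> vectors (H s)" and s: "-1 < s" "s < 1"
  shows "expands (H s) x (fourier_coeff f) f"
  unfolding expands_def
proof (rule LIMSEQ_I)
  fix e :: real assume "0 < e"
  define C where "C = 1 + proj_bound s"
  have "0 \<le> K * (4 / (1/2 - \<bar>s/2\<bar>))"
    by (intro mult_nonneg_nonneg K_nonneg divide_nonneg_nonneg) (use s in simp_all)
  then have C: "0 < C" by (simp add: C_def proj_bound_def)
  have "0 < e / C" using \<open>0 < e\<close> C by simp
  then obtain p where p: "trig_poly p" "vnorm (H s) (\<lambda>t. f t - p t) < e / C"
    using trig_poly_dense[OF s(1) f] unfolding trig_approx_def by meson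
  obtain N a where Na: "\<And>t. p t = (\<Sum>k<N. a k * x k t)"
    using trig_poly_span[OF p(1)] by blast
  have pH: "p \<in> vectors (H s)" by (rule trig_poly_H[OF p(1) s(1)])
  have fp: "(\<lambda>t. f t - p t) \<in> vectors (H s)" by (rule L2_diff(1)[OF f pH])
  have "vnorm (H s) (\<lambda>t. f t - (\<Sum>k<n. fourier_coeff f k * x k t)) < e" if "N \<le> n" for n
  proof -
    have coeff: "fourier_coeff p k = (if k < N then a k else 0)" for k
      using fourier_coeff_comb[of "{..<N}" a k] by (simp add: Na[abs_def])
    have "(\<Sum>k<n. fourier_coeff p k * x k t) = p t" for t
    proof -
      have "(\<Sum>k<n. fourier_coeff p k * x k t) = (\<Sum>k<N. fourier_coeff p k * x k t)"
        by (rule sum.mono_neutral_right) (use that in \<open>auto simp: coeff\<close>)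
      then show ?thesis by (simp add: coeff Na)
    qed
    then have eq: "f t - (\<Sum>k<n. fourier_coeff f k * x k t)
        = (f t - p t) - partial_sum (\<lambda>t. f t - p t) n t" for t
      by (simp add: partial_sum_def fourier_coeff_diff[OF f pH s(2)] left_diff_distrib sum_subtractf)
    then have "vnorm (H s) (\<lambda>t. f t - (\<Sum>k<n. fourier_coeff f k * x k t))
        = vnorm (H s) (\<lambda>t. (f t - p t) - partial_sum (\<lambda>t. f t - p t) n t)"
      by (simp only: eq)
    also have "\<dots> \<le> vnorm (H s) (\<lambda>t. f t - p t) + vnorm (H s) (partial_sum (\<lambda>t. f t - p t) n)"
      by (rule L2_diff(2)[OF fp]) (unfold partial_sum_def[abs_def], rule comb_H, rule s)
    also have "\<dots> \<le> C * vnorm (H s) (\<lambda>t. f t - p t)"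
      using vnorm_partial_sum_le[OF fp s, of n] by (simp add: C_def distrib_right)
    also have "\<dots> < e" using p(2) C by (simp add: pos_less_divide_eq mult.commute)
    finally show ?thesis .
  qed
  then show "\<exists>N. \<forall>n\<ge>N. norm (vnorm (H s) (\<lambda>t. f t - (\<Sum>k<n. fourier_coeff f k * x k t)) - 0) < e"
    by (intro exI[of _ N]) simp
qed

text \<open>The m-th Fourier coefficient is continuous, and on every partial sum of length n > m it
  takes the value \<open>a m\<close>.\<close>

lemma expands_unique:
  assumes f: "f \<in> vectors (H s)" and s: "-1 < s" "s < 1" and a: "expands (H s) x a f"
  shows "a = fourier_coeff f"
proof
  fix m
  have "(\<lambda>n. weight_norm (-s) * vnorm (H s) (\<lambda>t. f t - (\<Sum>k<n. a k * x k t))) \<longlonglongrightarrow> weight_norm (-s) * 0"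
    using a unfolding expands_def by (intro tendsto_intros)
  then have lim: "(\<lambda>n. weight_norm (-s) * vnorm (H s) (\<lambda>t. f t - (\<Sum>k<n. a k * x k t))) \<longlonglongrightarrow> 0"
    by simp
  have "norm (fourier_coeff f m - a m) \<le> weight_norm (-s) * vnorm (H s) (\<lambda>t. f t - (\<Sum>k<n. a k * x k t))"
    if "m < n" for n
  proof -
    have S: "(\<lambda>t. \<Sum>k<n. a k * x k t) \<in> vectors (H s)" by (rule comb_H[OF s(1)])
    have "fourier_coeff (\<lambda>t. f t - (\<Sum>k<n. a k * x k t)) m = fourier_coeff f m - a m"
      using that by (simp add: fourier_coeff_diff[OF f S s(2)] fourier_coeff_comb)
    then show ?thesis
      using norm_fourier_coeff_le[OF L2_diff(1)[OF f S] s, of m] by simp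
  qed
  then have "norm (fourier_coeff f m - a m) \<le> 0"
    by (intro tendsto_lowerbound[OF lim] eventually_mono[OF eventually_gt_at_top[of m]]) simp_all
  then show "a m = fourier_coeff f m" by simp
qed

lemma schauder_basis_H: "-1 < s \<Longrightarrow> s < 1 \<Longrightarrow> schauder_basis (H s) x"
  unfolding schauder_basis_def
  by (auto intro: x_H expands_fourier dest: expands_unique)

lemma coords_H: "f \<in> vectors (H s) \<Longrightarrow> -1 < s \<Longrightarrow> s < 1 \<Longrightarrow> coords (H s) x f = fourier_coeff f"
  unfolding coords_def by (rule the_equality) (auto intro: expands_fourier expands_unique)

end

section \<open>Sequence spaces\<close>

text \<open>The growth exponent of the norm of n unit entries in \<open>ell r\<close>. With the
  value 0 at infinity, the sharpness arguments compare real exponents without treating infinity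
  separately.\<close>

definition rec_exp :: "ereal \<Rightarrow> real"
  where "rec_exp r = (if r = \<infinity> then 0 else 1 / real_of_ereal r)"

lemma rec_exp_le_iff:
  assumes "1 \<le> r" "0 < p"
  shows "rec_exp r \<le> 1 / p \<longleftrightarrow> ereal p \<le> r" "1 / p \<le> rec_exp r \<longleftrightarrow> r \<le> ereal p"
  using assms by (cases r; simp add: rec_exp_def field_simps)+

text \<open>Converts an estimate along a family of test functions into a condition on exponents. If
  it failed, some n would satisfy \<open>real n powr (a - b)\<close> >= |C| + 1.\<close>

lemma powr_le_imp_exponent_le:
  assumes le: "\<And>n. 1 \<le> n \<Longrightarrow> real n powr a \<le> C * real n powr b"
  shows "a \<le> b"
proof (rule ccontr)
  assume "\<not> a \<le> b"
  then have ab: "0 < a - b" by simp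
  define B where "B = (\<bar>C\<bar> + 1) powr (1 / (a - b))"
  have B: "1 \<le> B" unfolding B_def using ab by (intro ge_one_powr_ge_zero) auto
  obtain n where n: "B \<le> real n" using real_arch_simple by blast
  have "B powr (a - b) \<le> real n powr (a - b)"
    using n B ab by (intro powr_mono2) auto
  then have n: "1 \<le> n" "C < real n powr (a - b)"
    using n B ab by (auto simp: B_def powr_powr)
  have "C * real n powr b < real n powr (a - b) * real n powr b"
    using n by (intro mult_strict_right_mono) auto
  also have "\<dots> = real n powr a" by (simp flip: powr_add)
  finally show False using le[OF n(1)] by simp
qed

lemma ell_norm_real:
  "ell_norm (ereal p) a = (\<Sum>n. norm (a n) powr p) powr (1 / p)"
  "a \<in> ell (ereal p) \<longleftrightarrow> summable (\<lambda>n. norm (a n) powr p)"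
  by (simp_all add: ell_norm_def ell_def)

lemma powr_le_iff_le_root:
  fixes x M p :: real
  assumes "0 < p" "0 \<le> x" "0 \<le> M"
  shows "x \<le> M powr p \<longleftrightarrow> x powr (1 / p) \<le> M"
proof
  assume "x \<le> M powr p"
  then have "x powr (1 / p) \<le> (M powr p) powr (1 / p)" using assms by (intro powr_mono2) auto
  then show "x powr (1 / p) \<le> M" using assms by (simp add: powr_powr)
next
  assume "x powr (1 / p) \<le> M"
  then have "(x powr (1 / p)) powr p \<le> M powr p" using assms by (intro powr_mono2) auto
  then show "x \<le> M powr p" using assms by (simp add: powr_powr)
qed

text \<open>Every entry is at most M, so an r'-th power is at most the p-th power times M powr (r' -
  p). The same M thus works for all larger exponents, and a bound at the critical exponent covers
  the whole interval.\<close>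

lemma ell_boundI:
  fixes c :: "nat \<Rightarrow> 'k::real_normed_field"
  assumes p: "1 \<le> p" and M: "0 \<le> M" and r: "ereal p \<le> r"
    and le: "\<And>n. (\<Sum>k<n. norm (c k) powr p) \<le> M powr p"
  shows "c \<in> ell r" "ell_norm r c \<le> M"
proof -
  have cM: "norm (c k) \<le> M" for k
  proof -
    have "norm (c k) powr p \<le> (\<Sum>k<Suc k. norm (c k) powr p)"
      by (rule member_le_sum) auto
    also have "\<dots> \<le> M powr p" by (rule le)
    finally have "(norm (c k) powr p) powr (1/p) \<le> M"
      using p M by (subst (asm) powr_le_iff_le_root) auto
    then show ?thesis using p by (simp add: powr_powr)
  qed
  have "c \<in> ell r \<and> ell_norm r c \<le> M"
  proof (cases r)
    case (real r')
    then have r': "p \<le> r'" using r by simp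
    have le': "(\<Sum>k<n. norm (c k) powr r') \<le> M powr r'" for n
    proof -
      have "(\<Sum>k<n. norm (c k) powr r') \<le> (\<Sum>k<n. norm (c k) powr p * M powr (r' - p))"
      proof (rule sum_mono)
        fix k
        have "norm (c k) powr r' = norm (c k) powr p * norm (c k) powr (r' - p)" by (simp flip: powr_add)
        also have "\<dots> \<le> norm (c k) powr p * M powr (r' - p)"
          using r' cM[of k] by (intro mult_left_mono powr_mono2) auto
        finally show "norm (c k) powr r' \<le> norm (c k) powr p * M powr (r' - p)" .
      qed
      also have "\<dots> = (\<Sum>k<n. norm (c k) powr p) * M powr (r' - p)" by (simp add: sum_distrib_right)
      also have "\<dots> \<le> M powr p * M powr (r' - p)" by (rule mult_right_mono[OF le]) simp
      also have "\<dots> = M powr r'" by (simp flip: powr_add)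
      finally show ?thesis .
    qed
    have sm: "summable (\<lambda>n. norm (c n) powr r')"
      by (rule summableI_nonneg_bounded[OF _ le']) simp
    have "(\<Sum>n. norm (c n) powr r') \<le> M powr r'"
      by (rule suminf_le_const[OF sm le'])
    then have "(\<Sum>n. norm (c n) powr r') powr (1/r') \<le> M"
      using p r' M by (subst (asm) powr_le_iff_le_root) (auto intro: suminf_nonneg sm)
    then show ?thesis using sm by (simp add: real ell_norm_real)
  next
    case PInf
    have "(SUP n. norm (c n)) \<le> M" by (rule cSUP_least) (auto simp: cM)
    moreover have "bdd_above (range (\<lambda>n. norm (c n)))" by (rule bdd_aboveI2[of _ _ M]) (rule cM)
    ultimately show ?thesis using PInf by (simp add: ell_def ell_norm_def)
  next
    case MInf
    then show ?thesis using r by simp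
  qed
  then show "c \<in> ell r" "ell_norm r c \<le> M" by auto
qed

lemma ell_norm_nonneg: "a \<in> ell r \<Longrightarrow> 0 \<le> ell_norm r a"
  by (auto simp: ell_norm_def ell_def intro: cSUP_upper2[of _ _ 0])

text \<open>This is \<open>ell_boundI\<close> with M chosen as the norm of the sequence
  itself.\<close>

lemma ell_sum_le:
  fixes a :: "nat \<Rightarrow> 'k::real_normed_field"
  assumes a: "a \<in> ell q" and q: "1 \<le> q" "q \<le> ereal p"
  shows "summable (\<lambda>n. norm (a n) powr p)" "(\<Sum>n. norm (a n) powr p) powr (1 / p) \<le> ell_norm q a"
proof -
  obtain q' where q': "q = ereal q'" using q by (cases q) auto
  have q1: "1 \<le> q'" "q' \<le> p" using q q' by (auto simp: one_ereal_def)
  have sm: "summable (\<lambda>n. norm (a n) powr q')" using a by (simp add: q' ell_norm_real)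
  let ?N = "ell_norm q a"
  have N: "0 \<le> ?N" by (rule ell_norm_nonneg[OF a])
  have "(\<Sum>k<n. norm (a k) powr q') \<le> ?N powr q'" for n
  proof -
    have "(\<Sum>k<n. norm (a k) powr q') \<le> (\<Sum>k. norm (a k) powr q')"
      by (rule sum_le_suminf[OF sm]) auto
    also have "\<dots> = ?N powr q'"
      unfolding q' ell_norm_real using q1 by (simp add: powr_powr suminf_nonneg[OF sm])
    finally show ?thesis .
  qed
  from ell_boundI[OF q1(1) N _ this, of "ereal p"]
  show "summable (\<lambda>n. norm (a n) powr p)" "(\<Sum>n. norm (a n) powr p) powr (1 / p) \<le> ?N"
    using q1 by (auto simp: ell_norm_real)
qed

text \<open>Applied to the coefficients of a test function; \<open>ell_norm_le\<close> is the
  counterpart for test sequences.\<close>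

lemma ell_norm_ge:
  fixes c :: "nat \<Rightarrow> 'k::real_normed_field"
  assumes c: "c \<in> ell r" and r: "1 \<le> r" and A: "finite A" "card A = n" "1 \<le> n"
    and m: "0 \<le> m" "\<And>k. k \<in> A \<Longrightarrow> m \<le> norm (c k)"
  shows "m * real n powr rec_exp r \<le> ell_norm r c"
proof (cases r)
  case (real r')
  then have r': "1 \<le> r'" using r by (simp add: one_ereal_def)
  have sm: "summable (\<lambda>n. norm (c n) powr r')" using c by (simp add: real ell_norm_real)
  have "m * real n powr (1 / r') = (real n * m powr r') powr (1 / r')"
    using r' m by (simp add: powr_mult powr_powr)
  also have "\<dots> \<le> (\<Sum>k. norm (c k) powr r') powr (1 / r')"
  proof (rule powr_mono2)
    have "real n * m powr r' = (\<Sum>k\<in>A. m powr r')" using A by simp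
    also have "\<dots> \<le> (\<Sum>k\<in>A. norm (c k) powr r')"
      using r' m by (intro sum_mono powr_mono2) auto
    also have "\<dots> \<le> (\<Sum>k. norm (c k) powr r')"
      by (rule sum_le_suminf[OF sm A(1)]) simp
    finally show "real n * m powr r' \<le> (\<Sum>k. norm (c k) powr r')" .
  qed (use r' in auto)
  finally show ?thesis by (simp add: real rec_exp_def ell_norm_real)
next
  case PInf
  obtain k where "k \<in> A" using A by fastforce
  have "m \<le> norm (c k)" by (rule m(2)) fact
  also have "\<dots> \<le> (SUP n. norm (c n))"
    using c PInf by (intro cSUP_upper) (auto simp: ell_def)
  finally show ?thesis using PInf A by (simp add: rec_exp_def ell_norm_def)
next
  case MInf
  then show ?thesis using r by simp
qed

lemma ell_norm_le:
  fixes c :: "nat \<Rightarrow> 'k::real_normed_field"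
  assumes r: "1 \<le> r" and A: "finite A" "card A = n" "1 \<le> n"
    and m: "\<And>k. k \<in> A \<Longrightarrow> norm (c k) \<le> 1" "\<And>k. k \<notin> A \<Longrightarrow> c k = 0"
  shows "c \<in> ell r" "ell_norm r c \<le> real n powr rec_exp r"
proof -
  have "c \<in> ell r \<and> ell_norm r c \<le> real n powr rec_exp r"
  proof (cases r)
    case (real r')
    then have r': "1 \<le> r'" using r by (simp add: one_ereal_def)
    have sums: "(\<lambda>k. norm (c k) powr r') sums (\<Sum>k\<in>A. norm (c k) powr r')"
      using A m(2) r' by (intro sums_finite) auto
    have "(\<Sum>k\<in>A. norm (c k) powr r') \<le> (\<Sum>k\<in>A. 1 powr r')"
      using r' m by (intro sum_mono powr_mono2) auto
    then have "(\<Sum>k. norm (c k) powr r') \<le> real n"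
      using A sums_unique[OF sums] by simp
    then have "(\<Sum>k. norm (c k) powr r') powr (1 / r') \<le> real n powr (1 / r')"
      using r' by (intro powr_mono2 suminf_nonneg sums_summable[OF sums]) auto
    then show ?thesis using sums_summable[OF sums] by (simp add: real rec_exp_def ell_norm_real)
  next
    case PInf
    have c1: "norm (c k) \<le> 1" for k using m[of k] by (cases "k \<in> A") auto
    then have "(SUP n. norm (c n)) \<le> 1" by (intro cSUP_least) auto
    moreover have "bdd_above (range (\<lambda>n. norm (c n)))" by (rule bdd_aboveI2[of _ _ 1]) (rule c1)
    ultimately show ?thesis using PInf A by (simp add: ell_def ell_norm_def rec_exp_def)
  next
    case MInf
    then show ?thesis using r by simp
  qed
  then show "c \<in> ell r" "ell_norm r c \<le> real n powr rec_exp r" by auto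
qed

text \<open>The second factor enters through a bound B, because in \<open>dual_bound\<close> it is
  known only through a Besselian estimate. After division by U and B, Young's inequality term by
  term adds up to 1/p + 1/r; U = 0 and B = 0 are separated because they cannot be
  normalized.\<close>

lemma holder_sum:
  fixes u v :: "nat \<Rightarrow> real"
  assumes p: "1 < p" "1 < r" "1 / p + 1 / r = 1"
    and uv: "\<And>k. 0 \<le> u k" "\<And>k. 0 \<le> v k"
    and B: "0 \<le> B" and le: "(\<Sum>k\<in>A. v k powr r) \<le> B powr r"
  shows "(\<Sum>k\<in>A. u k * v k) \<le> (\<Sum>k\<in>A. u k powr p) powr (1 / p) * B"
proof (cases "finite A")
  case fin: True
  define U where "U = (\<Sum>k\<in>A. u k powr p) powr (1 / p)"
  have U: "0 \<le> U" by (simp add: U_def)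
  have Up: "(\<Sum>k\<in>A. u k powr p) = U powr p"
    unfolding U_def using p by (simp add: powr_powr sum_nonneg)
  have zero: "u k = 0" if "U = 0" "k \<in> A" for k
  proof -
    have "(\<Sum>k\<in>A. u k powr p) = 0" using Up that p by simp
    then have "u k powr p = 0" using fin that by (subst (asm) sum_nonneg_eq_0_iff) auto
    then show ?thesis by simp
  qed
  have zero': "v k = 0" if "B = 0" "k \<in> A" for k
  proof -
    have "v k powr r \<le> (\<Sum>k\<in>A. v k powr r)" using fin that by (intro member_le_sum) auto
    also have "\<dots> \<le> 0" using le that p by simp
    finally have "v k powr r = 0" using antisym[OF _ powr_ge_zero] by blast
    then show ?thesis by simp
  qed
  show ?thesis
  proof (cases "U = 0 \<or> B = 0")
    case True
    then have "(\<Sum>k\<in>A. u k * v k) = 0" using zero zero' by (intro sum.neutral) auto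
    then show ?thesis using U B by (simp flip: U_def)
  next
    case False
    then have pos: "0 < U" "0 < B" using U B by auto
    have "(\<Sum>k\<in>A. (u k / U) * (v k / B)) \<le> (\<Sum>k\<in>A. (u k / U) powr p / p + (v k / B) powr r / r)"
      using p uv pos by (intro sum_mono Youngs_inequality) auto
    also have "\<dots> = (\<Sum>k\<in>A. u k powr p) / U powr p / p + (\<Sum>k\<in>A. v k powr r) / B powr r / r"
      using uv pos by (simp add: sum.distrib powr_divide sum_divide_distrib)
    also have "\<dots> \<le> 1 / p + 1 / r"
    proof (intro add_mono divide_right_mono)
      show "(\<Sum>k\<in>A. u k powr p) / U powr p \<le> 1" using pos by (simp add: Up)
      show "(\<Sum>k\<in>A. v k powr r) / B powr r \<le> 1" using pos le by simp
    qed (use p in auto)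
    finally have "(\<Sum>k\<in>A. (u k / U) * (v k / B)) \<le> 1" using p by simp
    moreover have "(\<Sum>k\<in>A. u k * v k) / (U * B) = (\<Sum>k\<in>A. (u k / U) * (v k / B))"
      by (simp add: sum_divide_distrib)
    ultimately have "(\<Sum>k\<in>A. u k * v k) / (U * B) \<le> 1" by simp
    then show ?thesis using pos by (simp add: pos_divide_le_eq flip: U_def)
  qed
qed (simp add: B)

section \<open>Pitt's inequality\<close>

lemma measure_leb_interval:
  assumes "0 \<le> \<delta>" "\<delta> \<le> 1/2"
  shows "emeasure leb {-\<delta>..\<delta>} = ennreal (2 * \<delta>)" "measure leb {-\<delta>..\<delta>} = 2 * \<delta>"
    "emeasure leb {0<..\<delta>} = ennreal \<delta>"
  using assms unfolding leb_def
  by (subst emeasure_restrict_space measure_restrict_space; auto)+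

context trig_system
begin

lemma wt_0_AE: "AE t in leb. wt 0 f t = (f t :: 'k)"
  using AE_leb_nonzero[of 0] by eventually_elim (simp add: wt_def)

text \<open>The density |t| powr 0 is 0 at t = 0 and 1 elsewhere, so the identification passes
  through almost everywhere equality.\<close>

lemma H_0_iff:
  assumes f: "f \<in> borel_measurable leb"
  shows "(f :: real \<Rightarrow> 'k) \<in> vectors (H 0) \<longleftrightarrow> f \<in> vectors (L2_space leb)"
    "vnorm (H 0) f = vnorm (L2_space leb) f"
proof -
  note [measurable] = f
  have m: "wt 0 f \<in> borel_measurable leb" by measurable
  have 1: "AE t in leb. norm (wt 0 f t) \<le> norm (f t)" "AE t in leb. norm (f t) \<le> norm (wt 0 f t)"
    using wt_0_AE[of f] by (eventually_elim, simp)+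
  show "f \<in> vectors (H 0) \<longleftrightarrow> f \<in> vectors (L2_space leb)"
    using wt_mem_iff(1)[OF f, of 0] L2_vnorm_mono(1)[OF _ m 1(1)] L2_vnorm_mono(1)[OF _ f 1(2)] by auto
  show "vnorm (H 0) f = vnorm (L2_space leb) f"
    using wt_mem_iff(2)[OF f, of 0] vnorm_L2_cong_AE[OF wt_0_AE m f] by simp
qed

lemma bessel_H:
  assumes f: "f \<in> vectors (H s)" and s: "s \<le> 0"
  shows "(\<Sum>k<n. norm (fourier_coeff f k) powr 2) \<le> (sqrt 2 * vnorm (H s) f) powr 2"
proof -
  note f0 = H_antimono[OF f s]
  have fL: "f \<in> vectors (L2_space leb)" "vnorm (L2_space leb) f = vnorm (H 0) f"
    using H_0_iff[OF H_measurable[OF f]] f0(1) by simp_all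
  have "(\<Sum>k<n. norm (fourier_coeff f k) powr 2) = (\<Sum>k<n. (norm (fourier_coeff f k))\<^sup>2)"
    by simp
  also have "\<dots> \<le> 2 * (vnorm (L2_space leb) f)\<^sup>2" by (rule bessel[OF fL(1)])
  also have "\<dots> \<le> 2 * (vnorm (H s) f)\<^sup>2"
    using f0(2) by (simp add: fL(2) power_mono)
  also have "\<dots> = (sqrt 2 * vnorm (H s) f) powr 2"
    by (simp add: power_mult_distrib)
  finally show ?thesis .
qed

text \<open>The part of \<open>f\<close> on \<open>\<bar>t\<bar> \<le> \<delta>\<close> has coefficients of modulus at most \<open>\<sigma>\<close> if \<open>\<delta>\<close> is chosen such
  that \<open>A * B * \<delta> powr (1/r) = \<sigma>\<close>; the rest of \<open>f\<close> is square integrable and Bessel's inequality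
  applies to it.\<close>

lemma truncated_coeff:
  fixes \<alpha> r \<sigma> A B :: real
  assumes f: "f \<in> vectors (H \<alpha>)" and \<alpha>: "0 < \<alpha>" "\<alpha> < 1" and r: "r = 2 / (1 - \<alpha>)"
    and A: "A = vnorm (H \<alpha>) f" "0 < A" and B: "B = 2 * sqrt (2 / (1 - \<alpha>))" and \<sigma>: "0 < \<sigma>"
  shows "ennreal (\<Sum>k<n. (max 0 (norm (fourier_coeff f k) - \<sigma>))\<^sup>2)
    \<le> 2 * (\<integral>\<^sup>+t. (if \<sigma> < A * B * \<bar>t\<bar> powr (1/r) then ennreal ((norm (f t))\<^sup>2) else 0) \<partial>leb)"
proof -
  have r0: "0 < r" and B0: "0 < B" using \<alpha> by (simp_all add: r B)
  note fm [measurable] = H_measurable[OF f]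
  define \<delta> where "\<delta> = (\<sigma> / (A * B)) powr r"
  have \<delta>: "0 < \<delta>" using \<sigma> A B0 by (simp add: \<delta>_def)
  have \<delta>r: "A * B * \<delta> powr (1/r) = \<sigma>"
    using \<sigma> A B0 r0 by (simp add: \<delta>_def powr_powr)
  have iff: "\<delta> < \<bar>t\<bar> \<longleftrightarrow> \<sigma> < A * B * \<bar>t\<bar> powr (1/r)" for t
  proof -
    have "\<delta> < \<bar>t\<bar> \<longleftrightarrow> \<delta> powr (1/r) < \<bar>t\<bar> powr (1/r)"
      using \<delta> r0 by (smt (verit, best) powr_less_mono2 abs_ge_zero divide_pos_pos)
    also have "\<dots> \<longleftrightarrow> A * B * \<delta> powr (1/r) < A * B * \<bar>t\<bar> powr (1/r)"
      using A B0 by (subst mult_less_cancel_left_pos) auto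
    finally show ?thesis by (simp only: \<delta>r)
  qed
  define I :: "real \<Rightarrow> 'k" where "I t = (if \<bar>t\<bar> \<le> \<delta> then 1 else 0)" for t
  have Ib [measurable]: "I \<in> borel_measurable borel" unfolding I_def[abs_def] by measurable
  note Im [measurable] = borel_measurable_leb[OF Ib]
  define f1 where "f1 t = I t * f t" for t
  define f2 where "f2 t = (1 - I t) * f t" for t
  have [measurable]: "f1 \<in> borel_measurable leb" "f2 \<in> borel_measurable leb"
    unfolding f1_def[abs_def] f2_def[abs_def] by measurable
  have f1H: "f1 \<in> vectors (H \<alpha>)" and f2H: "f2 \<in> vectors (H \<alpha>)"
    by (rule L2_vnorm_mono(1)[OF f]; simp add: measurable_power_measure f1_def f2_def I_def)+
  have eq: "fourier_coeff f k = fourier_coeff f1 k + fourier_coeff f2 k" for k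
  proof -
    have "fourier_coeff (\<lambda>t. f t - f2 t) k = fourier_coeff f k - fourier_coeff f2 k"
      by (rule fourier_coeff_diff[OF f f2H \<alpha>(2)])
    moreover have "(\<lambda>t. f t - f2 t) = f1" by (simp add: fun_eq_iff f1_def f2_def algebra_simps)
    ultimately show ?thesis by simp
  qed
  \<comment> \<open>A bound for the cut-off in the dual space \<open>H (-\<alpha>)\<close>. Its
    power of \<delta> is (1 - \<alpha>)/2 = 1/r, which is where the exponent r originates.\<close>
  let ?v = "sqrt (2 / (1 - \<alpha>) * \<delta> powr (1 - \<alpha>))"
  have I: "I \<in> vectors (H (-\<alpha>))" "vnorm (H (-\<alpha>)) I \<le> ?v"
  proof -
    have "(\<integral>\<^sup>+t. ennreal (\<bar>t\<bar> powr (-\<alpha>) * (norm (I t))\<^sup>2) \<partial>leb)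
        = (\<integral>\<^sup>+t. ennreal (\<bar>t\<bar> powr (-\<alpha>)) * indicator {..\<delta>} \<bar>t\<bar> \<partial>leb)"
      by (rule nn_integral_cong) (simp add: I_def split: split_indicator)
    also have "\<dots> \<le> ennreal (2 * \<delta> powr (- \<alpha> + 1) / (- \<alpha> + 1))"
      by (rule nn_integral_abs_powr_le) (use \<alpha> \<delta> in simp_all)
    also have "2 * \<delta> powr (- \<alpha> + 1) / (- \<alpha> + 1) = ?v\<^sup>2"
      using \<alpha> by (simp add: add.commute)
    finally have le: "(\<integral>\<^sup>+t. ennreal (\<bar>t\<bar> powr (-\<alpha>) * (norm (I t))\<^sup>2) \<partial>leb) \<le> ennreal (?v\<^sup>2)" .
    have "0 \<le> ?v" using \<alpha> by simp
    from H_boundI[OF Im le this] show "I \<in> vectors (H (-\<alpha>))" "vnorm (H (-\<alpha>)) I \<le> ?v" by auto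
  qed
  have f1_le: "norm (fourier_coeff f1 k) \<le> \<sigma>" for k
  proof -
    have int: "integrable leb (\<lambda>t. 2 * (norm (f t) * norm (I t)))"
      using H_pairing(1)[OF f I(1)] by simp
    have "norm (fourier_coeff f1 k) \<le> (\<integral>t. norm (f1 t * y k t) \<partial>leb)"
      unfolding fourier_coeff_def by (rule integral_norm_bound)
    also have "\<dots> \<le> (\<integral>t. 2 * (norm (f t) * norm (I t)) \<partial>leb)"
    proof (rule integral_mono[OF _ int])
      show "integrable leb (\<lambda>t. norm (f1 t * y k t))"
        by (rule integrable_norm[OF integrable_mult_y[OF f1H \<alpha>(2)]])
      show "norm (f1 t * y k t) \<le> 2 * (norm (f t) * norm (I t))" for t
        using mult_right_mono[OF norm_y[of k t], of "norm (I t) * norm (f t)"]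
        by (simp add: f1_def norm_mult mult_ac)
    qed
    also have "\<dots> = 2 * (\<integral>t. norm (f t) * norm (I t) \<partial>leb)" by simp
    also have "\<dots> \<le> 2 * (A * ?v)"
    proof -
      have "A * vnorm (H (-\<alpha>)) I \<le> A * ?v" by (rule mult_left_mono[OF I(2)]) (use A in simp)
      then show ?thesis using H_pairing(2)[OF f I(1)] unfolding A(1)[symmetric] by linarith
    qed
    also have "?v = sqrt (2 / (1 - \<alpha>)) * \<delta> powr (1/r)"
    proof -
      have "sqrt (\<delta> powr (1 - \<alpha>)) = \<delta> powr (1/r)"
        using \<delta> by (simp add: r powr_powr flip: powr_half_sqrt)
      then show ?thesis by (simp only: real_sqrt_mult)
    qed
    also have "2 * (A * (sqrt (2 / (1 - \<alpha>)) * \<delta> powr (1/r))) = A * B * \<delta> powr (1/r)"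
      by (simp add: B)
    finally show ?thesis by (simp only: \<delta>r)
  qed
  \<comment> \<open>Outside |t| <= \<delta> the weight is at least \<delta> powr \<alpha>, so this
    part of f is square integrable without the weight.\<close>
  have f2le: "\<delta> powr \<alpha> * (norm (f2 t))\<^sup>2 \<le> \<bar>t\<bar> powr \<alpha> * (norm (f t))\<^sup>2" for t
    using \<alpha> \<delta> by (auto simp: f2_def I_def intro!: mult_right_mono powr_mono2)
  have f2eq: "ennreal ((norm (f2 t))\<^sup>2) = (if \<sigma> < A * B * \<bar>t\<bar> powr (1/r) then ennreal ((norm (f t))\<^sup>2) else 0)" for t
    using iff[of t] by (auto simp: f2_def I_def)
  have f2L: "f2 \<in> vectors (L2_space leb)"
  proof (rule L2_boundI(1))
    let ?c = "sqrt (A\<^sup>2 / \<delta> powr \<alpha>)"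
    have "(\<integral>\<^sup>+t. ennreal ((norm (f2 t))\<^sup>2) \<partial>leb)
        \<le> (\<integral>\<^sup>+t. ennreal (1 / \<delta> powr \<alpha>) * ennreal (\<bar>t\<bar> powr \<alpha> * (norm (f t))\<^sup>2) \<partial>leb)"
    proof (rule nn_integral_mono)
      fix t
      have "(norm (f2 t))\<^sup>2 \<le> (1 / \<delta> powr \<alpha>) * (\<bar>t\<bar> powr \<alpha> * (norm (f t))\<^sup>2)"
        using f2le[of t] \<delta> by (simp add: pos_le_divide_eq mult.commute)
      then show "ennreal ((norm (f2 t))\<^sup>2) \<le> ennreal (1 / \<delta> powr \<alpha>) * ennreal (\<bar>t\<bar> powr \<alpha> * (norm (f t))\<^sup>2)"
        by (subst ennreal_mult[symmetric]) (auto intro: ennreal_leI)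
    qed
    also have "\<dots> = ennreal (1 / \<delta> powr \<alpha>) * ennreal (A\<^sup>2)"
    proof (subst nn_integral_cmult)
      have [measurable]: "(\<lambda>t. \<bar>t\<bar> powr \<alpha>) \<in> borel_measurable leb" by measurable
      show "(\<lambda>t. ennreal (\<bar>t\<bar> powr \<alpha> * (norm (f t))\<^sup>2)) \<in> borel_measurable leb" by measurable
    qed (simp only: nn_integral_H_eq[OF f] A)
    also have "\<dots> = ennreal (?c\<^sup>2)"
      by (subst ennreal_mult[symmetric]) simp_all
    finally show "(\<integral>\<^sup>+t. ennreal ((norm (f2 t))\<^sup>2) \<partial>leb) \<le> ennreal (?c\<^sup>2)" .
  qed auto
  \<comment> \<open>The inner part accounts for at most \<sigma> of each coefficient, so any excess
    over \<sigma> is due to \<open>f2\<close>.\<close>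
  have "(\<Sum>k<n. (max 0 (norm (fourier_coeff f k) - \<sigma>))\<^sup>2) \<le> (\<Sum>k<n. (norm (fourier_coeff f2 k))\<^sup>2)"
  proof (rule sum_mono)
    fix k
    have "norm (fourier_coeff f k) - \<sigma> \<le> norm (fourier_coeff f2 k)"
      using norm_triangle_ineq[of "fourier_coeff f1 k" "fourier_coeff f2 k"] f1_le[of k]
      unfolding eq[of k] by linarith
    then show "(max 0 (norm (fourier_coeff f k) - \<sigma>))\<^sup>2 \<le> (norm (fourier_coeff f2 k))\<^sup>2"
      by (intro power_mono) auto
  qed
  also have "\<dots> \<le> 2 * (vnorm (L2_space leb) f2)\<^sup>2" by (rule bessel[OF f2L])
  finally have "ennreal (\<Sum>k<n. (max 0 (norm (fourier_coeff f k) - \<sigma>))\<^sup>2) \<le> ennreal (2 * (vnorm (L2_space leb) f2)\<^sup>2)"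
    by (rule ennreal_leI)
  also have "\<dots> = 2 * (\<integral>\<^sup>+t. ennreal ((norm (f2 t))\<^sup>2) \<partial>leb)"
    by (subst ennreal_mult) (simp_all add: nn_integral_L2[OF f2L])
  finally show ?thesis by (simp only: f2eq)
qed

text \<open>Marcinkiewicz interpolation in disguise: integrate the previous estimate against
  \<open>\<sigma> powr (r - 3)\<close>.\<close>

lemma pitt_pos:
  fixes \<alpha> r A B :: real
  assumes f: "f \<in> vectors (H \<alpha>)" and \<alpha>: "0 < \<alpha>" "\<alpha> < 1" and r: "r = 2 / (1 - \<alpha>)"
    and A: "A = vnorm (H \<alpha>) f" "0 < A" and B: "B = 2 * sqrt (2 / (1 - \<alpha>))"
  shows "(\<Sum>k<n. (norm (fourier_coeff f k) / 2) powr r) \<le> 2 * B powr (r - 2) * A powr r"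
proof -
  interpret leb: finite_measure leb by (rule finite_measure_leb)
  interpret pair_sigma_finite lborel leb ..
  have r2: "2 < r" using \<alpha> by (simp add: r pos_less_divide_eq)
  have B0: "0 < B" using \<alpha> by (simp add: B)
  note fm [measurable] = H_measurable[OF f]
  let ?c = "\<lambda>k. norm (fourier_coeff f k)"
  let ?w = "\<lambda>\<sigma>::real. ennreal (\<sigma> powr (r - 3))"
  let ?F = "\<lambda>\<sigma> t. if 0 < \<sigma> \<and> \<sigma> < A * B * \<bar>t\<bar> powr (1/r) then ?w \<sigma> * ennreal ((norm (f t))\<^sup>2) else 0"
  have int_w: "(\<integral>\<^sup>+\<sigma>\<in>{0..b}. ?w \<sigma> \<partial>lborel) = ennreal (b powr (r - 2) / (r - 2))" if "0 \<le> b" for b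
    using nn_integral_powr_0[of "r - 3" b] r2 that by simp
  \<comment> \<open>Layer-cake form: b powr r / (r - 2) is b^2 times the integral of \<sigma> powr
    (r - 3) over [0, b], which converges at 0 because r > 2. The factor b^2 is kept apart in order
    to be compared with the squared excess.\<close>
  have "ennreal (\<Sum>k<n. (?c k / 2) powr r / (r - 2)) = (\<Sum>k<n. ennreal ((?c k / 2)\<^sup>2) * ennreal ((?c k / 2) powr (r - 2) / (r - 2)))"
  proof (subst sum_ennreal[symmetric])
    show "(\<Sum>k<n. ennreal ((?c k / 2) powr r / (r - 2)))
        = (\<Sum>k<n. ennreal ((?c k / 2)\<^sup>2) * ennreal ((?c k / 2) powr (r - 2) / (r - 2)))"
    proof (rule sum.cong)
      fix k
      have "(?c k / 2)\<^sup>2 * (?c k / 2) powr (r - 2) = (?c k / 2) powr r"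
        using powr_add[of "?c k / 2" 2 "r - 2"] by simp
      then show "ennreal ((?c k / 2) powr r / (r - 2)) = ennreal ((?c k / 2)\<^sup>2) * ennreal ((?c k / 2) powr (r - 2) / (r - 2))"
        using r2 by (subst ennreal_mult[symmetric]) simp_all
    qed simp
  qed (use r2 in simp)
  also have "\<dots> = (\<Sum>k<n. ennreal ((?c k / 2)\<^sup>2) * (\<integral>\<^sup>+\<sigma>\<in>{0..?c k / 2}. ?w \<sigma> \<partial>lborel))"
    by (simp add: int_w)
  also have "\<dots> = (\<integral>\<^sup>+\<sigma>. (\<Sum>k<n. ennreal ((?c k / 2)\<^sup>2) * (?w \<sigma> * indicator {0..?c k / 2} \<sigma>)) \<partial>lborel)"
    by (subst nn_integral_sum) (simp_all add: nn_integral_cmult)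
  also have "\<dots> \<le> (\<integral>\<^sup>+\<sigma>. 2 * (\<integral>\<^sup>+t. ?F \<sigma> t \<partial>leb) \<partial>lborel)"
  proof (rule nn_integral_mono)
    fix \<sigma> :: real
    show "(\<Sum>k<n. ennreal ((?c k / 2)\<^sup>2) * (?w \<sigma> * indicator {0..?c k / 2} \<sigma>)) \<le> 2 * (\<integral>\<^sup>+t. ?F \<sigma> t \<partial>leb)"
    proof (cases "0 < \<sigma>")
      case False
      then have z: "?w \<sigma> * indicator {0..?c k / 2} \<sigma> = 0" for k
        by (cases "\<sigma> = 0") (simp_all add: indicator_def)
      show ?thesis unfolding z by simp
    next
      case True
      let ?J = "\<integral>\<^sup>+t. (if \<sigma> < A * B * \<bar>t\<bar> powr (1/r) then ennreal ((norm (f t))\<^sup>2) else 0) \<partial>leb"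
      have "(\<Sum>k<n. ennreal ((?c k / 2)\<^sup>2) * (?w \<sigma> * indicator {0..?c k / 2} \<sigma>))
          \<le> (\<Sum>k<n. ?w \<sigma> * ennreal ((max 0 (?c k - \<sigma>))\<^sup>2))"
      proof (rule sum_mono)
        fix k
        show "ennreal ((?c k / 2)\<^sup>2) * (?w \<sigma> * indicator {0..?c k / 2} \<sigma>) \<le> ?w \<sigma> * ennreal ((max 0 (?c k - \<sigma>))\<^sup>2)"
        proof (cases "\<sigma> \<le> ?c k / 2")
          \<comment> \<open>For \<sigma> at most half of the coefficient, the excess is still at
            least that half; hence the division by 2 in the statement.\<close>
          case True
          then have "?c k / 2 \<le> max 0 (?c k - \<sigma>)"
            by (intro order_trans[OF _ max.cobounded2]) linarith
          then have "(?c k / 2)\<^sup>2 \<le> (max 0 (?c k - \<sigma>))\<^sup>2" by (intro power_mono) simp_all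
          then have "?w \<sigma> * ennreal ((?c k / 2)\<^sup>2) \<le> ?w \<sigma> * ennreal ((max 0 (?c k - \<sigma>))\<^sup>2)"
            by (intro mult_left_mono ennreal_leI) simp_all
          then show ?thesis using True \<open>0 < \<sigma>\<close> by (simp add: mult.commute)
        qed simp
      qed
      also have "\<dots> = ?w \<sigma> * ennreal (\<Sum>k<n. (max 0 (?c k - \<sigma>))\<^sup>2)"
        by (simp add: sum_distrib_left[symmetric] sum_ennreal)
      also have "\<dots> \<le> ?w \<sigma> * (2 * ?J)"
        by (rule mult_left_mono[OF truncated_coeff[OF f \<alpha> r A B True]]) simp
      also have "\<dots> = 2 * (?w \<sigma> * ?J)" by (simp only: mult_ac)
      also have "?w \<sigma> * ?J = (\<integral>\<^sup>+t. ?w \<sigma> * (if \<sigma> < A * B * \<bar>t\<bar> powr (1/r) then ennreal ((norm (f t))\<^sup>2) else 0) \<partial>leb)"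
        by (rule nn_integral_cmult[symmetric]) measurable
      also have "\<dots> = (\<integral>\<^sup>+t. ?F \<sigma> t \<partial>leb)"
        using True by (intro nn_integral_cong) simp
      finally show ?thesis .
    qed
  qed
  also have "\<dots> = 2 * (\<integral>\<^sup>+\<sigma>. (\<integral>\<^sup>+t. ?F \<sigma> t \<partial>leb) \<partial>lborel)"
    by (rule nn_integral_cmult) measurable
  also have "(\<integral>\<^sup>+\<sigma>. (\<integral>\<^sup>+t. ?F \<sigma> t \<partial>leb) \<partial>lborel) = (\<integral>\<^sup>+t. (\<integral>\<^sup>+\<sigma>. ?F \<sigma> t \<partial>lborel) \<partial>leb)"
    by (rule Fubini'[symmetric]) measurable
  also have "\<dots> \<le> (\<integral>\<^sup>+t. ennreal ((A * B) powr (r - 2) / (r - 2)) * ennreal (\<bar>t\<bar> powr \<alpha> * (norm (f t))\<^sup>2) \<partial>leb)"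
  proof (rule nn_integral_mono)
    fix t
    let ?b = "A * B * \<bar>t\<bar> powr (1/r)"
    have "(\<integral>\<^sup>+\<sigma>. ?F \<sigma> t \<partial>lborel) \<le> (\<integral>\<^sup>+\<sigma>. (?w \<sigma> * indicator {0..?b} \<sigma>) * ennreal ((norm (f t))\<^sup>2) \<partial>lborel)"
      by (rule nn_integral_mono) (simp split: split_indicator)
    also have "\<dots> = (\<integral>\<^sup>+\<sigma>\<in>{0..?b}. ?w \<sigma> \<partial>lborel) * ennreal ((norm (f t))\<^sup>2)"
    proof (rule nn_integral_multc)
      have "(\<lambda>\<sigma>. ?w \<sigma> * indicator {0..?b} \<sigma>) \<in> borel_measurable borel" by measurable
      then show "(\<lambda>\<sigma>. ?w \<sigma> * indicator {0..?b} \<sigma>) \<in> borel_measurable lborel" by simp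
    qed
    also have "\<dots> = ennreal (?b powr (r - 2) / (r - 2)) * ennreal ((norm (f t))\<^sup>2)"
      using A B0 by (subst int_w) simp_all
    also have "?b powr (r - 2) = (A * B) powr (r - 2) * \<bar>t\<bar> powr \<alpha>"
    proof -
      \<comment> \<open>With this choice of r the integral over \<sigma> reproduces exactly the
        weight |t| powr \<alpha>.\<close>
      have "(1/r) * (r - 2) = \<alpha>" using \<alpha> by (simp add: r field_simps)
      then have "(\<bar>t\<bar> powr (1/r)) powr (r - 2) = \<bar>t\<bar> powr \<alpha>" by (simp only: powr_powr)
      then show ?thesis using A B0 by (simp only: powr_mult)
    qed
    also have "ennreal ((A * B) powr (r - 2) * \<bar>t\<bar> powr \<alpha> / (r - 2)) * ennreal ((norm (f t))\<^sup>2)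
        = ennreal ((A * B) powr (r - 2) / (r - 2)) * ennreal (\<bar>t\<bar> powr \<alpha> * (norm (f t))\<^sup>2)"
      using r2 by (subst (1 2) ennreal_mult[symmetric]) (simp_all add: mult_ac)
    finally show "(\<integral>\<^sup>+\<sigma>. ?F \<sigma> t \<partial>lborel)
      \<le> ennreal ((A * B) powr (r - 2) / (r - 2)) * ennreal (\<bar>t\<bar> powr \<alpha> * (norm (f t))\<^sup>2)" .
  qed
  also have "\<dots> = ennreal ((A * B) powr (r - 2) / (r - 2)) * ennreal (A\<^sup>2)"
  proof (subst nn_integral_cmult)
    have [measurable]: "(\<lambda>t. \<bar>t\<bar> powr \<alpha>) \<in> borel_measurable leb" by measurable
    show "(\<lambda>t. ennreal (\<bar>t\<bar> powr \<alpha> * (norm (f t))\<^sup>2)) \<in> borel_measurable leb" by measurable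
  qed (simp only: nn_integral_H_eq[OF f] A)
  also have "2 * \<dots> = ennreal (2 * ((A * B) powr (r - 2) / (r - 2) * A\<^sup>2))"
    using r2 by (subst ennreal_mult[symmetric], simp, simp, subst ennreal_numeral[symmetric], subst ennreal_mult[symmetric]) simp_all
  finally have "ennreal (\<Sum>k<n. (?c k / 2) powr r / (r - 2)) \<le> ennreal (2 * ((A * B) powr (r - 2) / (r - 2) * A\<^sup>2))"
    by (simp add: mult_left_mono)
  then have "(\<Sum>k<n. (?c k / 2) powr r / (r - 2)) \<le> 2 * ((A * B) powr (r - 2) / (r - 2) * A\<^sup>2)"
    using r2 by (subst (asm) ennreal_le_iff) simp_all
  then have "(\<Sum>k<n. (?c k / 2) powr r) / (r - 2) \<le> (2 * ((A * B) powr (r - 2) * A\<^sup>2)) / (r - 2)"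
    by (simp add: sum_divide_distrib)
  then have "(\<Sum>k<n. (?c k / 2) powr r) \<le> 2 * ((A * B) powr (r - 2) * A\<^sup>2)"
    using r2 by (subst (asm) divide_le_cancel) simp
  also have "(A * B) powr (r - 2) * A\<^sup>2 = B powr (r - 2) * A powr r"
    using A B0 powr_add[of A "r - 2" 2] by (simp add: powr_mult)
  finally show ?thesis by (simp only: mult.assoc)
qed

text \<open>For \<alpha> = 0 the exponent is r = 2, where \<sigma> powr (r - 3) is not integrable at
  0, and Bessel's inequality takes over. Functions of norm 0 are separated because the truncation
  level is normalized by the norm; their coefficients vanish.\<close>

lemma pitt:
  assumes \<alpha>: "0 \<le> \<alpha>" "\<alpha> < 1" and r: "r = 2 / (1 - \<alpha>)"
  obtains C where "0 \<le> C"
    "\<And>f n. f \<in> vectors (H \<alpha>) \<Longrightarrow> (\<Sum>k<n. norm (fourier_coeff f k) powr r) \<le> (C * vnorm (H \<alpha>) f) powr r"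
proof (cases "\<alpha> = 0")
  case True
  then show ?thesis using that[of "sqrt 2"] bessel_H[of _ 0] r by simp
next
  case False
  then have \<alpha>': "0 < \<alpha>" using \<alpha> by simp
  define B where "B = 2 * sqrt (2 / (1 - \<alpha>))"
  define C where "C = (2 powr r * (2 * B powr (r - 2))) powr (1 / r)"
  have r0: "0 < r" using \<alpha> by (simp add: r)
  show ?thesis
  proof (rule that[of C])
    fix f :: "real \<Rightarrow> 'k" and n assume f: "f \<in> vectors (H \<alpha>)"
    show "(\<Sum>k<n. norm (fourier_coeff f k) powr r) \<le> (C * vnorm (H \<alpha>) f) powr r"
    proof (cases "vnorm (H \<alpha>) f = 0")
      case True
      then have "norm (fourier_coeff f k) = 0" for k
        using norm_fourier_coeff_le[OF f, of k] \<alpha>' \<alpha> by simp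
      then show ?thesis by simp
    next
      case False
      then have pos: "0 < vnorm (H \<alpha>) f" using vnorm_L2_nonneg[of _ f] by (simp only: less_le) simp
      have "(\<Sum>k<n. norm (fourier_coeff f k) powr r) = 2 powr r * (\<Sum>k<n. (norm (fourier_coeff f k) / 2) powr r)"
        by (simp add: sum_distrib_left powr_divide)
      also have "\<dots> \<le> 2 powr r * (2 * B powr (r - 2) * vnorm (H \<alpha>) f powr r)"
        by (intro mult_left_mono pitt_pos[OF f \<alpha>' \<alpha>(2) r refl pos B_def]) simp
      also have "\<dots> = C powr r * vnorm (H \<alpha>) f powr r"
        using r0 by (simp add: C_def powr_powr mult.assoc)
      also have "\<dots> = (C * vnorm (H \<alpha>) f) powr r"
        by (simp add: powr_mult C_def)
      finally show ?thesis .
    qed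
  qed (simp add: C_def)
qed

end

section \<open>Besselian and Hilbertian exponents\<close>

text \<open>By the parallelogram law, one of the two choices of the next sign is at least as good as the
  average.\<close>

lemma L2_signs:
  fixes x :: "nat \<Rightarrow> 's \<Rightarrow> 'k::{real_normed_field,euclidean_space}"
  assumes x: "\<And>k. x k \<in> vectors (L2_space M)"
  shows "\<exists>e. (\<forall>k. norm (e k) = 1) \<and>
      (vnorm (L2_space M) (\<lambda>t. \<Sum>k<n. e k * x k t))\<^sup>2 \<le> (\<Sum>k<n. (vnorm (L2_space M) (x k))\<^sup>2)"
    and "\<exists>e. (\<forall>k. norm (e k) = 1) \<and>
      (\<Sum>k<n. (vnorm (L2_space M) (x k))\<^sup>2) \<le> (vnorm (L2_space M) (\<lambda>t. \<Sum>k<n. e k * x k t))\<^sup>2"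
proof -
  let ?N = "\<lambda>f. (vnorm (L2_space M) f)\<^sup>2"
  have step: "?N (\<lambda>t. \<Sum>k<Suc n. (e(n := c)) k * x k t) = ?N (\<lambda>t. (\<Sum>k<n. e k * x k t) + c * x n t)" for e c n
  proof -
    have "(\<Sum>k<Suc n. (e(n := c)) k * x k t) = (\<Sum>k<n. e k * x k t) + c * x n t" for t
    proof -
      have "(\<Sum>k<n. (e(n := c)) k * x k t) = (\<Sum>k<n. e k * x k t)" by (rule sum.cong) auto
      then show ?thesis by simp
    qed
    then show ?thesis by simp
  qed
  have par: "?N (\<lambda>t. \<Sum>k<Suc n. (e(n := 1)) k * x k t) + ?N (\<lambda>t. \<Sum>k<Suc n. (e(n := -1)) k * x k t)
      = 2 * ?N (\<lambda>t. \<Sum>k<n. e k * x k t) + 2 * ?N (x n)" for e n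
    unfolding step using L2_parallelogram[OF L2_lincomb[of x M e "{..<n}", OF x] x[of n]] by simp
  show "\<exists>e. (\<forall>k. norm (e k) = 1) \<and> ?N (\<lambda>t. \<Sum>k<n. e k * x k t) \<le> (\<Sum>k<n. ?N (x k))"
  proof (induction n)
    case 0
    show ?case by (rule exI[of _ "\<lambda>_. 1"]) (simp add: vnorm_L2)
  next
    case (Suc n)
    then obtain e where e: "\<forall>k. norm (e k) = 1" "?N (\<lambda>t. \<Sum>k<n. e k * x k t) \<le> (\<Sum>k<n. ?N (x k))"
      by blast
    have "?N (\<lambda>t. \<Sum>k<Suc n. (e(n := 1)) k * x k t) \<le> (\<Sum>k<Suc n. ?N (x k)) \<or>
        ?N (\<lambda>t. \<Sum>k<Suc n. (e(n := -1)) k * x k t) \<le> (\<Sum>k<Suc n. ?N (x k))"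
      using par[of e n] e(2) unfolding sum.lessThan_Suc[of "\<lambda>k. ?N (x k)"] by linarith
    moreover have "\<forall>k. norm ((e(n := 1)) k) = 1" "\<forall>k. norm ((e(n := -1)) k) = 1" using e(1) by auto
    ultimately show ?case by blast
  qed
  show "\<exists>e. (\<forall>k. norm (e k) = 1) \<and> (\<Sum>k<n. ?N (x k)) \<le> ?N (\<lambda>t. \<Sum>k<n. e k * x k t)"
  proof (induction n)
    case 0
    show ?case by (rule exI[of _ "\<lambda>_. 1"]) simp
  next
    case (Suc n)
    then obtain e where e: "\<forall>k. norm (e k) = 1" "(\<Sum>k<n. ?N (x k)) \<le> ?N (\<lambda>t. \<Sum>k<n. e k * x k t)"
      by blast
    have "(\<Sum>k<Suc n. ?N (x k)) \<le> ?N (\<lambda>t. \<Sum>k<Suc n. (e(n := 1)) k * x k t) \<or>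
        (\<Sum>k<Suc n. ?N (x k)) \<le> ?N (\<lambda>t. \<Sum>k<Suc n. (e(n := -1)) k * x k t)"
      using par[of e n] e(2) unfolding sum.lessThan_Suc[of "\<lambda>k. ?N (x k)"] by linarith
    moreover have "\<forall>k. norm ((e(n := 1)) k) = 1" "\<forall>k. norm ((e(n := -1)) k) = 1" using e(1) by auto
    ultimately show ?case by blast
  qed
qed

lemma card_odd_less: "card {k. odd k \<and> k < 2 * n} = n"
proof -
  have "{k. odd k \<and> k < 2 * n} = (\<lambda>j. 2 * j + 1) ` {..<n}"
    by (auto elim!: oddE)
  then show ?thesis by (simp add: card_image inj_on_def)
qed

context trig_system
begin

section \<open>Sufficient conditions: Besselian estimates and their duals\<close>

lemma besselianI:
  assumes s: "-1 < s" "s < 1" and p: "1 \<le> p" "ereal p \<le> r" and C: "0 \<le> C"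
    and le: "\<And>f n. f \<in> vectors (H s) \<Longrightarrow>
      (\<Sum>k<n. norm (fourier_coeff f k) powr p) \<le> (C * vnorm (H s) f) powr p"
  shows "besselian r x (H s)"
  unfolding besselian_def
proof (intro conjI exI[of _ C] ballI)
  show "schauder_basis (H s) x" by (rule schauder_basis_H[OF s])
  fix f :: "real \<Rightarrow> 'k" assume f: "f \<in> vectors (H s)"
  have "0 \<le> C * vnorm (H s) f" using C by simp
  from ell_boundI[OF p(1) this p(2) le[OF f]]
  show "coords (H s) x f \<in> ell r" "ell_norm r (coords (H s) x f) \<le> C * vnorm (H s) f"
    by (simp_all add: coords_H[OF f s])
qed

lemma dual_bound:
  assumes s: "-1 < s" "s < 1" and p: "1 < p" "1 < r" "1 / p + 1 / r = 1" and C: "0 \<le> C"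
    and le: "\<And>f n. f \<in> vectors (H s) \<Longrightarrow>
      (\<Sum>k<n. norm (fourier_coeff f k) powr r) \<le> (C * vnorm (H s) f) powr r"
    and A: "finite A"
  shows "vnorm (H (-s)) (\<lambda>t. \<Sum>k\<in>A. a k * x k t) \<le> C * (\<Sum>k\<in>A. norm (a k) powr p) powr (1 / p)"
proof -
  define F where "F t = (\<Sum>k\<in>A. a k * x k t)" for t
  define G where "G = wt (-s) F"
  define V where "V = vnorm (H (-s)) F"
  have F: "F \<in> vectors (H (-s))"
    unfolding F_def[abs_def] by (rule comb_H) (use s in simp)
  have eq: "s + 2 * (- s) = - s" by simp
  have G: "G \<in> vectors (H s)" "vnorm (H s) G = V"
    using wt_H[of F s "-s"] F unfolding G_def V_def eq by simp_all
  have Gy: "integrable leb (\<lambda>t. G t * y k t)" for k by (rule integrable_mult_y[OF G(1) s(2)])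
  have "V\<^sup>2 = (\<integral>t. (norm (wt (-s/2) F t))\<^sup>2 \<partial>leb)"
    unfolding V_def vnorm_L2_sq[symmetric] using wt_mem_iff(2)[OF H_measurable[OF F], of "-s"] by simp
  also have "\<dots> = (\<integral>t. (\<Sum>k\<in>A. (a k \<bullet> (G t * y k t)) / d k) \<partial>leb)"
  proof (rule Bochner_Integration.integral_cong[OF refl])
    fix t
    have "(norm (wt (-s/2) F t))\<^sup>2 = \<bar>t\<bar> powr (-s) * (F t \<bullet> F t)"
      using norm_wt_sq[of "-s" F t] by (simp add: power2_norm_eq_inner)
    also have "\<dots> = G t \<bullet> F t"
      by (simp add: G_def wt_def inner_mult_left)
    also have "\<dots> = (\<Sum>k\<in>A. G t \<bullet> (a k * x k t))" by (simp add: F_def inner_sum_right)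
    also have "\<dots> = (\<Sum>k\<in>A. (a k \<bullet> (G t * y k t)) / d k)"
    proof (rule sum.cong)
      fix k show "G t \<bullet> (a k * x k t) = (a k \<bullet> (G t * y k t)) / d k"
        unfolding adjoint using d_ge[of k] by simp
    qed simp
    finally show "(norm (wt (-s/2) F t))\<^sup>2 = (\<Sum>k\<in>A. (a k \<bullet> (G t * y k t)) / d k)" .
  qed
  also have "\<dots> = (\<Sum>k\<in>A. \<integral>t. (a k \<bullet> (G t * y k t)) / d k \<partial>leb)"
    by (rule Bochner_Integration.integral_sum) (simp add: Gy integrable_inner_right)
  also have "\<dots> = (\<Sum>k\<in>A. (a k \<bullet> fourier_coeff G k) / d k)"
    unfolding fourier_coeff_def by (rule sum.cong) (simp_all add: Gy integral_inner_right)
  also have "\<dots> \<le> (\<Sum>k\<in>A. norm (a k) * norm (fourier_coeff G k))"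
  proof (rule sum_mono)
    fix k
    have "(a k \<bullet> fourier_coeff G k) / d k \<le> (norm (a k) * norm (fourier_coeff G k)) / d k"
      using d_ge[of k] by (intro divide_right_mono norm_cauchy_schwarz) simp
    also have "\<dots> \<le> (norm (a k) * norm (fourier_coeff G k)) / 1"
      using d_ge[of k] by (intro divide_left_mono) auto
    finally show "(a k \<bullet> fourier_coeff G k) / d k \<le> norm (a k) * norm (fourier_coeff G k)" by simp
  qed
  also have "\<dots> \<le> (\<Sum>k\<in>A. norm (a k) powr p) powr (1 / p) * (C * V)"
  proof (rule holder_sum[OF p])
    obtain n where n: "A \<subseteq> {..<n}" using A by (meson finite_nat_iff_bounded)
    have "(\<Sum>k\<in>A. norm (fourier_coeff G k) powr r) \<le> (\<Sum>k<n. norm (fourier_coeff G k) powr r)"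
      by (rule sum_mono2) (use n in auto)
    also have "\<dots> \<le> (C * V) powr r" using le[OF G(1), of n] by (simp add: G(2))
    finally show "(\<Sum>k\<in>A. norm (fourier_coeff G k) powr r) \<le> (C * V) powr r" .
  qed (use C in \<open>simp_all add: V_def\<close>)
  finally have "V * V \<le> (C * (\<Sum>k\<in>A. norm (a k) powr p) powr (1 / p)) * V"
    by (simp only: power2_eq_square mult_ac)
  then have "V \<le> C * (\<Sum>k\<in>A. norm (a k) powr p) powr (1 / p)"
  proof (cases "V = 0")
    case False
    then have "0 < V" using vnorm_L2_nonneg[of _ F] unfolding V_def by (simp only: less_le) simp
    then show ?thesis using \<open>V * V \<le> _\<close> by simp
  qed (use C in simp)
  then show ?thesis unfolding V_def F_def[abs_def] .
qed

text \<open>The bound on finite sums, applied to tails, makes the partial sums Cauchy; completeness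
  supplies the vector, and the bound passes to the limit.\<close>

lemma hilbertianI:
  assumes s: "-1 < s" "s < 1" and q: "1 \<le> q" "q \<le> ereal p" and p: "1 \<le> p" and C: "0 \<le> C"
    and le: "\<And>A a. finite A \<Longrightarrow>
      vnorm (H s) (\<lambda>t. \<Sum>k\<in>A. a k * x k t) \<le> C * (\<Sum>k\<in>A. norm (a k) powr p) powr (1 / p)"
  shows "hilbertian q x (H s)"
  unfolding hilbertian_def
proof (intro conjI exI[of _ C] ballI)
  show "schauder_basis (H s) x" by (rule schauder_basis_H[OF s])
  fix a :: "nat \<Rightarrow> 'k" assume a: "a \<in> ell q"
  note sm = ell_sum_le[OF a q]
  define F where "F n t = (\<Sum>k<n. a k * x k t)" for n t
  have F: "F n \<in> vectors (H s)" for n unfolding F_def[abs_def] by (rule comb_H[OF s(1)])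
  have diff: "vnorm (H s) (\<lambda>t. F m t - F n t) \<le> C * (\<Sum>k\<in>{n..<m}. norm (a k) powr p) powr (1 / p)"
    if "n \<le> m" for m n
  proof -
    have "F m t - F n t = (\<Sum>k\<in>{n..<m}. a k * x k t)" for t
      unfolding F_def using that by (simp add: sum_diff_nat_ivl flip: atLeast0LessThan)
    then show ?thesis using le[of "{n..<m}" a] by simp
  qed
  interpret finite_measure "power_measure s" by (rule finite_power_measure[OF s(1)])
  have cauchy: "\<exists>N. \<forall>m\<ge>N. \<forall>n\<ge>N. vnorm (H s) (\<lambda>t. F m t - F n t) < e" if e: "0 < e" for e
  proof -
    \<comment> \<open>Dividing by C + 1 is legitimate also for C = 0 and makes the final inequality
      strict.\<close>
    define \<eta> where "\<eta> = (e / (C + 1)) powr p"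
    have \<eta>: "0 < \<eta>" using e C by (simp add: \<eta>_def)
    obtain N where N: "\<And>m n. N \<le> m \<Longrightarrow> norm (\<Sum>k\<in>{m..<n}. norm (a k) powr p) < \<eta>"
      using sm(1) \<eta> unfolding summable_Cauchy by blast
    have *: "vnorm (H s) (\<lambda>t. F m t - F n t) < e" if "N \<le> n" "n \<le> m" for m n
    proof -
      let ?S = "\<Sum>k\<in>{n..<m}. norm (a k) powr p"
      have "0 \<le> ?S" by (simp add: sum_nonneg)
      then have "?S \<le> \<eta>" using N[OF that(1), of m] by simp
      then have "?S powr (1 / p) \<le> \<eta> powr (1 / p)" using p \<open>0 \<le> ?S\<close> by (intro powr_mono2) auto
      also have "\<dots> = e / (C + 1)" using e C p by (simp add: \<eta>_def powr_powr)
      finally have "C * ?S powr (1 / p) \<le> C * (e / (C + 1))" using C by (rule mult_left_mono)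
      also have "\<dots> < e" using C e by (simp add: field_simps)
      finally show ?thesis using diff[OF that(2)] by linarith
    qed
    show ?thesis
    proof (intro exI[of _ N] allI impI)
      fix m n assume "N \<le> m" "N \<le> n"
      then show "vnorm (H s) (\<lambda>t. F m t - F n t) < e"
        using *[of n m] *[of m n] vnorm_L2_minus_commute[of _ "F m" "F n"] by (cases "n \<le> m") simp_all
    qed
  qed
  obtain f where f: "f \<in> vectors (H s)" "(\<lambda>n. vnorm (H s) (\<lambda>t. f t - F n t)) \<longlonglongrightarrow> 0"
    by (rule L2_complete[of F, OF F cauchy])
  have "vnorm (H s) f \<le> C * ell_norm q a"
  proof (rule LIMSEQ_le_const)
    show "(\<lambda>n. vnorm (H s) (\<lambda>t. f t - F n t) + C * ell_norm q a) \<longlonglongrightarrow> C * ell_norm q a"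
      using tendsto_add[OF f(2) tendsto_const[of "C * ell_norm q a"]] by simp
    have "vnorm (H s) f \<le> vnorm (H s) (\<lambda>t. f t - F n t) + C * ell_norm q a" for n
    proof -
      have "vnorm (H s) (F n) \<le> C * (\<Sum>k<n. norm (a k) powr p) powr (1 / p)"
        unfolding F_def[abs_def] by (rule le) simp
      also have "\<dots> \<le> C * (\<Sum>k. norm (a k) powr p) powr (1 / p)"
        by (intro mult_left_mono[OF _ C] powr_mono2 sum_le_suminf sm(1)) (use p in \<open>simp_all add: sum_nonneg\<close>)
      also have "\<dots> \<le> C * ell_norm q a" by (rule mult_left_mono[OF sm(2) C])
      finally show ?thesis using vnorm_L2_triangle_sub[OF f(1) F[of n]] by linarith
    qed
    then show "\<exists>N. \<forall>n\<ge>N. vnorm (H s) f \<le> vnorm (H s) (\<lambda>t. f t - F n t) + C * ell_norm q a" by blast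
  qed
  then show "\<exists>f\<in>vectors (H s). expands (H s) x a f \<and> vnorm (H s) f \<le> C * ell_norm q a"
    using f unfolding expands_def F_def by blast
qed

section \<open>Necessary conditions on the exponents\<close>

lemma besselianD:
  assumes s: "-1 < s" "s < 1" and "besselian r x (H s)"
  obtains C where "0 \<le> C" "\<And>f. f \<in> vectors (H s) \<Longrightarrow> fourier_coeff f \<in> ell r"
    "\<And>f. f \<in> vectors (H s) \<Longrightarrow> ell_norm r (fourier_coeff f) \<le> C * vnorm (H s) f"
proof -
  obtain C where C: "\<And>f. f \<in> vectors (H s) \<Longrightarrow> coords (H s) x f \<in> ell r"
    "\<And>f. f \<in> vectors (H s) \<Longrightarrow> ell_norm r (coords (H s) x f) \<le> C * vnorm (H s) f"
    using assms(3) unfolding besselian_def by blast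
  \<comment> \<open>The definition puts no sign on the constant, so its absolute value is
    taken.\<close>
  have "ell_norm r (fourier_coeff f) \<le> \<bar>C\<bar> * vnorm (H s) f" if f: "f \<in> vectors (H s)" for f
    using C(2)[OF f] mult_right_mono[OF abs_ge_self[of C] vnorm_L2_nonneg[of _ f]]
    unfolding coords_H[OF f s] by (rule order_trans)
  then show ?thesis using that[of "\<bar>C\<bar>"] C(1) by (simp add: coords_H[OF _ s])
qed

text \<open>The definition only asserts that some vector f has the given expansion. For finitely
  many nonzero coefficients the partial sums are eventually constant, so f and the finite sum differ
  by norm 0.\<close>

lemma hilbertianD:
  assumes s: "-1 < s" "s < 1" and q: "1 \<le> q" and h: "hilbertian q x (H s)"
  obtains C where "\<forall>A a. finite A \<and> 1 \<le> card A \<and> (\<forall>k\<in>A. norm (a k) \<le> 1) \<longrightarrow>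
      vnorm (H s) (\<lambda>t. \<Sum>k\<in>A. a k * x k t) \<le> C * real (card A) powr rec_exp q"
proof -
  obtain C where C: "\<And>a. a \<in> ell q \<Longrightarrow> \<exists>f\<in>vectors (H s). expands (H s) x a f \<and> vnorm (H s) f \<le> C * ell_norm q a"
    using h unfolding hilbertian_def by blast
  show ?thesis
  proof (rule that[of "\<bar>C\<bar>"], intro allI impI)
    fix A :: "nat set" and a :: "nat \<Rightarrow> 'k"
    assume Aa: "finite A \<and> 1 \<le> card A \<and> (\<forall>k\<in>A. norm (a k) \<le> 1)"
    define n where "n = card A"
    have A: "finite A" "card A = n" "1 \<le> n" and a: "\<And>k. k \<in> A \<Longrightarrow> norm (a k) \<le> 1"
      using Aa by (simp_all add: n_def)
    define b where "b k = (if k \<in> A then a k else 0)" for k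
    have b: "b \<in> ell q" "ell_norm q b \<le> real n powr rec_exp q"
      by (rule ell_norm_le[OF q A]; simp add: b_def a)+
    obtain f where f: "f \<in> vectors (H s)" "expands (H s) x b f" "vnorm (H s) f \<le> C * ell_norm q b"
      using C[OF b(1)] by blast
    define S where "S t = (\<Sum>k\<in>A. a k * x k t)" for t
    have S: "S \<in> vectors (H s)" unfolding S_def[abs_def] by (rule comb_H[OF s(1)])
    obtain m where m: "A \<subseteq> {..<m}" using A(1) by (meson finite_nat_iff_bounded)
    have eq: "(\<Sum>k<j. b k * x k t) = S t" if "m \<le> j" for j t
      unfolding S_def by (rule sum.mono_neutral_cong_right) (use m that in \<open>auto simp: b_def\<close>)
    have "(\<lambda>j. vnorm (H s) (\<lambda>t. f t - (\<Sum>k<j. b k * x k t))) \<longlonglongrightarrow> vnorm (H s) (\<lambda>t. f t - S t)"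
      by (rule tendsto_eventually, rule eventually_mono[OF eventually_ge_at_top[of m]]) (simp add: eq)
    then have "vnorm (H s) (\<lambda>t. f t - S t) = 0"
      using f(2) LIMSEQ_unique unfolding expands_def by blast
    then have "vnorm (H s) S \<le> vnorm (H s) f"
      using vnorm_L2_triangle_sub[OF S f(1)] vnorm_L2_minus_commute[of _ f S] by simp
    also have "\<dots> \<le> \<bar>C\<bar> * ell_norm q b"
      by (rule order_trans[OF f(3) mult_right_mono[OF abs_ge_self ell_norm_nonneg[OF b(1)]]])
    also have "\<dots> \<le> \<bar>C\<bar> * real n powr rec_exp q"
      by (rule mult_left_mono[OF b(2)]) simp
    finally show "vnorm (H s) (\<lambda>t. \<Sum>k\<in>A. a k * x k t) \<le> \<bar>C\<bar> * real (card A) powr rec_exp q"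
      unfolding S_def[abs_def] n_def .
  qed
qed

text \<open>The signs leave n coefficients of modulus 1, whose norm in \<open>ell r\<close> is at
  least \<open>real n powr rec_exp r\<close>.\<close>

lemma besselian_imp_le_half:
  assumes s: "-1 < s" "s < 1" and r: "1 \<le> r" and "besselian r x (H s)"
  shows "rec_exp r \<le> 1/2"
proof -
  obtain C where C: "0 \<le> C" "\<And>f. f \<in> vectors (H s) \<Longrightarrow> fourier_coeff f \<in> ell r"
    "\<And>f. f \<in> vectors (H s) \<Longrightarrow> ell_norm r (fourier_coeff f) \<le> C * vnorm (H s) f"
    using besselianD[OF s assms(4)] by blast
  show ?thesis
  proof (rule powr_le_imp_exponent_le[of _ "C * weight_norm s"])
    fix n :: nat assume n: "1 \<le> n"
    obtain e where e: "\<forall>k. norm (e k) = 1"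
      "(vnorm (H s) (\<lambda>t. \<Sum>k<n. e k * x k t))\<^sup>2 \<le> (\<Sum>k<n. (vnorm (H s) (x k))\<^sup>2)"
      using L2_signs(1)[of x "power_measure s" n] x_H[OF s(1)] by blast
    define S where "S t = (\<Sum>k<n. e k * x k t)" for t
    have S: "S \<in> vectors (H s)" unfolding S_def[abs_def] by (rule comb_H[OF s(1)])
    have "1 * real n powr rec_exp r \<le> ell_norm r (fourier_coeff S)"
      by (rule ell_norm_ge[OF C(2)[OF S] r, of "{..<n}"])
         (use n e(1) in \<open>simp_all add: S_def[abs_def] fourier_coeff_comb\<close>)
    also have "\<dots> \<le> C * vnorm (H s) S" by (rule C(3)[OF S])
    also have "\<dots> \<le> C * (weight_norm s * real n powr (1/2))"
    proof (rule mult_left_mono[OF _ C(1)])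
      have "(vnorm (H s) S)\<^sup>2 \<le> (\<Sum>k<n. (weight_norm s)\<^sup>2)"
        unfolding S_def[abs_def]
        by (rule order_trans[OF e(2)], rule sum_mono, rule power_mono[OF vnorm_x_le[OF s(1)]]) simp
      also have "\<dots> = (weight_norm s * real n powr (1/2))\<^sup>2"
        by (simp add: power_mult_distrib powr_half_sqrt)
      finally show "vnorm (H s) S \<le> weight_norm s * real n powr (1/2)"
        by (rule power2_le_imp_le) (simp add: weight_norm_nonneg)
    qed
    finally show "real n powr rec_exp r \<le> C * weight_norm s * real n powr (1/2)"
      by (simp add: mult.assoc)
  qed
qed

text \<open>The opposite choice of signs requires the \<open>x k\<close> to be bounded below in
  norm. This follows from biorthogonality: the pairing of \<open>x k\<close> with \<open>y k\<close>
  is 1, and the \<open>y k\<close> are bounded in the dual space.\<close>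

lemma hilbertian_imp_ge_half:
  assumes s: "-1 < s" "s < 1" and q: "1 \<le> q" and "hilbertian q x (H s)"
  shows "1/2 \<le> rec_exp q"
proof -
  obtain C where "\<forall>A a. finite A \<and> 1 \<le> card A \<and> (\<forall>k\<in>A. norm (a k) \<le> 1) \<longrightarrow>
      vnorm (H s) (\<lambda>t. \<Sum>k\<in>A. a k * x k t) \<le> C * real (card A) powr rec_exp q"
    by (rule hilbertianD[OF s q assms(4)])
  then have C: "finite A \<Longrightarrow> card A = n \<Longrightarrow> 1 \<le> n \<Longrightarrow> (\<And>k. k \<in> A \<Longrightarrow> norm (a k) \<le> 1) \<Longrightarrow>
      vnorm (H s) (\<lambda>t. \<Sum>k\<in>A. a k * x k t) \<le> C * real n powr rec_exp q" for A a n
    by blast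
  define W where "W = weight_norm (-s)"
  have one: "1 \<le> vnorm (H s) (x k) * W" for k
  proof -
    have "norm (\<integral>t. x k t * y k t \<partial>leb) \<le> vnorm (H s) (x k) * vnorm (H (-s)) (y k)"
      by (rule H_mult(2)[OF x_H y_H]) (use s in simp_all)
    also have "\<dots> \<le> vnorm (H s) (x k) * W"
      unfolding W_def by (rule mult_left_mono[OF vnorm_y_le]) (use s in simp_all)
    finally show ?thesis by (simp add: biorthogonal)
  qed
  have W: "0 \<le> W" by (simp add: W_def weight_norm_nonneg)
  show ?thesis
  proof (rule powr_le_imp_exponent_le[of _ "W * C"])
    fix n :: nat assume n: "1 \<le> n"
    obtain e where e: "\<forall>k. norm (e k) = 1"
      "(\<Sum>k<n. (vnorm (H s) (x k))\<^sup>2) \<le> (vnorm (H s) (\<lambda>t. \<Sum>k<n. e k * x k t))\<^sup>2"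
      using L2_signs(2)[of x "power_measure s" n] x_H[OF s(1)] by blast
    define V where "V = vnorm (H s) (\<lambda>t. \<Sum>k<n. e k * x k t)"
    have "(real n powr (1/2))\<^sup>2 = (\<Sum>k<n. 1\<^sup>2)"
      by (simp add: powr_half_sqrt)
    also have "\<dots> \<le> (\<Sum>k<n. (vnorm (H s) (x k) * W)\<^sup>2)"
      by (rule sum_mono, rule power_mono[OF one]) simp
    also have "\<dots> = (\<Sum>k<n. (vnorm (H s) (x k))\<^sup>2) * W\<^sup>2"
      by (simp add: power_mult_distrib sum_distrib_right)
    also have "\<dots> \<le> V\<^sup>2 * W\<^sup>2" unfolding V_def by (rule mult_right_mono[OF e(2)]) simp
    also have "\<dots> = (W * V)\<^sup>2" by (simp add: power_mult_distrib mult.commute)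
    finally have "real n powr (1/2) \<le> W * V"
      by (rule power2_le_imp_le) (simp add: V_def W)
    also have "\<dots> \<le> W * (C * real n powr rec_exp q)"
      unfolding V_def by (rule mult_left_mono[OF C W]) (use n e(1) in simp_all)
    finally show "real n powr (1/2) \<le> W * C * real n powr rec_exp q" by (simp only: mult.assoc)
  qed
qed

text \<open>In \<open>H \<alpha>\<close> the indicator of [-\<delta>, \<delta>] has norm of order at
  most \<delta> powr ((1 + \<alpha>)/2). With \<delta> proportional to 1/n and n coefficients of
  size at least \<delta>, comparing powers of n gives 1/r <= 1 - (1 + \<alpha>)/2.\<close>

lemma besselian_imp_le:
  assumes \<alpha>: "0 \<le> \<alpha>" "\<alpha> < 1" and r: "1 \<le> r" and "besselian r x (H \<alpha>)"
  shows "rec_exp r \<le> (1 - \<alpha>) / 2"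
proof -
  have s: "-1 < \<alpha>" "\<alpha> < 1" using \<alpha> by simp_all
  obtain C where C: "0 \<le> C" "\<And>f. f \<in> vectors (H \<alpha>) \<Longrightarrow> fourier_coeff f \<in> ell r"
    "\<And>f. f \<in> vectors (H \<alpha>) \<Longrightarrow> ell_norm r (fourier_coeff f) \<le> C * vnorm (H \<alpha>) f"
    using besselianD[OF s assms(4)] by blast
  \<comment> \<open>For k < 2n and |t| <= \<kappa>/n the bound \<open>y_near_0\<close> becomes 4 *
    pi * 2n * \<kappa>/n = 1/2.\<close>
  define \<kappa> where "\<kappa> = 1 / (16 * pi)"
  have \<kappa>: "0 < \<kappa>" by (simp add: \<kappa>_def)
  have "rec_exp r \<le> - ((1 + \<alpha>) / 2) + 1"
  proof (rule powr_le_imp_exponent_le)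
    fix n :: nat assume n: "1 \<le> n"
    define \<delta> where "\<delta> = \<kappa> / real n"
    have n0: "0 < real n" using n by simp
    have \<delta>0: "0 < \<delta>" using \<kappa> n0 by (simp add: \<delta>_def)
    have "\<delta> \<le> \<kappa>" using n \<kappa> by (simp add: \<delta>_def pos_divide_le_eq)
    moreover have "\<kappa> \<le> 1/2" using pi_gt3 by (simp add: \<kappa>_def pos_divide_le_eq)
    ultimately have \<delta>1: "\<delta> \<le> 1/2" by simp
    define I :: "real \<Rightarrow> 'k" where "I t = of_real (indicator {-\<delta>..\<delta>} t)" for t
    have Ib [measurable]: "I \<in> borel_measurable borel" unfolding I_def[abs_def] by measurable
    have IH: "I \<in> vectors (H \<alpha>)"
      by (rule H_bounded(1)[OF s(1) Ib, of 1]) (simp add: I_def indicator_def)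
    have In: "vnorm (H \<alpha>) I \<le> sqrt 2 * \<delta> powr ((1 + \<alpha>) / 2)"
    proof (rule H_boundI(2)[OF H_measurable[OF IH]])
      have "(\<integral>\<^sup>+t. ennreal (\<bar>t\<bar> powr \<alpha> * (norm (I t))\<^sup>2) \<partial>leb) \<le> (\<integral>\<^sup>+t. ennreal (\<delta> powr \<alpha>) * indicator {-\<delta>..\<delta>} t \<partial>leb)"
      proof (rule nn_integral_mono)
        fix t
        have "\<bar>t\<bar> powr \<alpha> \<le> \<delta> powr \<alpha>" if "t \<in> {-\<delta>..\<delta>}"
          using that \<alpha> by (intro powr_mono2) auto
        then show "ennreal (\<bar>t\<bar> powr \<alpha> * (norm (I t))\<^sup>2) \<le> ennreal (\<delta> powr \<alpha>) * indicator {-\<delta>..\<delta>} t"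
          by (auto simp: I_def indicator_def intro: ennreal_leI)
      qed
      also have "\<dots> = ennreal (\<delta> powr \<alpha>) * emeasure leb {-\<delta>..\<delta>}"
        by (rule nn_integral_cmult_indicator) (use \<delta>1 in \<open>auto simp: leb_def sets_restrict_space intro!: image_eqI[of _ _ "{-\<delta>..\<delta>}"]\<close>)
      also have "\<dots> = ennreal (\<delta> powr \<alpha> * (2 * \<delta>))"
        using \<delta>0 \<delta>1 by (simp add: measure_leb_interval ennreal_mult)
      also have "\<delta> powr \<alpha> * (2 * \<delta>) = (sqrt 2 * \<delta> powr ((1 + \<alpha>) / 2))\<^sup>2"
      proof -
        have "(\<delta> powr ((1 + \<alpha>) / 2))\<^sup>2 = \<delta> powr (1 + \<alpha>)"
          by (simp add: power2_eq_square flip: powr_add)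
        also have "\<dots> = \<delta> * \<delta> powr \<alpha>" using \<delta>0 by (simp add: powr_add)
        finally show ?thesis by (simp add: power_mult_distrib)
      qed
      finally show "(\<integral>\<^sup>+t. ennreal (\<bar>t\<bar> powr \<alpha> * (norm (I t))\<^sup>2) \<partial>leb) \<le> ennreal ((sqrt 2 * \<delta> powr ((1 + \<alpha>) / 2))\<^sup>2)" .
    qed simp
    let ?A = "{k. odd k \<and> k < 2 * n}"
    \<comment> \<open>Freezing \<open>y k\<close> at 0 gives a main term of modulus at least
      2\<delta>, the length of the interval; the oscillation of at most 1/2 costs no more than
      \<delta>.\<close>
    have coeff: "\<delta> \<le> norm (fourier_coeff I k)" if k: "k \<in> ?A" for k
    proof -
      have int: "integrable leb (\<lambda>t. I t * y k t)" by (rule integrable_mult_y[OF IH s(2)])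
      have intI: "integrable leb I" by (rule H_integrable[OF IH s(2)])
      have nIe: "norm (I t) = indicator {-\<delta>..\<delta>} t" for t by (simp add: I_def indicator_def)
      have indint: "integrable leb (indicat_real {-\<delta>..\<delta>})"
        using integrable_norm[OF intI] unfolding nIe .
      have Iint: "(\<integral>t. I t \<partial>leb) = of_real (2 * \<delta>)"
      proof -
        have "{-\<delta>..\<delta>} \<inter> space leb = {-\<delta>..\<delta>}" using \<delta>1 by auto
        moreover have "(\<integral>t. I t \<partial>leb) = of_real (\<integral>t. indicator {-\<delta>..\<delta>} t \<partial>leb)"
          unfolding I_def by (rule integral_of_real) (rule indint)
        ultimately show ?thesis using \<delta>0 \<delta>1 by (simp add: measure_leb_interval)
      qed
      have nI: "(\<integral>t. norm (I t) \<partial>leb) = 2 * \<delta>"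
      proof -
        have "{-\<delta>..\<delta>} \<inter> space leb = {-\<delta>..\<delta>}" using \<delta>1 by auto
        then show ?thesis using \<delta>0 \<delta>1 by (simp add: nIe measure_leb_interval)
      qed
      have "fourier_coeff I k = (\<integral>t. I t * (y k t - y k 0) \<partial>leb) + (\<integral>t. I t \<partial>leb) * y k 0"
        using int intI by (simp add: fourier_coeff_def right_diff_distrib)
      moreover have "norm (\<integral>t. I t * (y k t - y k 0) \<partial>leb) \<le> \<delta>"
      proof -
        have "norm (\<integral>t. I t * (y k t - y k 0) \<partial>leb) \<le> (\<integral>t. norm (I t * (y k t - y k 0)) \<partial>leb)"
          by (rule integral_norm_bound)
        also have "\<dots> \<le> (\<integral>t. norm (I t) * (1/2) \<partial>leb)"
        proof (rule integral_mono)
          show "integrable leb (\<lambda>t. norm (I t * (y k t - y k 0)))"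
            using int intI by (intro integrable_norm) (simp add: right_diff_distrib)
          show "integrable leb (\<lambda>t. norm (I t) * (1/2))" using intI by simp
          fix t
          show "norm (I t * (y k t - y k 0)) \<le> norm (I t) * (1/2)"
          proof (cases "t \<in> {-\<delta>..\<delta>}")
            case True
            have "norm (y k t - y k 0) \<le> 4 * pi * real k * \<bar>t\<bar>" using k by (intro y_near_0) simp
            also have "\<dots> \<le> 4 * pi * (2 * real n) * \<delta>"
              using k True by (intro mult_mono) auto
            also have "\<dots> = 1/2" using n0 by (simp add: \<delta>_def \<kappa>_def)
            finally show ?thesis unfolding norm_mult by (rule mult_left_mono) simp
          qed (simp add: I_def)
        qed
        also have "\<dots> = \<delta>" using nI by simp
        finally show ?thesis .
      qed
      moreover have "2 * \<delta> \<le> norm ((\<integral>t. I t \<partial>leb) * y k 0)"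
        using y_at_0[of k] k \<delta>0 unfolding Iint norm_mult by simp
      ultimately show ?thesis
        using norm_diff_ineq[of "(\<integral>t. I t \<partial>leb) * y k 0" "\<integral>t. I t * (y k t - y k 0) \<partial>leb"]
        by (simp add: add.commute)
    qed
    have "\<delta> * real n powr rec_exp r \<le> ell_norm r (fourier_coeff I)"
      by (rule ell_norm_ge[OF C(2)[OF IH] r, of ?A])
         (use n \<delta>0 coeff in \<open>simp_all add: card_odd_less\<close>)
    also have "\<dots> \<le> C * vnorm (H \<alpha>) I" by (rule C(3)[OF IH])
    also have "\<dots> \<le> C * (sqrt 2 * \<delta> powr ((1 + \<alpha>) / 2))" by (rule mult_left_mono[OF In C(1)])
    also have "\<delta> powr ((1 + \<alpha>) / 2) = \<kappa> powr ((1 + \<alpha>) / 2) * real n powr (- ((1 + \<alpha>) / 2))"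
      unfolding \<delta>_def using \<kappa> n0 by (simp add: divide_powr)
    finally have "(\<delta> * real n powr rec_exp r) * (real n / \<kappa>)
        \<le> (C * (sqrt 2 * (\<kappa> powr ((1 + \<alpha>) / 2) * real n powr (- ((1 + \<alpha>) / 2))))) * (real n / \<kappa>)"
      by (rule mult_right_mono) (use \<kappa> in simp)
    also have "\<dots> = C * sqrt 2 * \<kappa> powr ((1 + \<alpha>) / 2) / \<kappa> * (real n powr (- ((1 + \<alpha>) / 2)) * real n)"
      by (simp only: times_divide_eq_right times_divide_eq_left mult_ac)
    also have "real n powr (- ((1 + \<alpha>) / 2)) * real n = real n powr (- ((1 + \<alpha>) / 2) + 1)"
      using n0 powr_add[of "real n" "- ((1 + \<alpha>) / 2)" 1] by simp
    also have "(\<delta> * real n powr rec_exp r) * (real n / \<kappa>) = real n powr rec_exp r"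
      using \<kappa> n0 by (simp add: \<delta>_def)
    finally show "real n powr rec_exp r
        \<le> C * sqrt 2 * \<kappa> powr ((1 + \<alpha>) / 2) / \<kappa> * real n powr (- ((1 + \<alpha>) / 2) + 1)" .
  qed
  then show ?thesis by (simp add: field_simps)
qed

text \<open>On (0, \<delta>], with \<delta> proportional to 1/n, the sum of the first n odd-indexed
  functions is at least n/2 and the weight at least \<delta> powr (-\<alpha>). The norm is thus at
  least of order n * \<delta> powr ((1 - \<alpha>)/2), a multiple of n powr ((1 +
  \<alpha>)/2).\<close>

lemma hilbertian_imp_ge:
  assumes \<alpha>: "0 \<le> \<alpha>" "\<alpha> < 1" and q: "1 \<le> q" and "hilbertian q x (H (-\<alpha>))"
  shows "(1 + \<alpha>) / 2 \<le> rec_exp q"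
proof -
  have s: "-1 < -\<alpha>" "-\<alpha> < 1" using \<alpha> by simp_all
  obtain C where "\<forall>A a. finite A \<and> 1 \<le> card A \<and> (\<forall>k\<in>A. norm (a k) \<le> 1) \<longrightarrow>
      vnorm (H (-\<alpha>)) (\<lambda>t. \<Sum>k\<in>A. a k * x k t) \<le> C * real (card A) powr rec_exp q"
    by (rule hilbertianD[OF s q assms(4)])
  then have C: "finite A \<Longrightarrow> card A = n \<Longrightarrow> 1 \<le> n \<Longrightarrow> (\<And>k. k \<in> A \<Longrightarrow> norm (a k) \<le> 1) \<Longrightarrow>
      vnorm (H (-\<alpha>)) (\<lambda>t. \<Sum>k\<in>A. a k * x k t) \<le> C * real n powr rec_exp q" for A a n
    by blast
  \<comment> \<open>For k < 2n and |t| <= \<kappa>/n the bound \<open>x_near_0\<close> becomes 2 *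
    pi * 2n * \<kappa>/n = 1/2.\<close>
  define \<kappa> where "\<kappa> = 1 / (8 * pi)"
  have \<kappa>: "0 < \<kappa>" by (simp add: \<kappa>_def)
  let ?e = "(1 - \<alpha>) / 2"
  show ?thesis
  proof (rule powr_le_imp_exponent_le[of _ "2 / \<kappa> powr ?e * C"])
    fix n :: nat assume n: "1 \<le> n"
    define \<delta> where "\<delta> = \<kappa> / real n"
    have n0: "0 < real n" using n by simp
    have \<delta>0: "0 < \<delta>" using \<kappa> n0 by (simp add: \<delta>_def)
    have "\<delta> \<le> \<kappa>" using n \<kappa> by (simp add: \<delta>_def pos_divide_le_eq)
    moreover have "\<kappa> \<le> 1/2" using pi_gt3 by (simp add: \<kappa>_def pos_divide_le_eq)
    ultimately have \<delta>1: "\<delta> \<le> 1/2" by simp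
    let ?A = "{k. odd k \<and> k < 2 * n}"
    define S where "S t = (\<Sum>k\<in>?A. 1 * x k t)" for t
    have S: "S \<in> vectors (H (-\<alpha>))" unfolding S_def[abs_def] by (rule comb_H[OF s(1)])
    \<comment> \<open>The half-open interval avoids t = 0, where
      \<open>\<bar>t\<bar> powr (-\<alpha>)\<close> is 0 by convention.\<close>
    have lower: "real n / 2 \<le> norm (S t)" if t: "t \<in> {0<..\<delta>}" for t
    proof -
      have "norm (S t - of_nat n) = norm (\<Sum>k\<in>?A. (x k t - 1))"
        by (simp add: S_def sum_subtractf card_odd_less)
      also have "\<dots> \<le> (\<Sum>k\<in>?A. 1/2)"
      proof (rule sum_norm_le)
        fix k assume k: "k \<in> ?A"
        have "norm (x k t - 1) \<le> 2 * pi * real k * \<bar>t\<bar>" using k by (intro x_near_0) simp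
        also have "\<dots> \<le> 2 * pi * (2 * real n) * \<delta>"
          using k t by (intro mult_mono) auto
        also have "\<dots> = 1/2" using n0 by (simp add: \<delta>_def \<kappa>_def)
        finally show "norm (x k t - 1) \<le> 1/2" .
      qed
      also have "\<dots> = real n / 2" by (simp add: card_odd_less)
      finally have "norm (S t - of_nat n) \<le> real n / 2" .
      moreover have "norm (of_nat n :: 'k) \<le> norm (S t) + norm (S t - of_nat n)"
        using norm_triangle_ineq4[of "S t" "S t - of_nat n"] by simp
      ultimately show ?thesis by simp
    qed
    have "ennreal ((\<delta> powr ?e * (real n / 2))\<^sup>2) = (\<integral>\<^sup>+t. ennreal (\<delta> powr (-\<alpha>) * (real n / 2)\<^sup>2) * indicator {0<..\<delta>} t \<partial>leb)"
    proof -
      have "(\<integral>\<^sup>+t. ennreal (\<delta> powr (-\<alpha>) * (real n / 2)\<^sup>2) * indicator {0<..\<delta>} t \<partial>leb)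
          = ennreal (\<delta> powr (-\<alpha>) * (real n / 2)\<^sup>2) * emeasure leb {0<..\<delta>}"
        by (rule nn_integral_cmult_indicator) (use \<delta>1 in \<open>auto simp: leb_def sets_restrict_space intro!: image_eqI[of _ _ "{0<..\<delta>}"]\<close>)
      also have "\<dots> = ennreal (\<delta> powr (-\<alpha>) * (real n / 2)\<^sup>2 * \<delta>)"
        using \<delta>0 \<delta>1 by (subst measure_leb_interval(3)) (simp_all add: ennreal_mult)
      also have "\<delta> powr (-\<alpha>) * (real n / 2)\<^sup>2 * \<delta> = (\<delta> powr ?e * (real n / 2))\<^sup>2"
      proof -
        have "(\<delta> powr ?e)\<^sup>2 = \<delta> powr (1 + - \<alpha>)"
          by (simp add: power2_eq_square flip: powr_add)
        also have "\<dots> = \<delta> * \<delta> powr (-\<alpha>)" using \<delta>0 by (subst powr_add) simp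
        finally have sq: "(\<delta> powr ?e)\<^sup>2 = \<delta> * \<delta> powr (-\<alpha>)" .
        show ?thesis unfolding power_mult_distrib sq by (simp only: mult_ac)
      qed
      finally show ?thesis by simp
    qed
    also have "\<dots> \<le> (\<integral>\<^sup>+t. ennreal (\<bar>t\<bar> powr (-\<alpha>) * (norm (S t))\<^sup>2) \<partial>leb)"
    proof (rule nn_integral_mono)
      fix t
      have "\<delta> powr (-\<alpha>) * (real n / 2)\<^sup>2 \<le> \<bar>t\<bar> powr (-\<alpha>) * (norm (S t))\<^sup>2" if "t \<in> {0<..\<delta>}"
        using that \<alpha> lower[OF that] by (intro mult_mono power_mono powr_mono2') auto
      then show "ennreal (\<delta> powr (-\<alpha>) * (real n / 2)\<^sup>2) * indicator {0<..\<delta>} t \<le> ennreal (\<bar>t\<bar> powr (-\<alpha>) * (norm (S t))\<^sup>2)"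
        by (auto simp: indicator_def intro: ennreal_leI)
    qed
    also have "\<dots> = ennreal ((vnorm (H (-\<alpha>)) S)\<^sup>2)" by (rule nn_integral_H_eq[OF S])
    finally have "(\<delta> powr ?e * (real n / 2))\<^sup>2 \<le> (vnorm (H (-\<alpha>)) S)\<^sup>2"
      unfolding ennreal_le_iff[OF zero_le_power2] .
    then have "\<delta> powr ?e * (real n / 2) \<le> vnorm (H (-\<alpha>)) S"
      by (rule power2_le_imp_le) simp
    also have "\<dots> \<le> C * real n powr rec_exp q"
      unfolding S_def[abs_def] by (rule C) (use n in \<open>simp_all add: card_odd_less\<close>)
    finally have le: "\<delta> powr ?e * (real n / 2) \<le> C * real n powr rec_exp q" .
    have "\<delta> powr ?e = \<kappa> powr ?e * real n powr (- ?e)"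
      unfolding \<delta>_def using \<kappa> n0 by (rule divide_powr)
    moreover have "real n powr (- ?e) * real n = real n powr ((1 + \<alpha>) / 2)"
    proof -
      have "- ?e + 1 = (1 + \<alpha>) / 2" by (simp add: field_simps)
      then show ?thesis using n0 powr_add[of "real n" "- ?e" 1] by (simp only: powr_one)
    qed
    ultimately have "\<delta> powr ?e * (real n / 2) = (\<kappa> powr ?e / 2) * real n powr ((1 + \<alpha>) / 2)"
      by (simp add: mult_ac)
    with le have "(\<kappa> powr ?e / 2) * real n powr ((1 + \<alpha>) / 2) \<le> C * real n powr rec_exp q" by (simp only:)
    then have "(2 / \<kappa> powr ?e) * ((\<kappa> powr ?e / 2) * real n powr ((1 + \<alpha>) / 2)) \<le> (2 / \<kappa> powr ?e) * (C * real n powr rec_exp q)"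
      by (rule mult_left_mono) simp
    then show "real n powr ((1 + \<alpha>) / 2) \<le> 2 / \<kappa> powr ?e * C * real n powr rec_exp q"
      using \<kappa> by (simp add: mult.assoc)
  qed
qed

section \<open>The exponent sets of an abstract trigonometric system\<close>

lemma J_B_H_nonpos:
  assumes \<alpha>: "0 \<le> \<alpha>" "\<alpha> < 1"
  shows "J_B x (H (- \<alpha>)) = {2..\<infinity>}"
proof (intro equalityI subsetI)
  fix r assume "r \<in> J_B x (H (- \<alpha>))"
  then have r: "1 \<le> r" "besselian r x (H (-\<alpha>))" by (auto simp: J_B_def)
  have "rec_exp r \<le> 1/2" by (rule besselian_imp_le_half[OF _ _ r]) (use \<alpha> in simp_all)
  then show "r \<in> {2..\<infinity>}" using rec_exp_le_iff(1)[OF r(1), of 2] by simp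
next
  fix r :: ereal assume "r \<in> {2..\<infinity>}"
  then have r: "ereal 2 \<le> r" by simp
  have "besselian r x (H (-\<alpha>))"
    by (rule besselianI[OF _ _ _ r, of _ "sqrt 2"]) (use \<alpha> bessel_H[of _ "-\<alpha>"] in simp_all)
  moreover have "1 \<le> r" by (rule order_trans[OF _ r]) simp
  ultimately show "r \<in> J_B x (H (- \<alpha>))" by (simp add: J_B_def)
qed

lemma J_B_H_nonneg:
  assumes \<alpha>: "0 \<le> \<alpha>" "\<alpha> < 1" and r: "r = 2 / (1 - \<alpha>)"
  shows "J_B x (H \<alpha>) = {ereal r..\<infinity>}"
proof -
  have r0: "1 \<le> r" using \<alpha> by (simp add: r pos_le_divide_eq)
  have rr: "(1 - \<alpha>) / 2 = 1 / r" by (simp add: r)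
  show ?thesis
  proof (intro equalityI subsetI)
    fix u assume "u \<in> J_B x (H \<alpha>)"
    then have u: "1 \<le> u" "besselian u x (H \<alpha>)" by (auto simp: J_B_def)
    have "rec_exp u \<le> 1 / r" unfolding rr[symmetric] by (rule besselian_imp_le[OF \<alpha> u])
    then show "u \<in> {ereal r..\<infinity>}" using rec_exp_le_iff(1)[OF u(1), of r] r0 by simp
  next
    fix u :: ereal assume "u \<in> {ereal r..\<infinity>}"
    then have u: "ereal r \<le> u" by simp
    obtain C where C: "0 \<le> C"
      "\<And>f n. f \<in> vectors (H \<alpha>) \<Longrightarrow> (\<Sum>k<n. norm (fourier_coeff f k) powr r) \<le> (C * vnorm (H \<alpha>) f) powr r"
      using pitt[OF \<alpha> r] by blast
    have "besselian u x (H \<alpha>)" by (rule besselianI[OF _ \<alpha>(2) r0 u C]) (use \<alpha> in simp_all)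
    moreover have "1 \<le> u" by (rule order_trans[OF _ u]) (use r0 in simp)
    ultimately show "u \<in> J_B x (H \<alpha>)" by (simp add: J_B_def)
  qed
qed

text \<open>The exponents q and r are conjugate, so \<open>dual_bound\<close> transports Pitt's
  inequality from \<open>H \<alpha>\<close> to \<open>H (-\<alpha>)\<close>.\<close>

lemma J_H_H_nonpos:
  assumes \<alpha>: "0 \<le> \<alpha>" "\<alpha> < 1" and q: "q = 2 / (1 + \<alpha>)"
  shows "J_H x (H (- \<alpha>)) = {1..ereal q}"
proof -
  define r where "r = 2 / (1 - \<alpha>)"
  have r0: "1 < r" and q0: "1 < q" using \<alpha> by (simp_all add: r_def q pos_less_divide_eq)
  have qq: "(1 + \<alpha>) / 2 = 1 / q" by (simp add: q)
  have conj: "1 / q + 1 / r = 1" by (simp add: q r_def field_simps)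
  show ?thesis
  proof (intro equalityI subsetI)
    fix u assume "u \<in> J_H x (H (- \<alpha>))"
    then have u: "1 \<le> u" "hilbertian u x (H (-\<alpha>))" by (auto simp: J_H_def)
    have "1 / q \<le> rec_exp u" unfolding qq[symmetric] by (rule hilbertian_imp_ge[OF \<alpha> u])
    then show "u \<in> {1..ereal q}" using rec_exp_le_iff(2)[OF u(1), of q] q0 u(1) by simp
  next
    fix u :: ereal assume "u \<in> {1..ereal q}"
    then have u: "1 \<le> u" "u \<le> ereal q" by simp_all
    obtain C where C: "0 \<le> C"
      "\<And>f n. f \<in> vectors (H \<alpha>) \<Longrightarrow> (\<Sum>k<n. norm (fourier_coeff f k) powr r) \<le> (C * vnorm (H \<alpha>) f) powr r"
      using pitt[OF \<alpha> r_def] by blast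
    have "hilbertian u x (H (-\<alpha>))"
    proof (rule hilbertianI[OF _ _ u _ C(1)])
      show "vnorm (H (-\<alpha>)) (\<lambda>t. \<Sum>k\<in>A. a k * x k t) \<le> C * (\<Sum>k\<in>A. norm (a k) powr q) powr (1 / q)"
        if "finite A" for A a
        by (rule dual_bound[OF _ \<alpha>(2) q0 r0 conj C that]) (use \<alpha> in simp_all)
    qed (use \<alpha> q0 in simp_all)
    then show "u \<in> J_H x (H (- \<alpha>))" using u(1) by (simp add: J_H_def)
  qed
qed

text \<open>Here \<open>dual_bound\<close> is used at s = -\<alpha> with the self-conjugate exponent
  2, starting from Bessel's inequality in \<open>H (-\<alpha>)\<close>.\<close>

lemma J_H_H_nonneg:
  assumes \<alpha>: "0 \<le> \<alpha>" "\<alpha> < 1"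
  shows "J_H x (H \<alpha>) = {1..2}"
proof (intro equalityI subsetI)
  fix u assume "u \<in> J_H x (H \<alpha>)"
  then have u: "1 \<le> u" "hilbertian u x (H \<alpha>)" by (auto simp: J_H_def)
  have "1 / 2 \<le> rec_exp u" by (rule hilbertian_imp_ge_half[OF _ _ u]) (use \<alpha> in simp_all)
  then show "u \<in> {1..2}" using rec_exp_le_iff(2)[OF u(1), of 2] u(1) by simp
next
  fix u :: ereal assume "u \<in> {1..2}"
  then have u: "1 \<le> u" "u \<le> ereal 2" by simp_all
  have "hilbertian u x (H \<alpha>)"
  proof (rule hilbertianI[OF _ _ u])
    show "vnorm (H \<alpha>) (\<lambda>t. \<Sum>k\<in>A. a k * x k t) \<le> sqrt 2 * (\<Sum>k\<in>A. norm (a k) powr 2) powr (1 / 2)"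
      if "finite A" for A a
      using dual_bound[of "-\<alpha>" 2 2 "sqrt 2" A a] bessel_H[of _ "-\<alpha>"] \<alpha> that by simp
  qed (use \<alpha> in simp_all)
  then show "u \<in> J_H x (H \<alpha>)" using u(1) by (simp add: J_H_def)
qed

end

section \<open>The complex trigonometric system\<close>

text \<open>Jordan's inequality: on [0, pi/2] the sine is concave and lies above its chord.\<close>

lemma two_mult_le_sin_pi:
  assumes "0 \<le> u" "u \<le> 1/2"
  shows "2 * u \<le> sin (pi * u)"
proof -
  have conc: "concave_on {0..pi/2} sin"
  proof (rule f''_le0_imp_concave)
    show "convex {0..pi/2}" by simp
    show "(sin has_real_derivative cos x) (at x)" for x :: real by (rule DERIV_sin)
    show "(cos has_real_derivative - sin x) (at x)" for x :: real by (rule DERIV_cos)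
    show "- sin x \<le> 0" if "x \<in> {0..pi/2}" for x :: real
      using that by (auto intro: sin_ge_zero)
  qed
  have "(1 - 2 * u) * sin 0 + (2 * u) * sin (pi/2) \<le> sin ((1 - 2 * u) *\<^sub>R 0 + (2 * u) *\<^sub>R (pi/2))"
    using assms by (intro concave_onD[OF conc]) auto
  then show ?thesis by (simp add: mult.commute)
qed

text \<open>With w = |s - t|, the number D is at most w and, because |s| and |t| are at most 1/2,
  also at most 1 - w. Jordan's inequality is applied to whichever of w and 1 - w lies in
  [0, 1/2].\<close>

lemma abs_diff_le_sin_pi:
  assumes "\<bar>s\<bar> \<le> 1/2" "\<bar>t\<bar> \<le> 1/2"
  shows "2 * \<bar>\<bar>s\<bar> - \<bar>t\<bar>\<bar> \<le> \<bar>sin (pi * (s - t))\<bar>"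
proof -
  define w D where "w = \<bar>s - t\<bar>" and "D = \<bar>\<bar>s\<bar> - \<bar>t\<bar>\<bar>"
  have w: "0 \<le> w" "w \<le> 1" "D \<le> w" "D \<le> 1 - w"
    using assms by (auto simp: w_def D_def)
  have "pi * w = pi * (s - t) \<or> pi * w = - (pi * (s - t))"
    by (auto simp: w_def abs_if algebra_simps)
  then have eq: "\<bar>sin (pi * (s - t))\<bar> = \<bar>sin (pi * w)\<bar>"
    by (elim disjE) (simp_all only: sin_minus abs_minus_cancel)
  have "2 * D \<le> sin (pi * w)"
  proof (cases "w \<le> 1/2")
    case True
    then show ?thesis using two_mult_le_sin_pi[of w] w by linarith
  next
    case False
    have "2 * D \<le> 2 * (1 - w)" using w by simp
    also have "\<dots> \<le> sin (pi * (1 - w))" using w False by (intro two_mult_le_sin_pi) auto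
    also have "\<dots> = sin (pi * w)" by (simp add: right_diff_distrib sin_diff)
    finally show ?thesis .
  qed
  then show ?thesis unfolding eq D_def[symmetric] by (rule order_trans[OF _ abs_ge_self])
qed

lemma tau_eq_cis: "tau n t = cis (2 * pi * of_int n * t)"
  unfolding tau_def cis_conv_exp by (simp add: mult_ac)

lemma norm_tau: "norm (tau n t) = 1"
  unfolding tau_eq_cis by (rule norm_cis)

lemma tau_0: "tau n 0 = 1"
  by (simp add: tau_def)

lemma tau_add: "tau (m + n) t = tau m t * tau n t"
  by (simp add: tau_eq_cis cis_mult algebra_simps)

lemma tau_diff_arg: "tau n (s - t) = tau n s * tau (- n) t"
  by (simp add: tau_eq_cis cis_mult algebra_simps)

text \<open>A geometric sum: |z^n - 1| <= 2, while |z - 1| = 2 |sin (pi (s - t))| is at least 4 ||s|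
  - |t||. Multiplying by z - 1 instead of dividing includes the case z = 1.\<close>

lemma sum_tau_bound:
  assumes st: "\<bar>s\<bar> \<le> 1/2" "\<bar>t\<bar> \<le> 1/2"
  shows "norm (\<Sum>j<n. tau (m + int j) (s - t)) * \<bar>\<bar>s\<bar> - \<bar>t\<bar>\<bar> \<le> 1/2"
proof -
  define z where "z = tau 1 (s - t)"
  have tau_int: "tau (int j) (s - t) = z ^ j" for j
    unfolding z_def tau_eq_cis Complex.DeMoivre by (simp add: mult_ac)
  have "norm (z - 1) = 2 * \<bar>sin (pi * (s - t))\<bar>"
  proof -
    have "z - 1 = 2 * \<i> * sin (pi * (s - t)) * cis (pi * (s - t))"
    proof -
      have "cos (2 * (pi * (s - t))) = 1 - 2 * (sin (pi * (s - t)))\<^sup>2" by (rule cos_double_sin)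
      moreover have "sin (2 * (pi * (s - t))) = 2 * sin (pi * (s - t)) * cos (pi * (s - t))" by (rule sin_double)
      ultimately show ?thesis
        by (simp add: z_def tau_eq_cis complex_eq_iff power2_eq_square mult.assoc)
    qed
    then show ?thesis by (simp add: norm_mult)
  qed
  then have z1: "4 * \<bar>\<bar>s\<bar> - \<bar>t\<bar>\<bar> \<le> norm (z - 1)"
    using abs_diff_le_sin_pi[OF st] by simp
  have "(\<Sum>j<n. tau (m + int j) (s - t)) = tau m (s - t) * (\<Sum>j<n. z ^ j)"
    by (simp add: tau_add tau_int sum_distrib_left)
  then have "norm (\<Sum>j<n. tau (m + int j) (s - t)) * norm (z - 1) = norm ((\<Sum>j<n. z ^ j) * (z - 1))"
    by (simp add: norm_mult tau_eq_cis)
  also have "(\<Sum>j<n. z ^ j) * (z - 1) = z ^ n - 1"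
    by (simp add: power_diff_1_eq mult.commute)
  also have "norm (z ^ n - 1) \<le> 2"
    using norm_triangle_ineq4[of "z ^ n" 1] by (simp add: norm_power z_def tau_eq_cis)
  finally have le: "norm (\<Sum>j<n. tau (m + int j) (s - t)) * norm (z - 1) \<le> 2" .
  have "norm (\<Sum>j<n. tau (m + int j) (s - t)) * (4 * \<bar>\<bar>s\<bar> - \<bar>t\<bar>\<bar>) \<le> norm (\<Sum>j<n. tau (m + int j) (s - t)) * norm (z - 1)"
    by (rule mult_left_mono[OF z1]) simp
  with le show ?thesis by simp
qed

text \<open>The enumeration 0, 1, -1, 2, -2, ... of the integers.\<close>

definition trig_freq :: "nat \<Rightarrow> int"
  where "trig_freq k = (if even k then - int (k div 2) else int (k div 2) + 1)"

lemma trig_freq_inj: "trig_freq j = trig_freq k \<longleftrightarrow> j = k"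
  by (cases "even j"; cases "even k"; auto simp: trig_freq_def; presburger)

text \<open>The first \<open>n\<close> frequencies of the complex system fill an interval of integers.\<close>

lemma sum_trig_freq:
  fixes g :: "int \<Rightarrow> 'a::comm_monoid_add"
  obtains m where "(\<Sum>k<n. g (trig_freq k)) = (\<Sum>j<n. g (m + int j))"
proof -
  have inj: "inj_on trig_freq {..<n}" by (simp add: inj_on_def trig_freq_inj)
  \<comment> \<open>The frequencies fill the interval from -m to m if n = 2m + 1, and from 1 - m to
    m if n = 2m. One inclusion and equality of cardinalities suffice.\<close>
  define a where "a = (if even n then 1 else 0) - int (n div 2)"
  have inj': "inj_on (\<lambda>j. a + int j) {..<n}" by (simp add: inj_on_def)
  have sub: "trig_freq ` {..<n} \<subseteq> (\<lambda>j. a + int j) ` {..<n}"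
  proof
    fix i assume "i \<in> trig_freq ` {..<n}"
    then obtain k where k: "k < n" "i = trig_freq k" by auto
    have "a \<le> i \<and> i < a + int n"
      using k by (cases "even k"; cases "even n") (auto simp: trig_freq_def a_def elim!: evenE oddE)
    then have "i = a + int (nat (i - a))" "nat (i - a) < n" by auto
    then show "i \<in> (\<lambda>j. a + int j) ` {..<n}" by blast
  qed
  have "trig_freq ` {..<n} = (\<lambda>j. a + int j) ` {..<n}"
    by (rule card_subset_eq[OF _ sub]) (simp_all add: card_image[OF inj] card_image[OF inj'])
  then have "(\<Sum>k<n. g (trig_freq k)) = (\<Sum>j<n. g (a + int j))"
    using sum.reindex[OF inj, of g] sum.reindex[OF inj', of g] by (simp add: o_def)
  then show ?thesis by (rule that)
qed

lemma trig_eq_tau: "trig k = tau (trig_freq k)"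
  by (simp add: trig_def trig_freq_def)

section \<open>Orthogonality relations and linear spans\<close>

lemma integral_leb_FTC:
  fixes f :: "real \<Rightarrow> 'k::euclidean_space"
  assumes "\<And>t. (F has_vector_derivative f t) (at t)" "continuous_on UNIV f"
  shows "(\<integral>t. f t \<partial>leb) = F (1/2) - F (-1/2)"
proof -
  have "(\<integral>t. f t \<partial>leb) = (\<integral>t. indicator {-1/2..1/2} t *\<^sub>R f t \<partial>lborel)"
    unfolding leb_def by (rule integral_restrict_space) simp
  also have "\<dots> = F (1/2) - F (-1/2)"
    by (rule integral_FTC_Icc)
       (use assms in \<open>auto intro: has_vector_derivative_at_within continuous_on_subset\<close>)
  finally show ?thesis .
qed

lemma integral_cos_leb: "(\<integral>t. cos (2 * pi * of_int j * t) \<partial>leb) = (if j = 0 then 1 else 0)"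
proof (cases "j = 0")
  case True
  then show ?thesis by (simp add: measure_leb_space del: space_leb)
next
  case False
  have "(\<integral>t. cos (2 * pi * of_int j * t) \<partial>leb)
      = sin (2 * pi * of_int j * (1/2)) / (2 * pi * of_int j) - sin (2 * pi * of_int j * (-1/2)) / (2 * pi * of_int j)"
    by (rule integral_leb_FTC)
       (use False in \<open>auto intro!: derivative_eq_intros continuous_intros
          simp: has_real_derivative_iff_has_vector_derivative[symmetric]\<close>)
  also have "\<dots> = 0"
  proof -
    have "sin (of_int j * pi) = 0" using sin_zero_iff_int2 by blast
    then show ?thesis by (simp add: mult_ac)
  qed
  finally show ?thesis using False by simp
qed

lemma integral_sin_leb: "(\<integral>t. sin (2 * pi * of_int j * t) \<partial>leb) = 0"
proof (cases "j = 0")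
  case True
  then show ?thesis by simp
next
  case False
  have "(\<integral>t. sin (2 * pi * of_int j * t) \<partial>leb)
      = - cos (2 * pi * of_int j * (1/2)) / (2 * pi * of_int j) - - cos (2 * pi * of_int j * (-1/2)) / (2 * pi * of_int j)"
    by (rule integral_leb_FTC)
       (use False in \<open>auto intro!: derivative_eq_intros continuous_intros
          simp: has_real_derivative_iff_has_vector_derivative[symmetric]\<close>)
  also have "\<dots> = 0" by simp
  finally show ?thesis .
qed

lemma integrable_leb_continuous:
  fixes f :: "real \<Rightarrow> 'k::euclidean_space"
  assumes "continuous_on UNIV f"
  shows "integrable leb f"
  unfolding leb_def
  by (subst integrable_restrict_space)
     (use borel_integrable_compact[of "{-1/2..1/2}" f] continuous_on_subset[OF assms] in \<open>auto simp: set_integrable_def\<close>)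

lemma integral_tau_leb: "(\<integral>t. tau j t \<partial>leb) = (if j = 0 then 1 else 0)"
proof -
  have eq: "tau j t = of_real (cos (2 * pi * of_int j * t)) + \<i> * of_real (sin (2 * pi * of_int j * t))" for t
    by (simp add: tau_eq_cis complex_eq_iff)
  have "integrable leb (\<lambda>t. cos (2 * pi * of_int j * t))" "integrable leb (\<lambda>t. sin (2 * pi * of_int j * t))"
    by (intro integrable_leb_continuous continuous_intros)+
  then have "(\<integral>t. tau j t \<partial>leb) = of_real (\<integral>t. cos (2 * pi * of_int j * t) \<partial>leb) + \<i> * of_real (\<integral>t. sin (2 * pi * of_int j * t) \<partial>leb)"
    unfolding eq by simp
  then show ?thesis by (simp add: integral_cos_leb integral_sin_leb)
qed

text \<open>The chord has length 2 |sin (u/2)|.\<close>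

lemma norm_cis_minus_one_le: "norm (cis u - 1) \<le> \<bar>u\<bar>"
proof -
  have "cis u - 1 = 2 * \<i> * sin (u / 2) * cis (u / 2)"
    using cos_double_sin[of "u/2"] sin_double[of "u/2"] by (simp add: complex_eq_iff power2_eq_square)
  then have "norm (cis u - 1) = 2 * \<bar>sin (u / 2)\<bar>" by (simp add: norm_mult)
  then show ?thesis using abs_sin_x_le_abs_x[of "u/2"] by simp
qed

lemma lincomb_span_add:
  fixes x :: "nat \<Rightarrow> 's \<Rightarrow> 'k::real_normed_field"
  assumes "\<exists>N a. \<forall>t. p t = (\<Sum>k<N. a k * x k t)" "\<exists>N a. \<forall>t. q t = (\<Sum>k<N. a k * x k t)"
  shows "\<exists>N a. \<forall>t. p t + q t = (\<Sum>k<N. a k * x k t)"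
proof -
  obtain N a M b where p: "\<And>t. p t = (\<Sum>k<N. a k * x k t)" and q: "\<And>t. q t = (\<Sum>k<M. b k * x k t)"
    using assms by blast
  define a' b' where "a' k = (if k < N then a k else 0)" and "b' k = (if k < M then b k else 0)" for k
  have "(\<Sum>k<N. a k * x k t) = (\<Sum>k<max N M. a' k * x k t)" for t
    by (rule sum.mono_neutral_cong_left) (auto simp: a'_def)
  moreover have "(\<Sum>k<M. b k * x k t) = (\<Sum>k<max N M. b' k * x k t)" for t
    by (rule sum.mono_neutral_cong_left) (auto simp: b'_def)
  ultimately have "p t + q t = (\<Sum>k<max N M. (a' k + b' k) * x k t)" for t
    by (simp add: p q distrib_right sum.distrib)
  then show ?thesis by (intro exI[of _ "max N M"] exI[of _ "\<lambda>k. a' k + b' k"] allI)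
qed

lemma lincomb_span_single:
  fixes x :: "nat \<Rightarrow> 's \<Rightarrow> 'k::real_normed_field"
  shows "\<exists>N a. \<forall>t. c * x m t = (\<Sum>k<N. a k * x k t)"
proof (intro exI[of _ "Suc m"] exI[of _ "\<lambda>k. if k = m then c else 0"] allI)
  fix t
  have "(\<Sum>k<Suc m. (if k = m then c else 0) * x k t) = (\<Sum>k<Suc m. if k = m then c * x k t else 0)"
    by (rule sum.cong) auto
  then show "c * x m t = (\<Sum>k<Suc m. (if k = m then c else 0) * x k t)" by simp
qed

lemma continuous_tau: "continuous_on UNIV (tau n)"
  unfolding tau_def by (intro continuous_intros)

text \<open>Moving a factor across the real inner product conjugates it; this is how the conjugate
  system enters the axiom \<open>adjoint\<close>.\<close>

lemma complex_inner_mult_cnj: "(c::complex) \<bullet> (u * v) = u \<bullet> (c * cnj v)"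
  by (simp add: inner_complex_def algebra_simps)

lemma trig_freq_odd: "odd k \<Longrightarrow> \<bar>real_of_int (trig_freq k)\<bar> \<le> real k"
  by (auto simp: trig_freq_def elim!: oddE)

lemma trig_freq_surj: "\<exists>k. trig_freq k = j"
proof (cases "j \<le> 0")
  case True
  then have "trig_freq (2 * nat (- j)) = j" by (simp add: trig_freq_def)
  then show ?thesis by blast
next
  case False
  then have "trig_freq (2 * nat (j - 1) + 1) = j" by (simp add: trig_freq_def)
  then show ?thesis by blast
qed

text \<open>The dual functions are the conjugates themselves, so \<open>d\<close> is 1, and K = 1/2
  is the geometric sum bound.\<close>

lemma trig_system_trig: "trig_system trig (\<lambda>k. tau (- trig_freq k)) (\<lambda>_. 1) (1/2)"
proof -
  have meas: "trig k \<in> borel_measurable borel" "tau (- trig_freq k) \<in> borel_measurable borel" for k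
    unfolding trig_eq_tau by (rule borel_measurable_continuous_onI[OF continuous_tau])+
  have bound: "norm (trig k t) \<le> 1" "norm (tau (- trig_freq k) t) \<le> 2" for k t
    unfolding trig_eq_tau norm_tau by simp_all
  have adj: "c \<bullet> (u * tau (- trig_freq k) t) = 1 * (u \<bullet> (c * trig k t))" for c u k t
  proof -
    have cnj: "cnj (tau (- trig_freq k) t) = trig k t"
      unfolding trig_eq_tau tau_eq_cis cis_cnj by simp
    show ?thesis
      using complex_inner_mult_cnj[of c u "tau (- trig_freq k) t"] unfolding cnj by (simp only: mult_1)
  qed
  have biorth: "(\<integral>t. trig j t * tau (- trig_freq k) t \<partial>leb) = (if j = k then 1 else 0)" for j k
  proof -
    have "trig j t * tau (- trig_freq k) t = tau (trig_freq j - trig_freq k) t" for t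
      using tau_add[of "trig_freq j" "- trig_freq k" t] by (simp add: trig_eq_tau)
    then show ?thesis by (simp add: integral_tau_leb trig_freq_inj)
  qed
  have kernel: "norm (\<Sum>k<n. trig k s * tau (- trig_freq k) t) * \<bar>\<bar>s\<bar> - \<bar>t\<bar>\<bar> \<le> 1/2"
    if st: "\<bar>s\<bar> \<le> 1/2" "\<bar>t\<bar> \<le> 1/2" for s t n
  proof -
    have "(\<Sum>k<n. trig k s * tau (- trig_freq k) t) = (\<Sum>k<n. tau (trig_freq k) (s - t))"
      by (simp add: trig_eq_tau tau_diff_arg)
    moreover obtain m where "(\<Sum>k<n. tau (trig_freq k) (s - t)) = (\<Sum>j<n. tau (m + int j) (s - t))"
      by (rule sum_trig_freq)
    ultimately show ?thesis
      using sum_tau_bound[OF st, of m n] by (simp only:)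
  qed
  have span: "\<exists>N a. \<forall>t. p t = (\<Sum>k<N. a k * trig k t)" if "trig_poly p" for p
    using that
  proof induction
    case (trig_poly_cos j c)
    obtain m n where mn: "trig_freq m = j" "trig_freq n = - j" using trig_freq_surj by metis
    have eq: "of_real (cos (2 * pi * of_int j * t)) * c = c / 2 * trig m t + c / 2 * trig n t" for t
    proof -
      have "tau j t + tau (- j) t = 2 * of_real (cos (2 * pi * of_int j * t))"
        by (simp add: tau_eq_cis complex_eq_iff)
      then have "c / 2 * (tau j t + tau (- j) t) = of_real (cos (2 * pi * of_int j * t)) * c" by simp
      then show ?thesis by (simp add: trig_eq_tau mn distrib_left)
    qed
    show ?case unfolding eq by (rule lincomb_span_add[OF lincomb_span_single lincomb_span_single])
  next
    case (trig_poly_sin j c)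
    obtain m n where mn: "trig_freq m = j" "trig_freq n = - j" using trig_freq_surj by metis
    have eq: "of_real (sin (2 * pi * of_int j * t)) * c = - \<i> * c / 2 * trig m t + \<i> * c / 2 * trig n t" for t
    proof -
      have "tau j t - tau (- j) t = 2 * \<i> * of_real (sin (2 * pi * of_int j * t))"
        by (simp add: tau_eq_cis complex_eq_iff)
      then have "- \<i> * c / 2 * (tau j t - tau (- j) t) = of_real (sin (2 * pi * of_int j * t)) * c"
        by (simp add: complex_eq_iff)
      then show ?thesis by (simp add: trig_eq_tau mn right_diff_distrib)
    qed
    show ?case unfolding eq by (rule lincomb_span_add[OF lincomb_span_single lincomb_span_single])
  next
    case (trig_poly_add p q)
    then show ?case by (intro lincomb_span_add)
  qed
  have le: "\<bar>2 * pi * of_int j * t\<bar> \<le> 2 * pi * real k * \<bar>t\<bar>" if "\<bar>real_of_int j\<bar> \<le> real k" for j k t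
  proof -
    have "\<bar>2 * pi * of_int j * t\<bar> = 2 * pi * \<bar>of_int j\<bar> * \<bar>t\<bar>" by (simp add: abs_mult)
    also have "\<dots> \<le> 2 * pi * real k * \<bar>t\<bar>"
      using that by (intro mult_right_mono mult_left_mono) simp_all
    finally show ?thesis .
  qed
  have near: "norm (trig k t - 1) \<le> 2 * pi * real k * \<bar>t\<bar>" if k: "odd k" for k t
    unfolding trig_eq_tau tau_eq_cis by (rule order_trans[OF norm_cis_minus_one_le le[OF trig_freq_odd[OF k]]])
  have near': "norm (tau (- trig_freq k) t - tau (- trig_freq k) 0) \<le> 4 * pi * real k * \<bar>t\<bar>" if k: "odd k" for k t
  proof -
    have "norm (tau (- trig_freq k) t - tau (- trig_freq k) 0) \<le> 2 * pi * real k * \<bar>t\<bar>"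
      unfolding tau_0 unfolding tau_eq_cis
      by (rule order_trans[OF norm_cis_minus_one_le le]) (use trig_freq_odd[OF k] in simp)
    also have "\<dots> \<le> 4 * pi * real k * \<bar>t\<bar>" by (intro mult_right_mono) auto
    finally show ?thesis .
  qed
  have at0: "1 \<le> norm (tau (- trig_freq k) 0)" for k by (simp add: norm_tau)
  show ?thesis
    by (rule trig_system.intro[OF meas bound _ _ adj biorth kernel span near near' at0]) simp_all
qed

section \<open>The real trigonometric system\<close>

text \<open>Leaving the scalar type open lets one proof serve the real system in the real and in the
  complex space.\<close>

definition real_trig_of :: "nat \<Rightarrow> real \<Rightarrow> 'k::{real_normed_field,euclidean_space}"
  where "real_trig_of n t = of_real (real_trig n t)"

text \<open>The reciprocal of the integral of the squared function: 1 for the constant, 2 for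
  cosines and sines.\<close>

definition trig_weight :: "nat \<Rightarrow> real"
  where "trig_weight k = (if k = 0 then 1 else 2)"

lemma real_trig_odd: "real_trig (2 * k + 1) t = cos (2 * pi * real (k + 1) * t)"
  and real_trig_even: "real_trig (2 * k + 2) t = sin (2 * pi * real (k + 1) * t)"
  by (simp_all add: real_trig_def)

lemma nat_parity_cases:
  obtains "n = 0" | k where "n = 2 * k + 1" | k where "n = 2 * k + (2::nat)"
proof (cases "even n")
  case True
  then obtain m where "n = 2 * m" by (rule evenE)
  then show ?thesis using that(1) that(3)[of "m - 1"] by (cases m) auto
next
  case False
  then show ?thesis using that(2) by (auto elim: oddE)
qed

lemma abs_real_trig_le_1: "\<bar>real_trig n t\<bar> \<le> 1"
  by (simp add: real_trig_def)

lemma continuous_real_trig: "continuous_on UNIV (real_trig n)"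
  unfolding real_trig_def[abs_def]
  by (cases "n = 0"; cases "odd n"; simp; intro continuous_intros)

lemma integral_real_trig_mult:
  "(\<integral>t. real_trig j t * real_trig k t \<partial>leb) = (if j = k then 1 / trig_weight k else 0)"
proof -
  have ic: "integrable leb (\<lambda>t. cos (2 * pi * of_int m * t))" "integrable leb (\<lambda>t. sin (2 * pi * of_int m * t))" for m
    by (intro integrable_leb_continuous continuous_intros)+
  have cc: "(\<integral>t. cos (2 * pi * of_int a * t) * cos (2 * pi * of_int b * t) \<partial>leb)
      = ((if a = b then 1 else 0) + (if a + b = 0 then 1 else 0)) / 2" for a b :: int
  proof -
    have "cos (2 * pi * of_int a * t) * cos (2 * pi * of_int b * t)
        = (cos (2 * pi * of_int (a - b) * t) + cos (2 * pi * of_int (a + b) * t)) / 2" for t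
      unfolding cos_times_cos freq_add freq_diff by simp
    then show ?thesis using ic(1) by (simp only: integral_cos_leb integral_divide_zero Bochner_Integration.integral_add) simp
  qed
  have ss: "(\<integral>t. sin (2 * pi * of_int a * t) * sin (2 * pi * of_int b * t) \<partial>leb)
      = ((if a = b then 1 else 0) - (if a + b = 0 then 1 else 0)) / 2" for a b :: int
  proof -
    have "sin (2 * pi * of_int a * t) * sin (2 * pi * of_int b * t)
        = (cos (2 * pi * of_int (a - b) * t) - cos (2 * pi * of_int (a + b) * t)) / 2" for t
      unfolding sin_times_sin freq_add freq_diff by simp
    then show ?thesis using ic(1) by (simp only: integral_cos_leb integral_divide_zero Bochner_Integration.integral_diff) simp
  qed
  have sc: "(\<integral>t. sin (2 * pi * of_int a * t) * cos (2 * pi * of_int b * t) \<partial>leb) = 0" for a b :: int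
  proof -
    have "sin (2 * pi * of_int a * t) * cos (2 * pi * of_int b * t)
        = (sin (2 * pi * of_int (a + b) * t) + sin (2 * pi * of_int (a - b) * t)) / 2" for t
      unfolding sin_times_cos freq_add freq_diff by simp
    then show ?thesis using ic(2) by (simp only: integral_sin_leb integral_divide_zero Bochner_Integration.integral_add) simp
  qed
  define C S where "C m t = cos (2 * pi * of_int m * t)" and "S m t = sin (2 * pi * of_int m * t)" for m :: int and t
  \<comment> \<open>The frequencies that occur are nonnegative, so \<open>a + b = 0\<close> happens
    only for a = b = 0, where it completes the integral of the constant 1.\<close>
  have CS: "(\<integral>t. C a t * C b t \<partial>leb) = ((if a = b then 1 else 0) + (if a + b = 0 then 1 else 0)) / 2"
    "(\<integral>t. S a t * S b t \<partial>leb) = ((if a = b then 1 else 0) - (if a + b = 0 then 1 else 0)) / 2"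
    "(\<integral>t. S a t * C b t \<partial>leb) = 0" "(\<integral>t. C b t * S a t \<partial>leb) = 0" for a b
    unfolding C_def S_def by (rule cc, rule ss, rule sc) (subst mult.commute, rule sc)
  have r: "real_trig 0 = C 0" "real_trig (2 * m + 1) = C (int m + 1)" "real_trig (2 * m + 2) = S (int m + 1)" for m
    by (simp_all add: fun_eq_iff real_trig_def C_def S_def add.commute)
  show ?thesis
    by (rule nat_parity_cases[of j]; rule nat_parity_cases[of k]; simp only: r CS trig_weight_def; simp; presburger?)
qed

text \<open>By the addition formula, a cosine and a sine of equal frequency together contribute 2
  cos of the difference of the arguments, the real part of two exponentials of opposite frequencies.
  Odd lengths consist of the constant and complete pairs.\<close>

lemma real_trig_kernel_odd:
  "(\<Sum>k<2 * N + 1. trig_weight k * (real_trig k s * real_trig k t)) = Re (\<Sum>k<2 * N + 1. tau (trig_freq k) (s - t))"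
proof (induction N)
  case 0
  then show ?case by (simp add: real_trig_def trig_weight_def trig_freq_def tau_eq_cis)
next
  case (Suc N)
  let ?a = "2 * pi * real (N + 1) * s" and ?b = "2 * pi * real (N + 1) * t"
  have N: "2 * Suc N + 1 = Suc (Suc (2 * N + 1))" by simp
  have w: "trig_weight (2 * N + 1) = 2" "trig_weight (Suc (2 * N + 1)) = 2" by (simp_all add: trig_weight_def)
  have rt: "real_trig (Suc (2 * N + 1)) u = sin (2 * pi * real (N + 1) * u)" for u
    using real_trig_even[of N u] by simp
  have "trig_freq (2 * N + 1) = int N + 1" "trig_freq (Suc (2 * N + 1)) = - (int N + 1)"
    by (simp_all add: trig_freq_def)
  then have tf: "Re (tau (trig_freq (2 * N + 1)) (s - t)) = cos (?a - ?b)"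
    "Re (tau (trig_freq (Suc (2 * N + 1))) (s - t)) = cos (?a - ?b)"
  proof -
    assume f: "trig_freq (2 * N + 1) = int N + 1" "trig_freq (Suc (2 * N + 1)) = - (int N + 1)"
    have 1: "2 * pi * of_int (int N + 1) * (s - t) = ?a - ?b" "2 * pi * of_int (- (int N + 1)) * (s - t) = - (?a - ?b)"
      by (simp_all add: algebra_simps)
    show "Re (tau (trig_freq (2 * N + 1)) (s - t)) = cos (?a - ?b)"
      unfolding f tau_eq_cis 1 by simp
    show "Re (tau (trig_freq (Suc (2 * N + 1))) (s - t)) = cos (?a - ?b)"
      unfolding f tau_eq_cis 1 cos_minus[of "?a - ?b", symmetric] by simp
  qed
  show ?case
    unfolding N sum.lessThan_Suc Suc.IH plus_complex.sel tf w real_trig_odd rt cos_diff by simp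
qed

text \<open>For positive even n one cosine remains unpaired. Its term is at most 2 and the factor
  ||s| - |t|| at most 1/2, so the total is at most 1/2 + 1.\<close>

lemma real_trig_kernel_bound:
  assumes st: "\<bar>s\<bar> \<le> 1/2" "\<bar>t\<bar> \<le> 1/2"
  shows "\<bar>\<Sum>k<n. trig_weight k * (real_trig k s * real_trig k t)\<bar> * \<bar>\<bar>s\<bar> - \<bar>t\<bar>\<bar> \<le> 2"
proof -
  let ?T = "\<lambda>k. trig_weight k * (real_trig k s * real_trig k t)"
  let ?D = "\<bar>\<bar>s\<bar> - \<bar>t\<bar>\<bar>"
  have D: "?D \<le> 1/2" using st by linarith
  have T2: "\<bar>?T k\<bar> \<le> 2" for k
  proof -
    have "\<bar>real_trig k s * real_trig k t\<bar> \<le> 1"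
      unfolding abs_mult by (intro mult_le_one abs_real_trig_le_1) simp_all
    then have "\<bar>trig_weight k\<bar> * \<bar>real_trig k s * real_trig k t\<bar> \<le> 2 * 1"
      by (intro mult_mono) (simp_all add: trig_weight_def)
    then show ?thesis by (simp add: abs_mult)
  qed
  have odd: "\<bar>\<Sum>k<2 * N + 1. ?T k\<bar> * ?D \<le> 1/2" for N
  proof -
    obtain m where m: "(\<Sum>k<2 * N + 1. tau (trig_freq k) (s - t)) = (\<Sum>j<2 * N + 1. tau (m + int j) (s - t))"
      by (rule sum_trig_freq)
    have "\<bar>\<Sum>k<2 * N + 1. ?T k\<bar> \<le> norm (\<Sum>j<2 * N + 1. tau (m + int j) (s - t))"
      unfolding real_trig_kernel_odd m by (rule abs_Re_le_cmod)
    then have "\<bar>\<Sum>k<2 * N + 1. ?T k\<bar> * ?D \<le> norm (\<Sum>j<2 * N + 1. tau (m + int j) (s - t)) * ?D"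
      by (rule mult_right_mono) simp
    also have "\<dots> \<le> 1/2" by (rule sum_tau_bound[OF st])
    finally show ?thesis .
  qed
  show ?thesis
  proof (rule nat_parity_cases[of n])
    assume "n = 0"
    then show ?thesis by simp
  next
    fix k assume "n = 2 * k + 1"
    then show ?thesis using odd[of k] by simp
  next
    fix k assume n: "n = 2 * k + 2"
    have "n = Suc (2 * k + 1)" by (simp add: n)
    then have "(\<Sum>k<n. ?T k) = (\<Sum>k<2 * k + 1. ?T k) + ?T (2 * k + 1)" by (simp only: sum.lessThan_Suc)
    then have "\<bar>\<Sum>k<n. ?T k\<bar> * ?D \<le> (\<bar>\<Sum>k<2 * k + 1. ?T k\<bar> + \<bar>?T (2 * k + 1)\<bar>) * ?D"
      by (simp only:) (rule mult_right_mono[OF abs_triangle_ineq], simp)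
    also have "\<dots> = \<bar>\<Sum>k<2 * k + 1. ?T k\<bar> * ?D + \<bar>?T (2 * k + 1)\<bar> * ?D" by (rule distrib_right)
    also have "\<dots> \<le> 1/2 + 2 * (1/2)"
      by (intro add_mono odd mult_mono T2 D) simp_all
    finally show ?thesis by simp
  qed
qed

text \<open>Negative frequencies are folded onto positive ones; the sign of a sine passes into its
  coefficient.\<close>

lemma trig_poly_in_span_real_trig:
  fixes p :: "real \<Rightarrow> 'k::{real_normed_field,euclidean_space}"
  assumes "trig_poly p"
  shows "\<exists>N a. \<forall>t. p t = (\<Sum>k<N. a k * real_trig_of k t)"
  using assms
proof induction
  case (trig_poly_cos j c)
  have "\<exists>m. \<forall>t. cos (2 * pi * of_int j * t) = real_trig m t"
  proof (cases "j = 0")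
    case True
    then show ?thesis by (intro exI[of _ 0]) (simp add: real_trig_def)
  next
    case False
    define k where "k = nat (\<bar>j\<bar> - 1)"
    have k: "real (k + 1) = \<bar>of_int j\<bar>" using False by (simp add: k_def)
    have "cos (2 * pi * of_int j * t) = cos (2 * pi * \<bar>of_int j\<bar> * t)" for t
    proof (cases "0 \<le> j")
      case False
      then have "2 * pi * \<bar>of_int j\<bar> * t = - (2 * pi * of_int j * t)" by simp
      then show ?thesis by (simp only: cos_minus)
    qed simp
    then have "cos (2 * pi * of_int j * t) = real_trig (2 * k + 1) t" for t
      unfolding real_trig_odd k .
    then show ?thesis by blast
  qed
  then obtain m where m: "\<And>t. cos (2 * pi * of_int j * t) = real_trig m t" by blast
  have "of_real (cos (2 * pi * of_int j * t)) * c = c * real_trig_of m t" for t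
    unfolding m real_trig_of_def by (rule mult.commute)
  then show ?case by (simp only: lincomb_span_single)
next
  case (trig_poly_sin j c)
  have "\<exists>m e. \<forall>t. sin (2 * pi * of_int j * t) = e * real_trig m t"
  proof (cases "j = 0")
    case True
    then show ?thesis by (intro exI[of _ 0]) simp
  next
    case False
    define k where "k = nat (\<bar>j\<bar> - 1)"
    have k: "real (k + 1) = \<bar>of_int j\<bar>" using False by (simp add: k_def)
    have "sin (2 * pi * of_int j * t) = sgn (of_int j) * sin (2 * pi * \<bar>of_int j\<bar> * t)" for t
    proof (cases "0 \<le> j")
      case False
      then have "2 * pi * \<bar>of_int j\<bar> * t = - (2 * pi * of_int j * t)" by simp
      then show ?thesis using False by (simp only: sin_minus) simp
    qed (use False in simp)
    then have "sin (2 * pi * of_int j * t) = sgn (of_int j) * real_trig (2 * k + 2) t" for t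
      unfolding real_trig_even k .
    then show ?thesis by blast
  qed
  then obtain m e where m: "\<And>t. sin (2 * pi * of_int j * t) = e * real_trig m t" by blast
  have "of_real (sin (2 * pi * of_int j * t)) * c = (c * of_real e) * real_trig_of m t" for t
    unfolding m real_trig_of_def by (simp add: mult_ac)
  then show ?case by (simp only: lincomb_span_single)
next
  case (trig_poly_add p q)
  then show ?case by (intro lincomb_span_add)
qed

text \<open>The dual functions are real multiples of the functions themselves, so the factor in
  \<open>adjoint\<close> is exactly this multiple. Its value 2 for cosines and sines accounts for
  the bounds 2 on \<open>y\<close> and \<open>d\<close> in the locale.\<close>

lemma trig_system_real_trig:
  "trig_system (real_trig_of :: nat \<Rightarrow> real \<Rightarrow> 'k::{real_normed_field,euclidean_space})
    (\<lambda>k t. of_real (trig_weight k * real_trig k t)) trig_weight 2"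
proof -
  have w: "1 \<le> trig_weight k" "trig_weight k \<le> 2" for k by (simp_all add: trig_weight_def)
  have cont: "continuous_on UNIV (\<lambda>t. of_real (c * real_trig k t) :: 'k)" for c k
    by (rule continuous_on_of_real[OF continuous_on_mult[OF continuous_on_const continuous_real_trig]])
  have meas: "(real_trig_of k :: real \<Rightarrow> 'k) \<in> borel_measurable borel"
    "(\<lambda>t. of_real (trig_weight k * real_trig k t) :: 'k) \<in> borel_measurable borel" for k
    using borel_measurable_continuous_onI[OF cont[of 1 k]] borel_measurable_continuous_onI[OF cont[of "trig_weight k" k]]
    unfolding real_trig_of_def[abs_def] by simp_all
  have bound: "norm (real_trig_of k t :: 'k) \<le> 1" "norm (of_real (trig_weight k * real_trig k t) :: 'k) \<le> 2" for k t
  proof -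
    show "norm (real_trig_of k t :: 'k) \<le> 1" by (simp add: real_trig_of_def abs_real_trig_le_1)
    have "trig_weight k * \<bar>real_trig k t\<bar> \<le> 2 * 1"
      using w[of k] by (intro mult_mono abs_real_trig_le_1) simp_all
    then show "norm (of_real (trig_weight k * real_trig k t) :: 'k) \<le> 2"
      using w[of k] unfolding norm_of_real abs_mult by simp
  qed
  have adj: "c \<bullet> (u * of_real (trig_weight k * real_trig k t)) = trig_weight k * (u \<bullet> (c * real_trig_of k t))"
    for c u :: 'k and k t
    unfolding real_trig_of_def inner_mult_right' by (simp add: inner_commute)
  have biorth: "(\<integral>t. real_trig_of j t * of_real (trig_weight k * real_trig k t) \<partial>leb) = (if j = k then 1 else (0::'k))" for j k
  proof -
    have "(\<integral>t. real_trig_of j t * of_real (trig_weight k * real_trig k t) \<partial>leb)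
        = (\<integral>t. of_real (trig_weight k * (real_trig j t * real_trig k t)) \<partial>leb :: 'k)"
      by (simp add: real_trig_of_def mult_ac)
    also have "\<dots> = of_real (\<integral>t. trig_weight k * (real_trig j t * real_trig k t) \<partial>leb)"
      by (rule integral_of_real, rule integrable_leb_continuous)
         (rule continuous_on_mult[OF continuous_on_const continuous_on_mult[OF continuous_real_trig continuous_real_trig]])
    also have "\<dots> = (if j = k then 1 else 0)"
      using w[of k] by (simp add: integral_real_trig_mult)
    finally show ?thesis .
  qed
  have kernel: "norm (\<Sum>k<n. real_trig_of k s * of_real (trig_weight k * real_trig k t) :: 'k) * \<bar>\<bar>s\<bar> - \<bar>t\<bar>\<bar> \<le> 2"
    if st: "\<bar>s\<bar> \<le> 1/2" "\<bar>t\<bar> \<le> 1/2" for s t n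
  proof -
    have "(\<Sum>k<n. real_trig_of k s * of_real (trig_weight k * real_trig k t) :: 'k)
        = of_real (\<Sum>k<n. trig_weight k * (real_trig k s * real_trig k t))"
      unfolding real_trig_of_def of_real_sum of_real_mult by (simp only: mult_ac)
    then show ?thesis using real_trig_kernel_bound[OF st, of n] by (simp only: norm_of_real)
  qed
  have near: "norm (real_trig_of k t - 1 :: 'k) \<le> 2 * pi * real k * \<bar>t\<bar>" if k: "odd k" for k t
  proof -
    obtain j where j: "k = 2 * j + 1" using k by (rule oddE)
    let ?u = "2 * pi * real (j + 1) * t"
    have "real_trig_of k t - 1 = (of_real (cos ?u - 1) :: 'k)"
      unfolding real_trig_of_def j real_trig_odd by simp
    then have "norm (real_trig_of k t - 1 :: 'k) = \<bar>cos ?u - 1\<bar>"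
      by (simp only: norm_of_real)
    also have "\<dots> = \<bar>Re (cis ?u - 1)\<bar>" by simp
    also have "\<dots> \<le> norm (cis ?u - 1)" by (rule abs_Re_le_cmod)
    also have "\<dots> \<le> \<bar>?u\<bar>" by (rule norm_cis_minus_one_le)
    also have "\<dots> = 2 * pi * real (j + 1) * \<bar>t\<bar>" by (simp add: abs_mult)
    also have "\<dots> \<le> 2 * pi * real k * \<bar>t\<bar>"
      by (intro mult_right_mono mult_left_mono) (simp_all add: j)
    finally show ?thesis .
  qed
  have odd0: "real_trig k 0 = 1" "trig_weight k = 2" if "odd k" for k
    using that by (auto simp: real_trig_def trig_weight_def odd_pos)
  have near': "norm (of_real (trig_weight k * real_trig k t) - of_real (trig_weight k * real_trig k 0) :: 'k)
      \<le> 4 * pi * real k * \<bar>t\<bar>" if k: "odd k" for k t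
  proof -
    have "of_real (trig_weight k * real_trig k t) - of_real (trig_weight k * real_trig k 0) = (2 * (real_trig_of k t - 1) :: 'k)"
      by (simp add: odd0[OF k] real_trig_of_def)
    also have "norm \<dots> = 2 * norm (real_trig_of k t - 1 :: 'k)" unfolding norm_mult by simp
    also have "\<dots> \<le> 2 * (2 * pi * real k * \<bar>t\<bar>)" by (rule mult_left_mono[OF near[OF k]]) simp
    finally show ?thesis by simp
  qed
  have at0: "1 \<le> norm (of_real (trig_weight k * real_trig k 0) :: 'k)" if "odd k" for k
    by (simp add: odd0[OF that])
  show ?thesis
    by (rule trig_system.intro[OF meas bound w adj biorth kernel trig_poly_in_span_real_trig near near' at0])
qed

lemma real_trig_of_complex: "real_trig_complex = real_trig_of"
  by (simp add: fun_eq_iff real_trig_complex_def real_trig_of_def)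

lemma real_trig_of_real: "real_trig = real_trig_of"
  by (simp add: fun_eq_iff real_trig_of_def)

theorem theorem1p3:
  fixes \<alpha> q r :: real
  assumes "0 \<le> \<alpha>" and "\<alpha> < 1"
    and "q = 2 / (1 + \<alpha>)" and "r = 2 / (1 - \<alpha>)"
  shows "(1 < q \<and> q \<le> 2 \<and> 2 \<le> r) \<and>
         (J_B trig (H_complex (- \<alpha>)) = {2..\<infinity>} \<and>
          J_B real_trig_complex (H_complex (- \<alpha>)) = {2..\<infinity>} \<and>
          J_B real_trig (H_real (- \<alpha>)) = {2..\<infinity>}) \<and>
         (J_H trig (H_complex (- \<alpha>)) = {1..ereal q} \<and>
          J_H real_trig_complex (H_complex (- \<alpha>)) = {1..ereal q} \<and>
          J_H real_trig (H_real (- \<alpha>)) = {1..ereal q}) \<and>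
         (J_B trig (H_complex \<alpha>) = {ereal r..\<infinity>} \<and>
          J_B real_trig_complex (H_complex \<alpha>) = {ereal r..\<infinity>} \<and>
          J_B real_trig (H_real \<alpha>) = {ereal r..\<infinity>}) \<and>
         (J_H trig (H_complex \<alpha>) = {1..2} \<and>
          J_H real_trig_complex (H_complex \<alpha>) = {1..2} \<and>
          J_H real_trig (H_real \<alpha>) = {1..2})"
proof -
  \<comment> \<open>Three instances: the exponentials, and the real system over each of the two
    scalar fields.\<close>
  interpret t: trig_system trig "\<lambda>k. tau (- trig_freq k)" "\<lambda>_. 1" "1/2"
    by (rule trig_system_trig)
  interpret c: trig_system "real_trig_of :: nat \<Rightarrow> real \<Rightarrow> complex"
    "\<lambda>k t. of_real (trig_weight k * real_trig k t)" trig_weight 2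
    by (rule trig_system_real_trig)
  interpret r: trig_system "real_trig_of :: nat \<Rightarrow> real \<Rightarrow> real"
    "\<lambda>k t. of_real (trig_weight k * real_trig k t)" trig_weight 2
    by (rule trig_system_real_trig)
  have "1 < q \<and> q \<le> 2 \<and> 2 \<le> r"
    using assms by (simp add: pos_less_divide_eq pos_divide_le_eq pos_le_divide_eq)
  then show ?thesis
    unfolding H_complex_def H_real_def real_trig_of_complex real_trig_of_real
    using t.J_B_H_nonpos t.J_B_H_nonneg t.J_H_H_nonpos t.J_H_H_nonneg
      c.J_B_H_nonpos c.J_B_H_nonneg c.J_H_H_nonpos c.J_H_H_nonneg
      r.J_B_H_nonpos r.J_B_H_nonneg r.J_H_H_nonpos r.J_H_H_nonneg assms
    by simp
qed

end
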